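(* Let $\mathcal{T}$ be a finite simplicial complex equipped with an affine realization. Suppose that for each $k$ a linear space $\Gamma^k(\mathcal{T})$ is given with $\Lambda^k(\mathcal{T})\subset\Gamma^k(\mathcal{T})\subset\Omega^k(\mathcal{T})$, such that $\mathrm{d}$ maps $\Gamma^k(\mathcal{T})$ into $\Gamma^{k+1}(\mathcal{T})$. Suppose that for each $k$ there are linear projectors $\Pi_\Gamma:\Omega^k(\mathcal{T})\to\Gamma^k(\mathcal{T})$ with range $\Gamma^k(\mathcal{T})$, and linear projectors $\Pi_\Lambda:\Omega^k(\mathcal{T})\to\Lambda^k(\mathcal{T})$ with range $\Lambda^k(\mathcal{T})$, and that both families of projectors commute with the exterior derivative. Suppose that $\Pi_\Lambda\circ\Pi_\Gamma=\Pi_\Lambda$. Then the inclusions $\Lambda^k(\mathcal{T})\to\Gamma^k(\mathcal{T})$ induce isomorphisms in cohomology $\mathrm{H}^k\Lambda^\bullet(\mathcal{T})\to\mathrm{H}^k\Gamma^\bullet(\mathcal{T})$ for every $k$.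
   Context: A simplicial complex is a set $\mathcal{T}$ of finite non-empty sets (simplexes) such that every non-empty subset of an element of $\mathcal{T}$ is in $\mathcal{T}$; all simplicial complexes are finite. A $k$-simplex is a simplex with $k+1$ elements (vertices); $\mathcal{T}^k$ is the set of $k$-simplexes of $\mathcal{T}$. For each $k$-simplex $T$ a bijection $\sigma_T:\{0,\dots,k\}\to T$ is fixed. An affine realization of $\mathcal{T}$ is a choice, for each $T\in\mathcal{T}$ with $T\in \mathcal{T}^k$, of an injection $\rho_T:T\to V$ into a (finite dimensional real) affine space, possibly depending on $T$, such that $\rho_T(T)$ has $k$-dimensional affine span; $|T|$ denotes the closed convex hull of $\rho_T(T)$. For $T'\subset T$ in $\mathcal{T}$, $i_{TT'}:|T'|\to|T|$ is the unique affine map with $i_{TT'}(\rho_{T'}(x))=\rho_T(x)$ for $x\in T'$. $\Omega^k(\mathcal{T})$ (compatible $k$-forms) is the space of families $(u_T)_{T\in\mathcal{T}}$ with $u_T$ a smooth $k$-form on $|T|$ (one having a smooth extension to the affine span of $|T|$), such that $(i_{TT'})^\star u_T=u_{T'}$ whenever $T'\subset T$. The exterior derivative $\mathrm{d}$ and the wedge product act componentwise, and $\Omega^\bullet(\mathcal{T})$ is a complex with differential $\mathrm{d}$. For a vertex $i$, $\lambda_i\in\Omega^0(\mathcal{T})$ is the barycentric coordinate relative to $i$ on each $|T|$ with $i\in T$, and $0$ on $|T|$ when $i\notin T$. For $T\in\mathcal{T}^k$, $$\lambda_T=k!\sum_{i=0}^k(-1)^i\lambda_{\sigma_T(i)}\,\mathrm{d}\lambda_{\sigma_T(0)}\wedge\cdots\widehat{\mathrm{d}\lambda_{\sigma_T(i)}}\cdots\wedge\mathrm{d}\lambda_{\sigma_T(k)}$$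 (hat meaning omission; for $k=0$, $\lambda_{\{i\}}=\lambda_i$). $\Lambda^k(\mathcal{T})\subset\Omega^k(\mathcal{T})$ is the linear span of $(\lambda_T)_{T\in\mathcal{T}^k}$; $\mathrm{d}$ maps $\Lambda^k(\mathcal{T})$ into $\Lambda^{k+1}(\mathcal{T})$. For a complex $A^\bullet$ of vector spaces, $\mathrm{H}^kA^\bullet=\ker(A^k\to A^{k+1})/\operatorname{im}(A^{k-1}\to A^k)$, with $A^{-1}=0$. *)

theory Defs
  imports
    "HOL-Analysis.Analysis"
    "HOL-Library.Function_Algebras"
    "HOL-Combinatorics.Permutations"
begin

section \<open>Pointwise vector space structure on functions\<close>

instantiation "fun" :: (type, real_vector) real_vector
begin

definition scaleR_fun :: "real \<Rightarrow> ('a \<Rightarrow> 'b) \<Rightarrow> 'a \<Rightarrow> 'b"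
  where "scaleR_fun r f = (\<lambda>x. r *\<^sub>R f x)"

instance
  by standard (auto simp: scaleR_fun_def fun_eq_iff scaleR_add_right scaleR_add_left)

end


section \<open>Linear maps between subspaces, and projectors\<close>

definition linear_map_on :: "'f::real_vector set \<Rightarrow> ('f \<Rightarrow> 'f) \<Rightarrow> bool" where
  "linear_map_on W P \<longleftrightarrow>
     (\<forall>u\<in>W. \<forall>v\<in>W. P (u + v) = P u + P v) \<and> (\<forall>a. \<forall>u\<in>W. P (a *\<^sub>R u) = a *\<^sub>R P u)"

definition linear_projector :: "'f::real_vector set \<Rightarrow> 'f set \<Rightarrow> ('f \<Rightarrow> 'f) \<Rightarrow> bool" where
  "linear_projector W R P \<longleftrightarrow> linear_map_on W P \<and> P ` W = R \<and> (\<forall>u\<in>W. P (P u) = P u)"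


section \<open>Cohomology\<close>

text \<open>A complex is a sequence of subspaces \<open>A k\<close> of one real vector space together with maps
  \<open>d k\<close> sending \<open>A k\<close> into \<open>A (Suc k)\<close>. Cohomology classes are cosets.\<close>

definition cocycles :: "(nat \<Rightarrow> 'f \<Rightarrow> 'f) \<Rightarrow> (nat \<Rightarrow> 'f::real_vector set) \<Rightarrow> nat \<Rightarrow> 'f set" where
  "cocycles d A k = {u \<in> A k. d k u = 0}"

definition coboundaries :: "(nat \<Rightarrow> 'f \<Rightarrow> 'f) \<Rightarrow> (nat \<Rightarrow> 'f::real_vector set) \<Rightarrow> nat \<Rightarrow> 'f set" where
  "coboundaries d A k = (case k of 0 \<Rightarrow> {0} | Suc j \<Rightarrow> d j ` A j)"

definition coh_class ::
    "(nat \<Rightarrow> 'f \<Rightarrow> 'f) \<Rightarrow> (nat \<Rightarrow> 'f::real_vector set) \<Rightarrow> nat \<Rightarrow> 'f \<Rightarrow> 'f set" where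
  "coh_class d A k u = {u + b | b. b \<in> coboundaries d A k}"

definition cohomology ::
    "(nat \<Rightarrow> 'f \<Rightarrow> 'f) \<Rightarrow> (nat \<Rightarrow> 'f::real_vector set) \<Rightarrow> nat \<Rightarrow> 'f set set" where
  "cohomology d A k = coh_class d A k ` cocycles d A k"

text \<open>The vector space operations of the quotient: each union is over equal sets.\<close>

definition coh_add ::
    "(nat \<Rightarrow> 'f \<Rightarrow> 'f) \<Rightarrow> (nat \<Rightarrow> 'f::real_vector set) \<Rightarrow> nat \<Rightarrow> 'f set \<Rightarrow> 'f set \<Rightarrow> 'f set" where
  "coh_add d A k X Y = (\<Union>x\<in>X. \<Union>y\<in>Y. coh_class d A k (x + y))"

definition coh_scale ::
    "(nat \<Rightarrow> 'f \<Rightarrow> 'f) \<Rightarrow> (nat \<Rightarrow> 'f::real_vector set) \<Rightarrow> nat \<Rightarrow> real \<Rightarrow> 'f set \<Rightarrow> 'f set" where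
  "coh_scale d A k a X = (\<Union>x\<in>X. coh_class d A k (a *\<^sub>R x))"

text \<open>For a subcomplex \<open>A\<close> of \<open>B\<close>: the rule \<open>[u]\<^bsub>A\<^esub> \<mapsto> [u]\<^bsub>B\<^esub>\<close> on cocycles
  \<open>u\<close> of \<open>A\<close> is a well-defined linear bijection in degree \<open>k\<close>.\<close>

definition inclusion_induces_iso ::
    "(nat \<Rightarrow> 'f \<Rightarrow> 'f) \<Rightarrow> (nat \<Rightarrow> 'f::real_vector set) \<Rightarrow> (nat \<Rightarrow> 'f set) \<Rightarrow> nat \<Rightarrow> bool" where
  "inclusion_induces_iso d A B k \<longleftrightarrow>
     (\<exists>\<phi>. (\<forall>u\<in>cocycles d A k. \<phi> (coh_class d A k u) = coh_class d B k u) \<and>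
          bij_betw \<phi> (cohomology d A k) (cohomology d B k) \<and>
          (\<forall>X\<in>cohomology d A k. \<forall>Y\<in>cohomology d A k.
             \<phi> (coh_add d A k X Y) = coh_add d B k (\<phi> X) (\<phi> Y)) \<and>
          (\<forall>a. \<forall>X\<in>cohomology d A k. \<phi> (coh_scale d A k a X) = coh_scale d B k a (\<phi> X)))"


section \<open>Simplicial complexes and affine realizations\<close>

definition abstract_simplicial_complex :: "'v set set \<Rightarrow> bool" where
  "abstract_simplicial_complex \<T> \<longleftrightarrow>
     finite \<T> \<and> (\<forall>T\<in>\<T>. finite T \<and> T \<noteq> {}) \<and> (\<forall>T\<in>\<T>. \<forall>T'. T' \<subseteq> T \<and> T' \<noteq> {} \<longrightarrow> T' \<in> \<T>)"

definition simplexes :: "'v set set \<Rightarrow> nat \<Rightarrow> 'v set set" where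
  "simplexes \<T> k = {T \<in> \<T>. card T = k + 1}"

definition vertex_numbering :: "'v set set \<Rightarrow> ('v set \<Rightarrow> nat \<Rightarrow> 'v) \<Rightarrow> bool" where
  "vertex_numbering \<T> \<sigma> \<longleftrightarrow> (\<forall>k. \<forall>T\<in>simplexes \<T> k. bij_betw (\<sigma> T) {0..k} T)"

text \<open>The affine space \<open>V T\<close>, which depends on \<open>T\<close>, is an affine subspace of one Euclidean
  space. As the complex is finite, this covers every choice of finite-dimensional real affine
  spaces; the Euclidean norm of the ambient space serves only for its topology.\<close>

definition affine_realization ::
    "'v set set \<Rightarrow> ('v set \<Rightarrow> 'a::euclidean_space set) \<Rightarrow> ('v set \<Rightarrow> 'v \<Rightarrow> 'a) \<Rightarrow> bool" where
  "affine_realization \<T> V \<rho> \<longleftrightarrow>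
     (\<forall>k. \<forall>T\<in>simplexes \<T> k.
        affine (V T) \<and> \<rho> T ` T \<subseteq> V T \<and> inj_on (\<rho> T) T \<and> aff_dim (affine hull (\<rho> T ` T)) = int k)"

definition carrier_of :: "('v set \<Rightarrow> 'v \<Rightarrow> 'a::euclidean_space) \<Rightarrow> 'v set \<Rightarrow> 'a set" where
  "carrier_of \<rho> T = convex hull (\<rho> T ` T)"

text \<open>The map \<open>i\<close> from \<open>|T'|\<close> to \<open>|T|\<close>. It is represented by an affine map of the whole
  ambient space, of which only the restriction to the affine span of \<open>|T'|\<close> is determined
  and used.\<close>

definition face_map ::
    "('v set \<Rightarrow> 'v \<Rightarrow> 'a::euclidean_space) \<Rightarrow> 'v set \<Rightarrow> 'v set \<Rightarrow> 'a \<Rightarrow> 'a" where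
  "face_map \<rho> T T' =
     (SOME f. (\<exists>c l. linear l \<and> f = (\<lambda>x. c + l x)) \<and> (\<forall>i\<in>T'. f (\<rho> T' i) = \<rho> T i))"


section \<open>Smooth differential forms on a convex set\<close>

text \<open>Let \<open>S\<close> be convex (in the application, \<open>|T|\<close>) and \<open>L = tangent S\<close> the direction of its
  affine span. A \<open>k\<close>-form on \<open>S\<close> takes a point of \<open>S\<close> and a list of \<open>k\<close> vectors of \<open>L\<close>.
  By convention it is 0 at all other arguments, so that equality of forms is equality of
  functions.\<close>

definition tangent :: "'a::euclidean_space set \<Rightarrow> 'a set" where
  "tangent S = {x - y | x y. x \<in> affine hull S \<and> y \<in> affine hull S}"

definition vectors :: "'a::euclidean_space set \<Rightarrow> nat \<Rightarrow> 'a list set" where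
  "vectors S k = {vs. length vs = k \<and> set vs \<subseteq> tangent S}"

definition alternating_form :: "'a::euclidean_space set \<Rightarrow> nat \<Rightarrow> ('a list \<Rightarrow> real) \<Rightarrow> bool" where
  "alternating_form S k \<omega> \<longleftrightarrow>
     (\<forall>vs. vs \<notin> vectors S k \<longrightarrow> \<omega> vs = 0) \<and>
     (\<forall>vs\<in>vectors S k. \<forall>i<k. \<forall>x\<in>tangent S. \<forall>y\<in>tangent S. \<forall>a b.
        \<omega> (vs[i := a *\<^sub>R x + b *\<^sub>R y]) = a * \<omega> (vs[i := x]) + b * \<omega> (vs[i := y])) \<and>
     (\<forall>vs\<in>vectors S k. \<forall>i j. i < j \<and> j < k \<and> vs ! i = vs ! j \<longrightarrow> \<omega> vs = 0)"

text \<open>Within a convex set \<open>A\<close> the Frechet derivative is uniquely determined on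
  \<open>tangent A\<close>, and only there; it agrees with that of any differentiable extension to the affine span.\<close>

fun Ck_on :: "nat \<Rightarrow> 'a::euclidean_space set \<Rightarrow> ('a \<Rightarrow> real) \<Rightarrow> bool" where
  "Ck_on 0 A f \<longleftrightarrow> continuous_on A f"
| "Ck_on (Suc n) A f \<longleftrightarrow>
     f differentiable_on A \<and>
     (\<forall>v\<in>tangent A. Ck_on n A (\<lambda>x. frechet_derivative f (at x within A) v))"

definition smooth_on :: "'a::euclidean_space set \<Rightarrow> ('a \<Rightarrow> real) \<Rightarrow> bool" where
  "smooth_on A f \<longleftrightarrow> (\<forall>n. Ck_on n A f)"

definition smooth_form ::
    "'a::euclidean_space set \<Rightarrow> nat \<Rightarrow> ('a \<Rightarrow> 'a list \<Rightarrow> real) \<Rightarrow> bool" where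
  "smooth_form S k u \<longleftrightarrow>
     (\<forall>x. x \<notin> S \<longrightarrow> u x = 0) \<and>
     (\<exists>U. (\<forall>x\<in>affine hull S. alternating_form S k (U x)) \<and>
          (\<forall>vs\<in>vectors S k. smooth_on (affine hull S) (\<lambda>x. U x vs)) \<and>
          (\<forall>x\<in>S. u x = U x))"

definition pullback ::
    "('a::euclidean_space \<Rightarrow> 'a) \<Rightarrow> 'a set \<Rightarrow> nat \<Rightarrow> ('a \<Rightarrow> 'a list \<Rightarrow> real) \<Rightarrow> 'a \<Rightarrow> 'a list \<Rightarrow> real" where
  "pullback f S k u x vs =
     (if x \<in> S \<and> vs \<in> vectors S k
      then u (f x) (map (frechet_derivative f (at x within S)) vs) else 0)"

text \<open>Exterior derivative and wedge product are normalized as in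
  \<open>(\<alpha>\<^sub>1 \<and> \<dots> \<and> \<alpha>\<^sub>k) (v\<^sub>1, \<dots>, v\<^sub>k) = det (\<alpha>\<^sub>i v\<^sub>j)\<close>.\<close>

definition ext_deriv ::
    "'a::euclidean_space set \<Rightarrow> nat \<Rightarrow> ('a \<Rightarrow> 'a list \<Rightarrow> real) \<Rightarrow> 'a \<Rightarrow> 'a list \<Rightarrow> real" where
  "ext_deriv S k u x vs =
     (if x \<in> S \<and> vs \<in> vectors S (Suc k)
      then \<Sum>i\<le>k. (-1) ^ i *
             frechet_derivative (\<lambda>y. u y (take i vs @ drop (Suc i) vs)) (at x within S) (vs ! i)
      else 0)"

definition wedge :: "nat \<Rightarrow> nat \<Rightarrow> ('a list \<Rightarrow> real) \<Rightarrow> ('a list \<Rightarrow> real) \<Rightarrow> 'a list \<Rightarrow> real" where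
  "wedge k l \<alpha> \<beta> vs =
     (if length vs = k + l
      then (\<Sum>\<pi> | \<pi> permutes {..<k + l}.
              of_int (sign \<pi>) * \<alpha> (map (\<lambda>i. vs ! \<pi> i) [0..<k]) * \<beta> (map (\<lambda>i. vs ! \<pi> i) [k..<k + l]))
           / (fact k * fact l)
      else 0)"


section \<open>Compatible forms\<close>

text \<open>Families of forms indexed by the simplexes of \<open>\<T>\<close>; the components at sets outside \<open>\<T>\<close>
  are 0 by convention.\<close>

type_synonym ('v, 'a) forms = "'v set \<Rightarrow> 'a \<Rightarrow> 'a list \<Rightarrow> real"

definition Omega ::
    "'v set set \<Rightarrow> ('v set \<Rightarrow> 'v \<Rightarrow> 'a::euclidean_space) \<Rightarrow> nat \<Rightarrow> ('v, 'a) forms set" where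
  "Omega \<T> \<rho> k =
     {u. (\<forall>T\<in>\<T>. smooth_form (carrier_of \<rho> T) k (u T)) \<and>
         (\<forall>T. T \<notin> \<T> \<longrightarrow> u T = 0) \<and>
         (\<forall>T\<in>\<T>. \<forall>T'\<in>\<T>. T' \<subseteq> T \<longrightarrow>
            pullback (face_map \<rho> T T') (carrier_of \<rho> T') k (u T) = u T')}"

definition dd ::
    "'v set set \<Rightarrow> ('v set \<Rightarrow> 'v \<Rightarrow> 'a::euclidean_space) \<Rightarrow> nat \<Rightarrow> ('v, 'a) forms \<Rightarrow> ('v, 'a) forms" where
  "dd \<T> \<rho> k u = (\<lambda>T. if T \<in> \<T> then ext_deriv (carrier_of \<rho> T) k (u T) else 0)"

definition wedge_forms ::
    "nat \<Rightarrow> nat \<Rightarrow> ('v, 'a) forms \<Rightarrow> ('v, 'a) forms \<Rightarrow> ('v, 'a) forms" where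
  "wedge_forms k l u w = (\<lambda>T x. wedge k l (u T x) (w T x))"

text \<open>The constant function 1 as a 0-form, which is the empty wedge product.\<close>

definition one_form0 ::
    "'v set set \<Rightarrow> ('v set \<Rightarrow> 'v \<Rightarrow> 'a::euclidean_space) \<Rightarrow> ('v, 'a) forms" where
  "one_form0 \<T> \<rho> T x vs = (if T \<in> \<T> \<and> x \<in> carrier_of \<rho> T \<and> vs = [] then 1 else 0)"

fun wedge_list ::
    "'v set set \<Rightarrow> ('v set \<Rightarrow> 'v \<Rightarrow> 'a::euclidean_space) \<Rightarrow> ('v, 'a) forms list \<Rightarrow> ('v, 'a) forms" where
  "wedge_list \<T> \<rho> [] = one_form0 \<T> \<rho>"
| "wedge_list \<T> \<rho> (u # us) = wedge_forms 1 (length us) u (wedge_list \<T> \<rho> us)"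


section \<open>Whitney forms\<close>

text \<open>The barycentric coordinates of \<open>x \<in> |T|\<close>; their values at the vertices of \<open>T\<close> are unique.\<close>

definition bary_coords :: "('v set \<Rightarrow> 'v \<Rightarrow> 'a::euclidean_space) \<Rightarrow> 'v set \<Rightarrow> 'a \<Rightarrow> 'v \<Rightarrow> real" where
  "bary_coords \<rho> T x = (SOME c. sum c T = 1 \<and> (\<Sum>i\<in>T. c i *\<^sub>R \<rho> T i) = x)"

definition lam ::
    "'v set set \<Rightarrow> ('v set \<Rightarrow> 'v \<Rightarrow> 'a::euclidean_space) \<Rightarrow> 'v \<Rightarrow> ('v, 'a) forms" where
  "lam \<T> \<rho> i T x vs =
     (if T \<in> \<T> \<and> i \<in> T \<and> x \<in> carrier_of \<rho> T \<and> vs = [] then bary_coords \<rho> T x i else 0)"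

text \<open>The form attached to a \<open>k\<close>-simplex \<open>T\<close>; the product of a function and a form is its wedge
  product with that function as a 0-form.\<close>

definition whitney_form ::
    "'v set set \<Rightarrow> ('v set \<Rightarrow> 'v \<Rightarrow> 'a::euclidean_space) \<Rightarrow> ('v set \<Rightarrow> nat \<Rightarrow> 'v) \<Rightarrow>
     nat \<Rightarrow> 'v set \<Rightarrow> ('v, 'a) forms" where
  "whitney_form \<T> \<rho> \<sigma> k T =
     fact k *\<^sub>R (\<Sum>i\<le>k. (-1) ^ i *\<^sub>R
       wedge_forms 0 k (lam \<T> \<rho> (\<sigma> T i))
         (wedge_list \<T> \<rho> (map (\<lambda>j. dd \<T> \<rho> 0 (lam \<T> \<rho> (\<sigma> T j))) [j \<leftarrow> [0..<Suc k]. j \<noteq> i])))"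

definition Lambda ::
    "'v set set \<Rightarrow> ('v set \<Rightarrow> 'v \<Rightarrow> 'a::euclidean_space) \<Rightarrow> ('v set \<Rightarrow> nat \<Rightarrow> 'v) \<Rightarrow>
     nat \<Rightarrow> ('v, 'a) forms set" where
  "Lambda \<T> \<rho> \<sigma> k = span (whitney_form \<T> \<rho> \<sigma> k ` simplexes \<T> k)"

end

(* Surjectivity on cohomology is the simplicial de Rham theorem: a closed compatible form u is cohomologous to
   an element of Lambda. Once u = w + d v with w in Lambda, the projectors give
   u - Pi_Lambda u = d (Pi_Gamma v - Pi_Lambda v). Injectivity follows by applying Pi_Lambda to u = d z.

   The de Rham theorem is proved by a Cech - de Rham zigzag for the stars of the vertices, with the barycentric
   coordinates as partition of unity. Starting from eta_() = u, choose for a tuple I of vertices a primitive eta_I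
   of the alternating sum of the eta_J, J being I with one entry omitted, by contracting each simplex to a vertex
   of I; as this vertex depends only on the set I, eta_I is alternating in I and compatible with faces.
   After k steps the alternating sums are constants c_I. With R_n = sum_I dlambda_I ^ eta_I over tuples of length n,
   and Q_n = sum_(j,I) lambda_j dlambda_I ^ eta_(j,I), one has d Q_n = R_(n+1) + (-1)^n R_n, so that u = R_0 is
   cohomologous to a multiple of R_k, which is the Whitney form with the coefficients c_I. *)
theory Submission
  imports Defs "HOL-Combinatorics.Multiset_Permutations"
begin


section \<open>Signed sums over the deletions of one list entry\<close>

text \<open>The operator \<open>alt_sum\<close> serves as exterior derivative, as wedge product with
  a covector and as Cech differential. Exchanging the two deletions of a double
  \<open>alt_sum\<close> changes the sign; this one fact lets d anticommute with a constant
  covector, lets the dlambda_i anticommute, and makes the Cech differential square to zero. Analysis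
  takes place in the ambient space: every smooth form on a simplex is the restriction of a smooth
  form on the whole space. The forms eta_I exist only on simplexes that contain I. Extension by zero
  is compatible, because on a face that misses a vertex of (j, I) one of the factors lambda_j,
  dlambda_i vanishes. The formula for d Q_n and the passage from R_k to constants rest on sum
  lambda_j = 1 and sum dlambda_i = 0: summed over all tuples, the term that omits j survives by the
  first identity, and the terms that omit an entry of I vanish by the second. Tuples run over all
  orders and repetitions. Alternation removes the repetitions; once one vertex is singled out as j,
  the k! orders of the others produce the factor k! of the Whitney form.\<close>

fun alt_sum :: "('b \<Rightarrow> 'b list \<Rightarrow> 'c::real_vector) \<Rightarrow> 'b list \<Rightarrow> 'c" where
  "alt_sum G [] = 0"
| "alt_sum G (x # xs) = G x xs - alt_sum (\<lambda>y ys. G y (x # ys)) xs"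

lemma alt_sum_eq_sum:
  "alt_sum G xs = (\<Sum>i<length xs. (-1) ^ i *\<^sub>R G (xs ! i) (take i xs @ drop (Suc i) xs))"
proof (induction xs arbitrary: G)
  case (Cons x xs)
  then show ?case
    by (simp only: alt_sum.simps Cons list.size add_0_right add_Suc_right sum.lessThan_Suc_shift)
       (simp add: sum_negf)
qed simp

text \<open>The hypothesis uses multisets because the recursion moves entries of the list into the
  argument of \<open>G\<close>; the length and the set of entries of \<open>ys\<close> can be read
  off from it.\<close>

lemma alt_sum_cong:
  assumes "\<And>y ys. mset (y # ys) = mset xs \<Longrightarrow> G y ys = H y ys"
  shows "alt_sum G xs = alt_sum H xs"
  using assms
proof (induction xs arbitrary: G H)
  case (Cons x xs)
  have "alt_sum (\<lambda>y ys. G y (x # ys)) xs = alt_sum (\<lambda>y ys. H y (x # ys)) xs"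
    by (rule Cons.IH) (use Cons.prems in \<open>auto simp: add_mset_commute\<close>)
  then show ?case using Cons.prems by simp
qed simp

text \<open>Derivatives and integrals are additive only on smooth or continuous functions, whence
  the domain \<open>W\<close>. Membership of the partial sums is carried along because the induction
  uses it.\<close>

lemma alt_sum_additive_on:
  assumes "\<And>y ys. mset (y # ys) = mset xs \<Longrightarrow> G y ys \<in> W"
    and "0 \<in> W" and "\<And>a b. a \<in> W \<Longrightarrow> b \<in> W \<Longrightarrow> a - b \<in> W"
    and "\<phi> 0 = 0" and "\<And>a b. a \<in> W \<Longrightarrow> b \<in> W \<Longrightarrow> \<phi> (a - b) = \<phi> a - \<phi> b"
  shows "alt_sum G xs \<in> W \<and> \<phi> (alt_sum G xs) = alt_sum (\<lambda>y ys. \<phi> (G y ys)) xs"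
  using assms(1)
proof (induction xs arbitrary: G)
  case (Cons x xs)
  have "alt_sum (\<lambda>y ys. G y (x # ys)) xs \<in> W \<and>
      \<phi> (alt_sum (\<lambda>y ys. G y (x # ys)) xs) = alt_sum (\<lambda>y ys. \<phi> (G y (x # ys))) xs"
    by (rule Cons.IH) (use Cons.prems in \<open>auto simp: add_mset_commute\<close>)
  then show ?case using Cons.prems assms by auto
qed (use assms in auto)

lemma alt_sum_additive:
  assumes "\<And>a b. \<phi> (a - b) = \<phi> a - \<phi> b"
  shows "\<phi> (alt_sum G xs) = alt_sum (\<lambda>y ys. \<phi> (G y ys)) xs"
proof -
  have "\<phi> 0 = 0" using assms[of 0 0] by simp
  with alt_sum_additive_on[of xs G UNIV \<phi>] assms show ?thesis by auto
qed

lemma alt_sum_in: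
  assumes "\<And>y ys. mset (y # ys) = mset xs \<Longrightarrow> G y ys \<in> W"
    and "0 \<in> W" and "\<And>a b. a \<in> W \<Longrightarrow> b \<in> W \<Longrightarrow> a - b \<in> W"
  shows "alt_sum G xs \<in> W"
  using alt_sum_additive_on[of xs G W id] assms by auto

lemma alt_sum_apply: "alt_sum G xs a = alt_sum (\<lambda>y ys. G y ys a) xs"
  by (rule alt_sum_additive[where \<phi> = "\<lambda>f. f a"]) simp

lemma alt_sum_diff: "alt_sum (\<lambda>y ys. G y ys - H y ys) xs = alt_sum G xs - alt_sum H xs"
  by (induction xs arbitrary: G H) auto

lemma alt_sum_add: "alt_sum (\<lambda>y ys. G y ys + H y ys) xs = alt_sum G xs + alt_sum H xs"
  by (induction xs arbitrary: G H) auto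

lemma alt_sum_zero [simp]: "alt_sum (\<lambda>y ys. 0) xs = 0"
  by (induction xs) auto

lemma alt_sum_uminus: "alt_sum (\<lambda>y ys. - G y ys) xs = - alt_sum G xs"
  by (induction xs arbitrary: G) auto

lemma alt_sum_scaleR: "alt_sum (\<lambda>y ys. c *\<^sub>R G y ys) xs = c *\<^sub>R alt_sum G xs"
  by (induction xs arbitrary: G) (auto simp: scaleR_diff_right)

lemma alt_sum_mult: "alt_sum (\<lambda>y ys. c * G y ys) xs = c * alt_sum G xs" for c :: real
  using alt_sum_scaleR[of c G xs] by simp

lemma alt_sum_map: "alt_sum G (map f xs) = alt_sum (\<lambda>y ys. G (f y) (map f ys)) xs"
  by (induction xs arbitrary: G) auto

text \<open>Of two deleted entries, the one further right has its position lowered by one if the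
  other is deleted first; so the order of deletion costs a sign.\<close>

lemma alt_sum_alt_sum_swap:
  "alt_sum (\<lambda>a ys. alt_sum (\<lambda>b zs. g a b zs) ys) xs
     = - alt_sum (\<lambda>a ys. alt_sum (\<lambda>b zs. g b a zs) ys) xs"
proof (induction xs arbitrary: g)
  case (Cons x xs)
  show ?case using Cons[of "\<lambda>a b zs. g a b (x # zs)"]
    by (simp add: alt_sum_diff)
qed simp

lemma eq_uminus_self: "x = - x \<Longrightarrow> x = 0" for x :: "'c::real_vector"
  using scaleR_2[of x] by (metis add.right_inverse scaleR_eq_0_iff zero_neq_numeral)

text \<open>The summand sees only what is left of the list, so exchanging the two deletions turns
  the sum into its own negative.\<close>

lemma alt_sum_alt_sum_eq_0: "alt_sum (\<lambda>_ ys. alt_sum (\<lambda>_ zs. g zs) ys) xs = 0"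
proof -
  let ?x = "alt_sum (\<lambda>_ ys. alt_sum (\<lambda>_ zs. g zs) ys) xs"
  have "?x = - ?x" by (rule alt_sum_alt_sum_swap)
  then show ?thesis by (rule eq_uminus_self)
qed

section \<open>Alternating functions of lists\<close>

definition swap_antisymmetric :: "('b list \<Rightarrow> 'c::real_vector) \<Rightarrow> bool" where
  "swap_antisymmetric g \<longleftrightarrow> (\<forall>xs a b ys. g (xs @ a # b # ys) = - g (xs @ b # a # ys))"

lemma swap_antisymmetricD:
  "swap_antisymmetric g \<Longrightarrow> g (xs @ a # b # ys) = - g (xs @ b # a # ys)"
  unfolding swap_antisymmetric_def by blast

lemma swap_antisymmetric_Cons: "swap_antisymmetric g \<Longrightarrow> swap_antisymmetric (\<lambda>xs. g (x # xs))"
  unfolding swap_antisymmetric_def by (metis append_Cons)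

text \<open>Deleting \<open>a\<close> (or \<open>b\<close>) from the two lists leaves the same
  remainder, but at neighbouring positions and hence with opposite signs. Every other deletion keeps
  both entries, and \<open>g\<close> supplies the sign.\<close>

lemma swap_antisymmetric_alt_sum:
  assumes "swap_antisymmetric g"
  shows "swap_antisymmetric (alt_sum (\<lambda>_. g))"
proof -
  have "alt_sum (\<lambda>_. g) (xs @ a # b # ys) = - alt_sum (\<lambda>_. g) (xs @ b # a # ys)" for xs a b ys
    using assms
  proof (induction xs arbitrary: g)
    case Nil
    have "alt_sum (\<lambda>_ ws. g (a # b # ws)) ys = - alt_sum (\<lambda>_ ws. g (b # a # ws)) ys"
      unfolding alt_sum_uminus[symmetric]
      by (rule alt_sum_cong) (use swap_antisymmetricD[OF Nil, of "[]" a b] in simp)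
    then show ?case by simp
  next
    case (Cons x xs)
    show ?case
      using Cons.IH[OF swap_antisymmetric_Cons[OF Cons.prems]] swap_antisymmetricD[OF Cons.prems, of "x # xs" a b ys]
      using swap_antisymmetricD[OF Cons.prems, of xs a b ys]
      by simp
  qed
  then show ?thesis unfolding swap_antisymmetric_def by blast
qed

text \<open>Adjacent swaps carry any entry to the front; the prefix \<open>ps\<close> in the
  inductions holds the entries that are already in place.\<close>

lemma swap_invariant_eq:
  assumes inv: "\<And>xs a b ys. g (xs @ a # b # ys) = g (xs @ b # a # ys)"
    and "mset xs = mset ys"
  shows "g xs = g ys"
proof -
  have front: "g (ps @ us @ a # vs) = g (ps @ a # us @ vs)" for ps us a vs
  proof (induction us arbitrary: ps)
    case (Cons u us)
    show ?case using Cons[of "ps @ [u]"] inv[of ps u a "us @ vs"] by simp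
  qed simp
  have "g (ps @ xs) = g (ps @ ys)" for ps
    using assms(2)
  proof (induction xs arbitrary: ys ps)
    case (Cons x xs)
    then have "x \<in> set ys" by (metis list.set_intros(1) set_mset_mset)
    then obtain us vs where ys: "ys = us @ x # vs" by (meson split_list)
    with Cons.prems have "mset xs = mset (us @ vs)" by simp
    from Cons.IH[OF this, of "ps @ [x]"] show ?case
      by (simp add: ys front)
  qed simp
  from this[of "[]"] show ?thesis by simp
qed

lemma swap_antisymmetric_eq_0:
  assumes "swap_antisymmetric g" "\<not> distinct xs"
  shows "g xs = 0"
proof -
  \<comment> \<open>Vanishing of \<open>g\<close> is invariant under swaps, so the equal entries may
    be moved to the front.\<close>
  have inv: "(g (xs @ a # b # ys) = 0) = (g (xs @ b # a # ys) = 0)" for xs a b ys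
    using swap_antisymmetricD[OF assms(1), of xs a b ys] by simp
  obtain as bs cs y where xs: "xs = as @ [y] @ bs @ [y] @ cs"
    using assms(2) not_distinct_decomp by blast
  have "g ([] @ y # y # as @ bs @ cs) = 0"
    using swap_antisymmetricD[OF assms(1), of "[]" y y] by (intro eq_uminus_self)
  with swap_invariant_eq[where g = "\<lambda>xs. g xs = 0", OF inv, of xs "y # y # as @ bs @ cs"] show ?thesis
    by (simp add: xs)
qed

lemma swap_antisymmetric_move:
  assumes "swap_antisymmetric g"
  shows "g (us @ a # vs) = (-1) ^ length us *\<^sub>R g (a # us @ vs)"
proof -
  have "g (ps @ us @ a # vs) = (-1) ^ length us *\<^sub>R g (ps @ a # us @ vs)" for ps
  proof (induction us arbitrary: ps)
    case (Cons u us)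
    show ?case using Cons[of "ps @ [u]"] swap_antisymmetricD[OF assms, of ps u a "us @ vs"] by simp
  qed simp
  from this[of "[]"] show ?thesis by simp
qed


section \<open>Derivatives within convex sets\<close>

lemma tangent_UNIV [simp]: "tangent (UNIV :: 'a::euclidean_space set) = UNIV"
  by (auto simp: tangent_def) (metis diff_zero)

lemma tangent_affine_hull [simp]: "tangent (affine hull S) = tangent S"
  by (simp add: tangent_def hull_hull)

lemma diff_mem_tangent: "x \<in> affine hull S \<Longrightarrow> y \<in> affine hull S \<Longrightarrow> x - y \<in> tangent S"
  by (auto simp: tangent_def)

lemma tangent_eq_span:
  assumes "x \<in> S"
  shows "tangent S = span ((\<lambda>y. y - x) ` S)"
proof -
  have hull: "affine hull S = (\<lambda>v. x + v) ` span ((\<lambda>y. y - x) ` S)"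
  proof -
    have "span ((\<lambda>y. - x + y) ` (S - {x})) = span ((\<lambda>y. y - x) ` S)"
    proof -
      have "insert 0 ((\<lambda>y. - x + y) ` (S - {x})) = (\<lambda>y. y - x) ` S"
        using assms by (auto simp: image_iff)
      then show ?thesis by (metis span_insert_0)
    qed
    then show ?thesis using affine_hull_span2[OF assms] by simp
  qed
  show ?thesis
  proof
    show "tangent S \<subseteq> span ((\<lambda>y. y - x) ` S)"
      unfolding tangent_def hull by (auto simp: span_diff)
    have "x \<in> affine hull S" by (simp add: assms hull_inc)
    show "span ((\<lambda>y. y - x) ` S) \<subseteq> tangent S"
    proof
      fix v assume "v \<in> span ((\<lambda>y. y - x) ` S)"
      then have "x + v \<in> affine hull S" unfolding hull by blast
      from diff_mem_tangent[OF this \<open>x \<in> affine hull S\<close>] show "v \<in> tangent S" by simp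
    qed
  qed
qed

lemma subspace_tangent: "S \<noteq> {} \<Longrightarrow> subspace (tangent S)"
  using tangent_eq_span by (metis equals0I subspace_span)

lemma add_tangent_mem:
  assumes "x \<in> affine hull S" "v \<in> tangent S"
  shows "x + v \<in> affine hull S"
proof -
  obtain y z where "v = y - z" "y \<in> affine hull S" "z \<in> affine hull S"
    using assms(2) by (auto simp: tangent_def)
  then show ?thesis
    using mem_affine_3_minus[OF affine_affine_hull assms(1), of y z 1] by simp
qed

text \<open>\<open>S\<close> may have empty interior. Along the segment from \<open>x\<close> to
  another point of \<open>S\<close> the derivative is the one-sided derivative of a function of one
  variable, hence unique; the directions of these segments span the tangent space.\<close>

lemma has_derivative_unique_on_tangent:
  fixes f :: "'a::euclidean_space \<Rightarrow> 'b::real_normed_vector"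
  assumes "convex S" "x \<in> S" "(f has_derivative D) (at x within S)"
    "(f has_derivative E) (at x within S)" "v \<in> tangent S"
  shows "D v = E v"
proof -
  have lin: "linear D" "linear E"
    using assms(3,4) has_derivative_linear by blast+
  have *: "D (y - x) = E (y - x)" if y: "y \<in> S" for y
  proof -
    define p where "p = (\<lambda>t::real. x + t *\<^sub>R (y - x))"
    have p: "p ` {0..1} \<subseteq> S"
    proof
      fix z assume "z \<in> p ` {0..1}"
      then obtain t where t: "t \<in> {0..1}" "z = (1 - t) *\<^sub>R x + t *\<^sub>R y"
        by (auto simp: p_def algebra_simps)
      then show "z \<in> S" using convexD_alt[OF assms(1,2) y, of t] by simp
    qed
    have dp: "(p has_derivative (\<lambda>t. t *\<^sub>R (y - x))) (at 0 within {0..1})"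
      unfolding p_def by (auto intro!: derivative_eq_intros)
    have "((f \<circ> p) has_vector_derivative D' (y - x)) (at 0 within {0..1})"
      if D': "(f has_derivative D') (at x within S)" for D'
    proof -
      have "(f has_derivative D') (at (p 0) within p ` {0..1})"
        using has_derivative_subset[OF D' p] by (simp add: p_def)
      from diff_chain_within[OF dp this] show ?thesis
        using linear_cmul[OF has_derivative_linear[OF D']]
        by (simp add: has_vector_derivative_def o_def)
    qed
    note this[OF assms(3)] this[OF assms(4)]
    moreover have "at (0::real) within {0..1} \<noteq> bot"
      by (simp add: at_within_Icc_at_right trivial_limit_at_right_real)
    ultimately show ?thesis using vector_derivative_unique_within by blast
  qed
  show ?thesis
    using linear_eq_on[OF lin, of v "(\<lambda>y. y - x) ` S"] * assms(5)
    by (auto simp: tangent_eq_span[OF assms(2)])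
qed

text \<open>The value that \<open>frechet_derivative\<close> has chosen can be computed from any
  differentiable \<open>F\<close> that agrees with \<open>f\<close> on \<open>S\<close>, as long as
  the direction is tangent.\<close>

lemma frechet_derivative_within_eq:
  fixes f F :: "'a::euclidean_space \<Rightarrow> 'b::real_normed_vector"
  assumes "convex S" "x \<in> S" "(F has_derivative D) (at x within S)"
    "\<And>y. y \<in> S \<Longrightarrow> f y = F y" "v \<in> tangent S"
  shows "frechet_derivative f (at x within S) v = D v"
proof -
  have "(f has_derivative D) (at x within S)"
    by (rule has_derivative_transform[OF assms(2) _ assms(3)]) (use assms(4) in auto)
  moreover from this have "(f has_derivative frechet_derivative f (at x within S)) (at x within S)"
    using differentiableI frechet_derivative_works by blast
  ultimately show ?thesis
    using has_derivative_unique_on_tangent assms by blast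
qed

section \<open>Functions of class C^n on convex sets\<close>

lemma Ck_on_cong:
  fixes f g :: "'a::euclidean_space \<Rightarrow> real"
  assumes "\<And>x. x \<in> A \<Longrightarrow> f x = g x"
  shows "Ck_on n A f \<longleftrightarrow> Ck_on n A g"
  using assms
proof (induction n arbitrary: f g)
  case 0
  then show ?case by (simp cong: continuous_on_cong)
next
  case (Suc n)
  have eq: "(f has_derivative D) (at x within A) \<longleftrightarrow> (g has_derivative D) (at x within A)"
    if "x \<in> A" for x D
    using has_derivative_transform[OF that, of f g D] has_derivative_transform[OF that, of g f D]
      Suc.prems by metis
  then have "frechet_derivative f (at x within A) = frechet_derivative g (at x within A)"
    if "x \<in> A" for x
    using that by (simp add: frechet_derivative_def)
  then have "Ck_on n A (\<lambda>x. frechet_derivative f (at x within A) v)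
      \<longleftrightarrow> Ck_on n A (\<lambda>x. frechet_derivative g (at x within A) v)" for v
    by (intro Suc.IH) simp
  moreover have "f differentiable_on A \<longleftrightarrow> g differentiable_on A"
    using eq by (simp add: differentiable_on_def differentiable_def)
  ultimately show ?case by simp
qed

lemma Ck_on_SucI:
  fixes f :: "'a::euclidean_space \<Rightarrow> real"
  assumes "convex A" "\<And>x. x \<in> A \<Longrightarrow> (f has_derivative f' x) (at x within A)"
    "\<And>v. v \<in> tangent A \<Longrightarrow> Ck_on n A (\<lambda>x. f' x v)"
  shows "Ck_on (Suc n) A f"
proof -
  have "Ck_on n A (\<lambda>x. frechet_derivative f (at x within A) v)" if "v \<in> tangent A" for v
    using Ck_on_cong[of A "\<lambda>x. frechet_derivative f (at x within A) v" "\<lambda>x. f' x v" n]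
      frechet_derivative_within_eq[OF assms(1) _ assms(2)] assms(3) that by blast
  then show ?thesis
    using assms(2) by (auto simp: differentiable_on_def intro: differentiableI)
qed

lemma Ck_on_SucD:
  assumes "Ck_on (Suc n) A f"
  shows "x \<in> A \<Longrightarrow> (f has_derivative frechet_derivative f (at x within A)) (at x within A)"
    and "v \<in> tangent A \<Longrightarrow> Ck_on n A (\<lambda>x. frechet_derivative f (at x within A) v)"
  using assms by (auto simp: differentiable_on_def frechet_derivative_works)

lemma Ck_on_Suc_imp: "Ck_on (Suc n) A f \<Longrightarrow> Ck_on n A f"
proof (induction n arbitrary: f)
  case 0
  then show ?case by (simp add: differentiable_imp_continuous_on)
next
  case (Suc n)
  have "Ck_on n A (\<lambda>x. frechet_derivative f (at x within A) v)" if "v \<in> tangent A" for v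
    using Suc.IH Suc.prems that Ck_on.simps(2) by blast
  then show ?case using Suc.prems by auto
qed

lemma Ck_on_const: "convex A \<Longrightarrow> Ck_on n A (\<lambda>x. c)"
  by (induction n arbitrary: c) (auto intro!: Ck_on_SucI[where f' = "\<lambda>x v. 0"] simp del: Ck_on.simps(2))

lemma Ck_on_add:
  assumes "convex A" "Ck_on n A f" "Ck_on n A g"
  shows "Ck_on n A (\<lambda>x. f x + g x)"
  using assms
proof (induction n arbitrary: f g)
  case (Suc n)
  note D = Ck_on_SucD[OF Suc.prems(2)] Ck_on_SucD[OF Suc.prems(3)]
  show ?case
    by (rule Ck_on_SucI[OF Suc.prems(1) has_derivative_add[OF D(1,3)]]) (auto intro: Suc.IH Suc.prems D)
qed (auto intro: continuous_on_add)

lemma Ck_on_cmult: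
  assumes "convex A" "Ck_on n A f"
  shows "Ck_on n A (\<lambda>x. c * f x)"
  using assms
proof (induction n arbitrary: f)
  case (Suc n)
  note D = Ck_on_SucD[OF Suc.prems(2)]
  show ?case
    by (rule Ck_on_SucI[OF Suc.prems(1) has_derivative_mult_right[OF D(1)]])
       (auto intro: Suc.IH Suc.prems D)
qed (auto intro: continuous_on_mult_left)

text \<open>The derivative of the product is an affine multiple of a derivative of \<open>f\<close>
  plus a constant multiple of \<open>f\<close>, so the induction closes within this class of
  factors. It is applied to barycentric coordinates and to the components of x - e.\<close>

lemma Ck_on_mult_affine:
  assumes "convex A" "bounded_linear l" "Ck_on n A f"
  shows "Ck_on n A (\<lambda>x. (c + l x) * f x)"
  using assms(3)
proof (induction n arbitrary: f)
  case 0
  then show ?case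
    using linear_continuous_on[OF assms(2)] by (auto intro!: continuous_intros)
next
  case (Suc n)
  note D = Ck_on_SucD[OF Suc.prems]
  have "Ck_on n A (\<lambda>x. (c + l x) * frechet_derivative f (at x within A) v + (0 + l v) * f x)"
    if "v \<in> tangent A" for v
    using Suc.IH D(2)[OF that] Ck_on_Suc_imp[OF Suc.prems] assms(1)
    by (intro Ck_on_add) (auto intro: Ck_on_cmult)
  then show ?case
    using D(1) bounded_linear.has_derivative[OF assms(2) has_derivative_ident]
    by (intro Ck_on_SucI[OF assms(1), where f' = "\<lambda>x v. (c + l x) * frechet_derivative f (at x within A) v + l v * f x"])
       (auto intro!: derivative_eq_intros)
qed


lemma Ck_on_UNIV_imp:
  fixes f :: "'a::euclidean_space \<Rightarrow> real"
  assumes "convex A" "Ck_on n UNIV f"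
  shows "Ck_on n A f"
  using assms(2)
proof (induction n arbitrary: f)
  case 0
  then show ?case using continuous_on_subset[of UNIV f A] by simp
next
  case (Suc n)
  show ?case
    by (rule Ck_on_SucI[OF assms(1) has_derivative_at_withinI[OF Ck_on_SucD(1)[OF Suc.prems]]])
       (auto intro!: Suc.IH Ck_on_SucD(2)[OF Suc.prems])
qed

text \<open>As the range lies in \<open>A\<close>, derivatives within \<open>A\<close> obey the
  chain rule. That \<open>l\<close> maps into the tangent space keeps the new directions among those
  that \<open>Ck_on\<close> controls.\<close>

lemma Ck_on_compose_affine:
  fixes f :: "'a::euclidean_space \<Rightarrow> real"
  assumes "convex A" "bounded_linear l" "range (\<lambda>x. c + l x) \<subseteq> A" "range l \<subseteq> tangent A"
    and "Ck_on n A f"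
  shows "Ck_on n UNIV (\<lambda>x. f (c + l x))"
  using assms(5)
proof (induction n arbitrary: f)
  case 0
  have "continuous_on UNIV (\<lambda>x. c + l x)"
    using linear_continuous_on[OF assms(2)] by (auto intro!: continuous_intros)
  then show ?case using continuous_on_compose2[of A f UNIV "\<lambda>x. c + l x"] 0 assms(3) by simp
next
  case (Suc n)
  have "((\<lambda>x. f (c + l x)) has_derivative
      (\<lambda>v. frechet_derivative f (at (c + l x) within A) (l v))) (at x)" for x
  proof -
    have "((\<lambda>x. c + l x) has_derivative l) (at x)"
      using bounded_linear.has_derivative[OF assms(2) has_derivative_ident]
      by (auto intro!: derivative_eq_intros)
    moreover have "(f has_derivative frechet_derivative f (at (c + l x) within A))
        (at (c + l x) within range (\<lambda>x. c + l x))"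
      using Ck_on_SucD(1)[OF Suc.prems] assms(3) by (intro has_derivative_subset[OF _ assms(3)]) auto
    ultimately show ?thesis by (rule has_derivative_in_compose)
  qed
  moreover have "Ck_on n UNIV (\<lambda>x. frechet_derivative f (at (c + l x) within A) (l v))" for v
    by (rule Suc.IH, rule Ck_on_SucD(2)[OF Suc.prems]) (use assms(4) in auto)
  ultimately show ?case by (intro Ck_on_SucI) auto
qed

text \<open>A linear projection onto the tangent space, shifted so as to fix a point of the affine
  hull. Composition with it extends forms from the affine hull to the whole space.\<close>

lemma affine_retraction_exists:
  assumes "S \<noteq> {}"
  obtains c l where "linear l" "range l \<subseteq> tangent S" "\<And>v. v \<in> tangent S \<Longrightarrow> l v = v"
    "\<And>x. c + l x \<in> affine hull S" "\<And>x. x \<in> affine hull S \<Longrightarrow> c + l x = x"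
proof -
  obtain a where a: "a \<in> affine hull S" using assms hull_subset by fastforce
  obtain l where l: "range l \<subseteq> tangent S" "linear l" "\<And>v. v \<in> tangent S \<Longrightarrow> l v = v"
    using linear_exists_left_inverse_on[OF linear_id subspace_tangent[OF assms]] by auto
  show thesis
  proof (rule that[OF l(2,1,3)])
    show "(a - l a) + l x \<in> affine hull S" for x
    proof -
      have "l (x - a) \<in> tangent S" using l(1) by blast
      from add_tangent_mem[OF a this] show ?thesis
        by (simp add: linear_diff[OF l(2)] algebra_simps)
    qed
    show "(a - l a) + l x = x" if "x \<in> affine hull S" for x
      using l(3)[OF diff_mem_tangent[OF that a]] by (auto simp: linear_diff[OF l(2)] algebra_simps)
  qed
qed

section \<open>Integrals along segments to a point\<close>

text \<open>The weight \<open>t ^ k\<close> arises when a form is pulled back along the contraction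
  to \<open>e\<close>: each of the k vectors other than the radial one is scaled by t.\<close>

definition seg_integral :: "'a::euclidean_space \<Rightarrow> nat \<Rightarrow> ('a \<Rightarrow> real) \<Rightarrow> 'a \<Rightarrow> real" where
  "seg_integral e k f x = integral {0..1} (\<lambda>t. t ^ k * f (e + t *\<^sub>R (x - e)))"

lemma continuous_on_seg:
  fixes f :: "'a::euclidean_space \<Rightarrow> 'b::topological_space"
  assumes "continuous_on UNIV f"
  shows "continuous_on B (\<lambda>t. f (e + t *\<^sub>R (x - e)))"
    and "continuous_on C (\<lambda>(x, t). f (e + t *\<^sub>R (x - e)))"
  unfolding case_prod_unfold
  by (rule continuous_on_compose2[OF assms]; (intro continuous_intros subset_UNIV)?)+

lemma seg_integrable:
  fixes f :: "'a::euclidean_space \<Rightarrow> real"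
  assumes "continuous_on UNIV f"
  shows "(\<lambda>t. t ^ k * f (e + t *\<^sub>R (x - e))) integrable_on {0..1}"
  by (intro integrable_continuous_real continuous_intros continuous_on_seg assms)

lemma continuous_on_seg_integral:
  fixes f :: "'a::euclidean_space \<Rightarrow> real"
  assumes "continuous_on UNIV f"
  shows "continuous_on UNIV (seg_integral e k f)"
proof -
  have "continuous_on (UNIV \<times> cbox 0 1) (\<lambda>(x, t). t ^ k * f (e + t *\<^sub>R (x - e)))"
    using continuous_on_seg(2)[OF assms] unfolding case_prod_unfold
    by (auto intro!: continuous_intros)
  from integral_continuous_on_param[OF this] show ?thesis
    by (simp add: seg_integral_def[abs_def])
qed

text \<open>The chain rule contributes a factor t, which raises the weight by one. The derivative of
  the integrand is packed into a bounded linear function so that \<open>leibniz_rule\<close> applies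
  to all directions at once.\<close>

lemma has_derivative_seg_integral:
  fixes f :: "'a::euclidean_space \<Rightarrow> real"
  assumes f': "\<And>x. (f has_derivative f' x) (at x)" and cont: "\<And>v. continuous_on UNIV (\<lambda>x. f' x v)"
  shows "(seg_integral e k f has_derivative (\<lambda>v. seg_integral e (Suc k) (\<lambda>y. f' y v) x)) (at x)"
proof -
  have cf: "continuous_on UNIV f"
    using has_derivative_continuous[OF f'] by (simp add: continuous_at_imp_continuous_on)
  define B where "B = (\<lambda>x. Blinfun (f' x))"
  have B: "blinfun_apply (B x) = f' x" for x
    unfolding B_def by (rule bounded_linear_Blinfun_apply) (rule has_derivative_bounded_linear[OF f'])
  have contB: "continuous_on UNIV B"
    by (rule continuous_on_blinfun_componentwise) (simp add: B cont)
  define G where "G = (\<lambda>x t. t ^ Suc k *\<^sub>R B (e + t *\<^sub>R (x - e)))"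
  have contG: "continuous_on (UNIV \<times> cbox 0 1) (\<lambda>(x, t). G x t)"
    using continuous_on_seg(2)[OF contB] unfolding G_def case_prod_unfold
    by (auto intro!: continuous_intros)
  have dG: "((\<lambda>x. t ^ k * f (e + t *\<^sub>R (x - e))) has_derivative blinfun_apply (G x t)) (at x within UNIV)" for x t
  proof -
    have "((\<lambda>x. e + t *\<^sub>R (x - e)) has_derivative (\<lambda>v. t *\<^sub>R v)) (at x)"
      by (auto intro!: derivative_eq_intros)
    from has_derivative_mult_right[OF has_derivative_compose[OF this f'], of "t ^ k"]
    moreover have "blinfun_apply (G x t) = (\<lambda>v. t ^ k * f' (e + t *\<^sub>R (x - e)) (t *\<^sub>R v))"
      using linear_cmul[OF has_derivative_linear[OF f']]
      by (simp add: fun_eq_iff G_def B blinfun.scaleR_left)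
    ultimately show ?thesis by simp
  qed
  have "((\<lambda>x. integral (cbox 0 1) (\<lambda>t. t ^ k * f (e + t *\<^sub>R (x - e)))) has_derivative
      integral (cbox 0 1) (G x)) (at x within UNIV)"
    by (rule leibniz_rule[OF dG _ contG]) (use seg_integrable[OF cf] in auto)
  moreover have "blinfun_apply (integral (cbox 0 1) (G x)) = (\<lambda>v. seg_integral e (Suc k) (\<lambda>y. f' y v) x)"
  proof
    fix v
    have "G x integrable_on cbox 0 1"
      using continuous_on_seg(1)[OF contB] unfolding G_def
      by (intro integrable_continuous) (auto intro!: continuous_intros)
    from integral_linear[OF this, of "\<lambda>L. blinfun_apply L v"]
    show "blinfun_apply (integral (cbox 0 1) (G x)) v = seg_integral e (Suc k) (\<lambda>y. f' y v) x"
      by (simp add: o_def G_def seg_integral_def blinfun.scaleR_left B blinfun.bounded_linear_left)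
  qed
  ultimately show ?thesis by (simp add: seg_integral_def[abs_def])
qed

text \<open>The weight \<open>k\<close> varies in the induction, as every derivative raises
  it.\<close>

lemma Ck_on_seg_integral: "Ck_on n UNIV f \<Longrightarrow> Ck_on n UNIV (seg_integral e k f)"
proof (induction n arbitrary: f k)
  case (Suc n)
  note D = Ck_on_SucD[OF Suc.prems, simplified]
  have C: "Ck_on 0 UNIV f" if "Ck_on m UNIV f" for m and f :: "'a \<Rightarrow> real"
    using that
  proof (induction m)
    case (Suc m)
    from Suc.IH[OF Ck_on_Suc_imp[OF Suc.prems]] show ?case .
  qed
  show ?case
    by (rule Ck_on_SucI[OF _ has_derivative_seg_integral])
       (use D C in \<open>auto intro: Suc.IH simp del: Ck_on.simps(2)\<close>)
qed (simp add: continuous_on_seg_integral)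


lemma seg_integral_diff:
  assumes "continuous_on UNIV f" "continuous_on UNIV g"
  shows "seg_integral e k (\<lambda>x. f x - g x) x = seg_integral e k f x - seg_integral e k g x"
  using integral_diff[OF seg_integrable seg_integrable, OF assms]
  by (simp add: seg_integral_def algebra_simps)

lemma seg_integral_add:
  assumes "continuous_on UNIV f" "continuous_on UNIV g"
  shows "seg_integral e k (\<lambda>x. f x + g x) x = seg_integral e k f x + seg_integral e k g x"
  using integral_add[OF seg_integrable seg_integrable, OF assms]
  by (simp add: seg_integral_def algebra_simps)

lemma seg_integral_cmult: "seg_integral e k (\<lambda>x. c * f x) x = c * seg_integral e k f x"
  using integral_mult_right[of "{0..1}" c "\<lambda>t. t ^ k * f (e + t *\<^sub>R (x - e))"]
  by (simp add: seg_integral_def algebra_simps)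

lemma seg_integral_zero [simp]: "seg_integral e k (\<lambda>x. 0) x = 0"
  by (simp add: seg_integral_def)

lemma seg_integral_sum:
  assumes "\<And>i. i \<in> I \<Longrightarrow> continuous_on UNIV (f i)"
  shows "seg_integral e k (\<lambda>x. \<Sum>i\<in>I. f i x) x = (\<Sum>i\<in>I. seg_integral e k (f i) x)"
  using assms
  by (induction I rule: infinite_finite_induct) (auto simp: seg_integral_add continuous_on_sum)

lemma seg_integral_alt_sum:
  assumes "\<And>y ys. mset (y # ys) = mset xs \<Longrightarrow> continuous_on UNIV (G y ys)"
  shows "seg_integral e k (\<lambda>z. alt_sum (\<lambda>y ys. G y ys z) xs) x
    = alt_sum (\<lambda>y ys. seg_integral e k (G y ys) x) xs"
proof -
  have "seg_integral e k (alt_sum G xs) x = alt_sum (\<lambda>y ys. seg_integral e k (G y ys) x) xs"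
    using alt_sum_additive_on[of xs G "Collect (continuous_on UNIV)" "\<lambda>f. seg_integral e k f x"]
      assms continuous_on_diff[of UNIV] seg_integral_diff[of _ _ e k x]
    by (auto simp: zero_fun_def fun_diff_def continuous_on_const)
  moreover have "alt_sum G xs = (\<lambda>z. alt_sum (\<lambda>y ys. G y ys z) xs)"
    by (auto simp: alt_sum_apply)
  ultimately show ?thesis by simp
qed

text \<open>Both formulas integrate a derivative in t: the first that of
  \<open>t ^ Suc k * f (e + t *\<^sub>R (x - e))\<close>, which vanishes at t = 0; the second that
  of \<open>f (e + t *\<^sub>R (x - e))\<close>, which leaves \<open>f e\<close>.\<close>

lemma seg_integral_fundamental:
  fixes f :: "'a::euclidean_space \<Rightarrow> real"
  assumes f': "\<And>x. (f has_derivative f' x) (at x)" and cont: "\<And>v. continuous_on UNIV (\<lambda>x. f' x v)"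
  shows "seg_integral e (Suc k) (\<lambda>y. f' y (x - e)) x + Suc k * seg_integral e k f x = f x"
    and "seg_integral e 0 (\<lambda>y. f' y (x - e)) x = f x - f e"
proof -
  have cf: "continuous_on UNIV f"
    using has_derivative_continuous[OF f'] by (simp add: continuous_at_imp_continuous_on)
  have df: "((\<lambda>t. f (e + t *\<^sub>R (x - e))) has_real_derivative f' (e + t *\<^sub>R (x - e)) (x - e)) (at t within {0..1})"
    for t
  proof -
    have "((\<lambda>t. e + t *\<^sub>R (x - e)) has_derivative (\<lambda>s. s *\<^sub>R (x - e))) (at t within {0..1})"
      by (auto intro!: derivative_eq_intros)
    from has_derivative_compose[OF this f'] show ?thesis
      using linear_cmul[OF has_derivative_linear[OF f']]
      by (simp add: has_field_derivative_def mult.commute[of "f' _ _"] mult_commute_abs)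
  qed
  note df' = df[unfolded has_real_derivative_iff_has_vector_derivative]
  show "seg_integral e 0 (\<lambda>y. f' y (x - e)) x = f x - f e"
    using fundamental_theorem_of_calculus[of 0 1, OF _ df'] 
    by (simp add: seg_integral_def has_integral_iff)
  have "((\<lambda>t. t ^ Suc k * f (e + t *\<^sub>R (x - e))) has_vector_derivative
      (t ^ Suc k * f' (e + t *\<^sub>R (x - e)) (x - e) + Suc k * (t ^ k * f (e + t *\<^sub>R (x - e)))))
      (at t within {0..1})" for t
    unfolding has_real_derivative_iff_has_vector_derivative[symmetric]
    using DERIV_mult[OF DERIV_pow[of "Suc k"] df] by (simp add: algebra_simps)
  from fundamental_theorem_of_calculus[of 0 1, OF _ this]
  have "((\<lambda>t. t ^ Suc k * f' (e + t *\<^sub>R (x - e)) (x - e) + Suc k * (t ^ k * f (e + t *\<^sub>R (x - e))))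
      has_integral f x) {0..1}" by simp
  moreover have "((\<lambda>t. t ^ Suc k * f' (e + t *\<^sub>R (x - e)) (x - e) + Suc k * (t ^ k * f (e + t *\<^sub>R (x - e))))
      has_integral (seg_integral e (Suc k) (\<lambda>y. f' y (x - e)) x + Suc k * seg_integral e k f x)) {0..1}"
    unfolding seg_integral_def
    by (intro has_integral_add has_integral_mult_right integrable_integral seg_integrable cf cont)
  ultimately show "seg_integral e (Suc k) (\<lambda>y. f' y (x - e)) x + Suc k * seg_integral e k f x = f x"
    by (rule has_integral_unique[symmetric])
qed


lemma add_mset_eq_mset_length: "add_mset y (mset ys) = mset xs \<Longrightarrow> length xs = Suc (length ys)"
  by (metis size_add_mset size_mset)

section \<open>Alternating forms\<close>

abbreviation dir_deriv :: "'a::euclidean_space \<Rightarrow> ('a \<Rightarrow> real) \<Rightarrow> 'a \<Rightarrow> real" where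
  "dir_deriv v f x \<equiv> frechet_derivative f (at x) v"

lemma vectors_UNIV [simp]: "vectors UNIV k = {vs. length vs = k}"
  by (simp add: vectors_def)

lemma alternating_form_length: "alternating_form UNIV k \<omega> \<Longrightarrow> length vs \<noteq> k \<Longrightarrow> \<omega> vs = 0"
  by (simp add: alternating_form_def)

lemma alternating_form_update:
  "alternating_form UNIV k \<omega> \<Longrightarrow> length vs = k \<Longrightarrow> i < k \<Longrightarrow>
     \<omega> (vs[i := a *\<^sub>R x + b *\<^sub>R y]) = a * \<omega> (vs[i := x]) + b * \<omega> (vs[i := y])"
  by (simp add: alternating_form_def)

lemma alternating_form_repeat:
  "alternating_form UNIV k \<omega> \<Longrightarrow> length vs = k \<Longrightarrow> i < j \<Longrightarrow> j < k \<Longrightarrow> vs ! i = vs ! j \<Longrightarrow> \<omega> vs = 0"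
  by (auto simp: alternating_form_def)

text \<open>Prepares inductions that peel off the first vector. Testing a repetition of the first
  two vectors is enough beyond the tail: by polarisation these two anticommute, and a swap brings a
  first vector that is repeated further on into the tail.\<close>

lemma alternating_form_Suc:
  "alternating_form UNIV (Suc k) \<omega> \<longleftrightarrow>
     \<omega> [] = 0 \<and> (\<forall>v. alternating_form UNIV k (\<lambda>ws. \<omega> (v # ws))) \<and>
     (\<forall>ws. linear (\<lambda>v. \<omega> (v # ws))) \<and> (\<forall>v ws. \<omega> (v # v # ws) = 0)"
  (is "?L \<longleftrightarrow> ?R")
proof
  assume L: ?L
  then have len: "\<omega> vs = 0" if "length vs \<noteq> Suc k" for vs
    using that by (simp add: alternating_form_def)
  have lin: "\<omega> (vs[i := a *\<^sub>R x + b *\<^sub>R y]) = a * \<omega> (vs[i := x]) + b * \<omega> (vs[i := y])"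
    if "length vs = Suc k" "i < Suc k" for vs i a x b y
    using L that by (simp add: alternating_form_def)
  have alt: "\<omega> vs = 0" if "length vs = Suc k" "i < j" "j < Suc k" "vs ! i = vs ! j" for vs i j
    using L that by (auto simp: alternating_form_def)
  have "alternating_form UNIV k (\<lambda>ws. \<omega> (v # ws))" for v
    unfolding alternating_form_def
  proof (intro conjI allI impI ballI)
    fix vs :: "'a list" and i j assume "vs \<in> vectors UNIV k" "i < j \<and> j < k \<and> vs ! i = vs ! j"
    then show "\<omega> (v # vs) = 0" using alt[of "v # vs" "Suc i" "Suc j"] by simp
  next
    fix vs :: "'a list" and i x y a b assume "vs \<in> vectors UNIV k" "i < k"
    then show "\<omega> (v # vs[i := a *\<^sub>R x + b *\<^sub>R y]) = a * \<omega> (v # vs[i := x]) + b * \<omega> (v # vs[i := y])"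
      using lin[of "v # vs" "Suc i"] by simp
  qed (auto simp: len)
  moreover have "linear (\<lambda>v. \<omega> (v # ws))" for ws
  proof (cases "length ws = k")
    case True
    have "\<omega> ((a *\<^sub>R x + b *\<^sub>R y) # ws) = a * \<omega> (x # ws) + b * \<omega> (y # ws)" for a x b y
      using lin[of "0 # ws" 0 a x b y] True by simp
    from this[of 1 _ 1] this[of _ _ 0 0] show ?thesis by (auto intro!: linearI)
  qed (simp add: len linear_zero)
  moreover have "\<omega> (v # v # ws) = 0" for v ws
    using alt[of "v # v # ws" 0 1] len[of "v # v # ws"] by (cases "k = Suc (length ws)") auto
  ultimately show ?R using len by auto
next
  assume R: ?R
  then have lin: "linear (\<lambda>v. \<omega> (v # ws))" and alt: "\<omega> (v # v # ws) = 0"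
    and af: "alternating_form UNIV k (\<lambda>ws. \<omega> (v # ws))" for v ws by auto
  have len: "\<omega> vs = 0" if "length vs \<noteq> Suc k" for vs
    using R that by (cases vs) (auto simp: alternating_form_def)
  have swap: "\<omega> (v # w # ws) = - \<omega> (w # v # ws)" for v w ws
  proof -
    have "\<omega> (v # (v + w) # ws) = \<omega> (v # w # ws)" "\<omega> (w # (v + w) # ws) = \<omega> (w # v # ws)"
    proof -
      have add: "\<omega> (x # (v + w) # ws) = \<omega> (x # v # ws) + \<omega> (x # w # ws)" for x
      proof (cases "length ws + 1 = k")
        case True
        then show ?thesis
          using alternating_form_update[OF af[of x], of "0 # ws" 0 1 v 1 w] by simp
      qed (auto simp: len)
      show "\<omega> (v # (v + w) # ws) = \<omega> (v # w # ws)" "\<omega> (w # (v + w) # ws) = \<omega> (w # v # ws)"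
        using add alt by auto
    qed
    moreover have "\<omega> ((v + w) # (v + w) # ws) = \<omega> (v # (v + w) # ws) + \<omega> (w # (v + w) # ws)"
      using lin linear_add by blast
    ultimately show ?thesis using alt[of "v + w" ws] by simp
  qed
  show ?L
    unfolding alternating_form_def
  proof (intro conjI allI impI ballI)
    fix vs :: "'a list" and i x y a b assume vs: "vs \<in> vectors UNIV (Suc k)" "i < Suc k"
    then obtain v ws where v: "vs = v # ws" "length ws = k" by (auto simp: length_Suc_conv)
    show "\<omega> (vs[i := a *\<^sub>R x + b *\<^sub>R y]) = a * \<omega> (vs[i := x]) + b * \<omega> (vs[i := y])"
      using vs(2) v af[of v] linear_add[OF lin] linear_cmul[OF lin]
      by (cases i) (auto simp: alternating_form_def)
  next
    fix vs :: "'a list" and i j assume vs: "vs \<in> vectors UNIV (Suc k)" "i < j \<and> j < Suc k \<and> vs ! i = vs ! j"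
    then obtain v ws where v: "vs = v # ws" "length ws = k" by (auto simp: length_Suc_conv)
    obtain j' where j: "j = Suc j'" using vs(2) by (cases j) auto
    show "\<omega> vs = 0"
    proof (cases i)
      case (Suc i')
      then show ?thesis using vs v j af[of v] by (auto simp: alternating_form_def)
    next
      case 0
      then obtain w us where w: "ws = w # us" using v vs j by (cases ws) auto
      show ?thesis
      proof (cases j')
        case 0
        then show ?thesis using \<open>i = 0\<close> vs v j w alt by auto
      next
        case (Suc j'')
        have "\<omega> (w # v # us) = 0"
          using alternating_form_repeat[OF af[of w], of "v # us" 0 j'] vs v j w \<open>i = 0\<close> Suc by auto
        then show ?thesis using swap[of v w us] v w by simp
      qed
    qed
  qed (use len in auto)
qed

lemma swap_antisymmetric_alternating_form:
  "alternating_form UNIV k \<omega> \<Longrightarrow> swap_antisymmetric \<omega>"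
proof (induction k arbitrary: \<omega>)
  case 0
  then show ?case by (simp add: alternating_form_def swap_antisymmetric_def)
next
  case (Suc k)
  then have lin: "linear (\<lambda>v. \<omega> (v # ws))" and alt: "\<omega> (v # v # ws) = 0"
    and IH: "swap_antisymmetric (\<lambda>ws. \<omega> (v # ws))"
    and af: "alternating_form UNIV k (\<lambda>ws. \<omega> (v # ws))" for v ws
    by (auto simp: alternating_form_Suc)
  have lin2: "linear (\<lambda>w. \<omega> (v # w # ws))" for v ws
  proof (cases k)
    case 0
    then show ?thesis using alternating_form_length[OF af[of v]] by (simp add: linear_zero)
  next
    case (Suc j)
    then show ?thesis using af[of v] by (simp add: alternating_form_Suc)
  qed
  have swap: "\<omega> (v # w # ws) = - \<omega> (w # v # ws)" for v w ws
    using alt[of "v + w" ws] alt[of v ws] alt[of w ws]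
    by (simp add: linear_add[OF lin] linear_add[OF lin2])
  have "\<omega> (xs @ a # b # ys) = - \<omega> (xs @ b # a # ys)" for xs a b ys
    using swap_antisymmetricD[OF IH, of "hd xs" "tl xs" a b ys] swap[of a b ys] by (cases xs) auto
  then show ?case unfolding swap_antisymmetric_def by blast
qed


lemma alternating_formI:
  assumes "\<And>vs. length vs \<noteq> k \<Longrightarrow> \<omega> vs = 0"
    and "\<And>vs i x y a b. length vs = k \<Longrightarrow> i < k \<Longrightarrow>
      \<omega> (vs[i := a *\<^sub>R x + b *\<^sub>R y]) = a * \<omega> (vs[i := x]) + b * \<omega> (vs[i := y])"
    and "\<And>vs i j. length vs = k \<Longrightarrow> i < j \<Longrightarrow> j < k \<Longrightarrow> vs ! i = vs ! j \<Longrightarrow> \<omega> vs = 0"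
  shows "alternating_form UNIV k \<omega>"
  using assms by (auto simp: alternating_form_def)

lemma alternating_form_add:
  "alternating_form UNIV k \<omega> \<Longrightarrow> alternating_form UNIV k \<eta> \<Longrightarrow> alternating_form UNIV k (\<lambda>vs. \<omega> vs + \<eta> vs)"
  by (rule alternating_formI)
     (auto simp: alternating_form_length alternating_form_update alternating_form_repeat algebra_simps)

lemma alternating_form_mult:
  "alternating_form UNIV k \<omega> \<Longrightarrow> alternating_form UNIV k (\<lambda>vs. c * \<omega> vs)"
  by (rule alternating_formI)
     (auto simp: alternating_form_length alternating_form_update alternating_form_repeat algebra_simps)

text \<open>Fixing the first vector \<open>v\<close> gives \<open>\<alpha> v\<close> times
  \<open>\<omega>\<close> minus the wedge product of \<open>\<alpha>\<close> with the contraction of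
  \<open>\<omega>\<close> by \<open>v\<close>, which has lower degree. If \<open>v\<close> is
  repeated, the two terms with the factor \<open>\<alpha> v\<close> cancel.\<close>

lemma alternating_form_wedge_covector:
  assumes "linear \<alpha>" "alternating_form UNIV k \<omega>"
  shows "alternating_form UNIV (Suc k) (alt_sum (\<lambda>v ws. \<alpha> v * \<omega> ws))"
  using assms(2)
proof (induction k arbitrary: \<omega>)
  case 0
  have *: "\<omega> (v # ws) = 0" for v ws using alternating_form_length[OF 0] by simp
  have "alternating_form UNIV 0 (\<lambda>ws. \<alpha> v * \<omega> ws)" for v
    using 0 by (rule alternating_form_mult)
  then show ?case
    using assms(1) by (auto simp: alternating_form_Suc * linear_iff algebra_simps)
next
  case (Suc k)
  have lin: "linear (\<lambda>v. \<omega> (v # ws))" and alt: "\<omega> (v # v # ws) = 0"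
    and af: "alternating_form UNIV k (\<lambda>ws. \<omega> (v # ws))" for v ws
    using Suc.prems by (auto simp: alternating_form_Suc)
  let ?w = "alt_sum (\<lambda>v ws. \<alpha> v * \<omega> ws)"
  have "alternating_form UNIV (Suc k) (\<lambda>ws. ?w (v # ws))" for v
    using alternating_form_add[OF alternating_form_mult[OF Suc.prems] alternating_form_mult[OF Suc.IH[OF af]], of "\<alpha> v" "-1" v]
    by simp
  moreover have "linear (\<lambda>v. ?w (v # ws))" for ws
  proof (rule linearI)
    fix a b :: 'a and r :: real
    show "?w ((a + b) # ws) = ?w (a # ws) + ?w (b # ws)"
      by (simp add: linear_add[OF lin] linear_add[OF assms(1)] alt_sum_add algebra_simps)
    show "?w ((r *\<^sub>R a) # ws) = r *\<^sub>R ?w (a # ws)"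
      using alt_sum_mult[of r "\<lambda>y ys. \<alpha> y * \<omega> (a # ys)" ws]
      by (simp add: linear_cmul[OF lin] linear_cmul[OF assms(1)] algebra_simps)
  qed
  moreover have "?w (v # v # ws) = 0" for v ws
    by (simp add: alt)
  ultimately show ?case
    by (auto simp only: alternating_form_Suc alt_sum.simps)
qed

text \<open>Cancels the factor that the derivative of \<open>t ^ k\<close> contributes to the homotopy formula.\<close>
lemma alt_sum_alternating_form:
  "alternating_form UNIV k \<omega> \<Longrightarrow> length vs = k \<Longrightarrow> alt_sum (\<lambda>v ws. \<omega> (v # ws)) vs = k * \<omega> vs"
proof (induction k arbitrary: \<omega> vs)
  case (Suc k)
  obtain v ws where vs: "vs = v # ws" "length ws = k" using Suc.prems(2) by (auto simp: length_Suc_conv)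
  have af: "alternating_form UNIV k (\<lambda>ws. \<omega> (v # ws))"
    using Suc.prems(1) by (auto simp: alternating_form_Suc)
  have "\<omega> (y # v # ys) = - \<omega> (v # y # ys)" for y ys
    using swap_antisymmetricD[OF swap_antisymmetric_alternating_form[OF Suc.prems(1)], of "[]" y v] by simp
  then have "alt_sum (\<lambda>y ys. \<omega> (y # v # ys)) ws = - (k * \<omega> (v # ws))"
    using Suc.IH[OF af vs(2)] by (simp add: alt_sum_uminus)
  then show ?case by (simp add: vs algebra_simps)
qed simp


section \<open>Smooth forms on the whole space\<close>

lemma smooth_onD:
  fixes f :: "'a::euclidean_space \<Rightarrow> real"
  assumes "smooth_on UNIV f"
  shows "(f has_derivative (\<lambda>v. dir_deriv v f x)) (at x)"
    and "smooth_on UNIV (dir_deriv v f)" and "continuous_on UNIV f"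
proof -
  have C: "Ck_on n UNIV f" for n using assms by (simp add: smooth_on_def)
  show "(f has_derivative (\<lambda>v. dir_deriv v f x)) (at x)"
    using Ck_on_SucD(1)[OF C] by simp
  show "smooth_on UNIV (dir_deriv v f)"
    using Ck_on_SucD(2)[OF C] by (simp add: smooth_on_def)
  show "continuous_on UNIV f" using C[of 0] by simp
qed

lemma smooth_on_const: "smooth_on UNIV (\<lambda>x. c)"
  by (simp add: smooth_on_def Ck_on_const)

lemma smooth_on_add: "smooth_on UNIV f \<Longrightarrow> smooth_on UNIV g \<Longrightarrow> smooth_on UNIV (\<lambda>x. f x + g x)"
  by (simp add: smooth_on_def Ck_on_add)

lemma smooth_on_cmult: "smooth_on UNIV f \<Longrightarrow> smooth_on UNIV (\<lambda>x. c * f x)"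
  by (simp add: smooth_on_def Ck_on_cmult)

lemma smooth_on_diff: "smooth_on UNIV f \<Longrightarrow> smooth_on UNIV g \<Longrightarrow> smooth_on UNIV (\<lambda>x. f x - g x)"
  using smooth_on_add[of f "\<lambda>x. -1 * g x"] smooth_on_cmult[of g "-1"] by simp

lemma smooth_on_sum: "(\<And>i. i \<in> I \<Longrightarrow> smooth_on UNIV (f i)) \<Longrightarrow> smooth_on UNIV (\<lambda>x. \<Sum>i\<in>I. f i x)"
  by (induction I rule: infinite_finite_induct) (auto simp: smooth_on_add smooth_on_const)

lemma smooth_on_mult_affine:
  "bounded_linear l \<Longrightarrow> smooth_on UNIV f \<Longrightarrow> smooth_on UNIV (\<lambda>x. (c + l x) * f x)"
  by (simp add: smooth_on_def Ck_on_mult_affine)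

lemma smooth_on_seg_integral: "smooth_on UNIV f \<Longrightarrow> smooth_on UNIV (seg_integral e k f)"
  by (simp add: smooth_on_def Ck_on_seg_integral)

lemma smooth_on_alt_sum:
  assumes "\<And>y ys. mset (y # ys) = mset xs \<Longrightarrow> smooth_on UNIV (G y ys)"
  shows "smooth_on UNIV (\<lambda>z. alt_sum (\<lambda>y ys. G y ys z) xs)"
proof -
  have "alt_sum G xs \<in> Collect (smooth_on UNIV)"
    by (rule alt_sum_in)
       (use assms smooth_on_const[of 0] smooth_on_diff in \<open>auto simp: zero_fun_def fun_diff_def\<close>)
  moreover have "alt_sum G xs = (\<lambda>z. alt_sum (\<lambda>y ys. G y ys z) xs)"
    by (auto simp: alt_sum_apply)
  ultimately show ?thesis by simp
qed

lemma dir_deriv_eqI: "(f has_derivative D) (at x) \<Longrightarrow> dir_deriv v f x = D v"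
  using frechet_derivative_at by metis

lemma dir_deriv_add:
  "smooth_on UNIV f \<Longrightarrow> smooth_on UNIV g \<Longrightarrow>
     dir_deriv v (\<lambda>x. f x + g x) x = dir_deriv v f x + dir_deriv v g x"
  by (rule dir_deriv_eqI[OF has_derivative_add[OF smooth_onD(1) smooth_onD(1)]])

lemma dir_deriv_diff:
  "smooth_on UNIV f \<Longrightarrow> smooth_on UNIV g \<Longrightarrow>
     dir_deriv v (\<lambda>x. f x - g x) x = dir_deriv v f x - dir_deriv v g x"
  by (rule dir_deriv_eqI[OF has_derivative_diff[OF smooth_onD(1) smooth_onD(1)]])

lemma dir_deriv_cmult:
  "smooth_on UNIV f \<Longrightarrow> dir_deriv v (\<lambda>x. c * f x) x = c * dir_deriv v f x"
  by (rule dir_deriv_eqI[OF has_derivative_mult_right[OF smooth_onD(1)]])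

lemma dir_deriv_mult_affine:
  assumes "bounded_linear l" "smooth_on UNIV f"
  shows "dir_deriv v (\<lambda>x. (c + l x) * f x) x = l v * f x + (c + l x) * dir_deriv v f x"
  using bounded_linear.has_derivative[OF assms(1) has_derivative_ident, of "at x"] smooth_onD(1)[OF assms(2), of x]
  by (intro dir_deriv_eqI) (auto intro!: derivative_eq_intros)

lemma dir_deriv_seg_integral:
  "smooth_on UNIV f \<Longrightarrow> dir_deriv v (seg_integral e k f) x = seg_integral e (Suc k) (dir_deriv v f) x"
  by (rule dir_deriv_eqI[OF has_derivative_seg_integral]) (auto intro: smooth_onD)

lemma dir_deriv_alt_sum:
  assumes "\<And>y ys. mset (y # ys) = mset xs \<Longrightarrow> smooth_on UNIV (G y ys)"
  shows "dir_deriv v (\<lambda>z. alt_sum (\<lambda>y ys. G y ys z) xs) x = alt_sum (\<lambda>y ys. dir_deriv v (G y ys) x) xs"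
proof -
  have "dir_deriv v (alt_sum G xs) x = alt_sum (\<lambda>y ys. dir_deriv v (G y ys) x) xs"
    using alt_sum_additive_on[of xs G "Collect (smooth_on UNIV)" "\<lambda>f. dir_deriv v f x"]
      assms smooth_on_diff[of _ ] smooth_on_const[of 0] dir_deriv_diff[of _ _ x v]
    by (auto simp: zero_fun_def fun_diff_def)
  moreover have "alt_sum G xs = (\<lambda>z. alt_sum (\<lambda>y ys. G y ys z) xs)"
    by (auto simp: alt_sum_apply)
  ultimately show ?thesis by simp
qed

lemma smooth_form_UNIV:
  "smooth_form UNIV k U \<longleftrightarrow>
     (\<forall>x. alternating_form UNIV k (U x)) \<and> (\<forall>vs. smooth_on UNIV (\<lambda>x. U x vs))"
proof -
  have "smooth_on UNIV (\<lambda>x. U x vs)" if "\<forall>x. alternating_form UNIV k (U x)" "length vs \<noteq> k" for vs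
  proof -
    have "U x vs = 0" for x using that alternating_form_length by blast
    then show ?thesis by (simp add: smooth_on_const)
  qed
  moreover have "smooth_form UNIV k U \<longleftrightarrow>
     (\<forall>x. alternating_form UNIV k (U x)) \<and> (\<forall>vs. length vs = k \<longrightarrow> smooth_on UNIV (\<lambda>x. U x vs))"
  proof -
    have "U = U'" if "\<forall>x. U x = U' x" for U' using that by auto
    then show ?thesis unfolding smooth_form_def by auto
  qed
  ultimately show ?thesis by blast
qed

lemma smooth_form_UNIV_length: "smooth_form UNIV k U \<Longrightarrow> length vs \<noteq> k \<Longrightarrow> U x vs = 0"
  using alternating_form_length smooth_form_UNIV by blast

definition fun_mult :: "('a \<Rightarrow> real) \<Rightarrow> ('a \<Rightarrow> 'a list \<Rightarrow> real) \<Rightarrow> 'a \<Rightarrow> 'a list \<Rightarrow> real" where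
  "fun_mult g u = (\<lambda>x vs. g x * u x vs)"

text \<open>The covector is the same at all points: the differentials of barycentric coordinates are
  constant.\<close>

definition wedge1 :: "('a \<Rightarrow> real) \<Rightarrow> ('a \<Rightarrow> 'a list \<Rightarrow> real) \<Rightarrow> 'a \<Rightarrow> 'a list \<Rightarrow> real" where
  "wedge1 \<alpha> u = (\<lambda>x. alt_sum (\<lambda>v ws. \<alpha> v * u x ws))"

text \<open>The homotopy operator of the contraction of \<open>S\<close> to the point \<open>e\<close>.\<close>
definition cone_op :: "'a::euclidean_space set \<Rightarrow> 'a \<Rightarrow> ('a \<Rightarrow> 'a list \<Rightarrow> real) \<Rightarrow> 'a \<Rightarrow> 'a list \<Rightarrow> real" where
  "cone_op S e u = (\<lambda>x vs. if x \<in> S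
     then seg_integral e (length vs) (\<lambda>y. u y ((x - e) # vs)) x else 0)"

lemma smooth_form_UNIV_add:
  "smooth_form UNIV k U \<Longrightarrow> smooth_form UNIV k W \<Longrightarrow> smooth_form UNIV k (U + W)"
  by (simp add: smooth_form_UNIV plus_fun_def alternating_form_add smooth_on_add)

lemma smooth_form_UNIV_scaleR: "smooth_form UNIV k U \<Longrightarrow> smooth_form UNIV k (c *\<^sub>R U)"
  by (simp add: smooth_form_UNIV scaleR_fun_def alternating_form_mult smooth_on_cmult)

lemma smooth_form_UNIV_fun_mult:
  "bounded_linear l \<Longrightarrow> smooth_form UNIV k U \<Longrightarrow> smooth_form UNIV k (fun_mult (\<lambda>x. c + l x) U)"
  by (simp add: smooth_form_UNIV fun_mult_def alternating_form_mult smooth_on_mult_affine)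

lemma smooth_form_UNIV_wedge1:
  "linear \<alpha> \<Longrightarrow> smooth_form UNIV k U \<Longrightarrow> smooth_form UNIV (Suc k) (wedge1 \<alpha> U)"
  by (auto simp: smooth_form_UNIV wedge1_def alternating_form_wedge_covector
      intro!: smooth_on_alt_sum smooth_on_cmult)

text \<open>The variable also enters through the vector x - e. Its basis expansion leaves fixed
  vectors inside the integrals and affine functions of x in front, written as constant plus linear
  part to match the product rules for affine factors.\<close>

lemma cone_UNIV_expand:
  assumes "smooth_form UNIV (Suc k) U"
  shows "seg_integral e j (\<lambda>y. U y ((x - e) # vs)) x
    = (\<Sum>b\<in>Basis. (- (e \<bullet> b) + x \<bullet> b) * seg_integral e j (\<lambda>y. U y (b # vs)) x)"
proof -
  have lin: "linear (\<lambda>v. U y (v # vs))" and sm: "continuous_on UNIV (\<lambda>y. U y ws)" for y ws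
    using assms by (auto simp: smooth_form_UNIV alternating_form_Suc intro: smooth_onD)
  have "U y ((x - e) # vs) = (\<Sum>b\<in>Basis. (- (e \<bullet> b) + x \<bullet> b) * U y (b # vs))" for y
  proof -
    have "U y ((\<Sum>b\<in>Basis. ((x - e) \<bullet> b) *\<^sub>R b) # vs) = (\<Sum>b\<in>Basis. (- (e \<bullet> b) + x \<bullet> b) * U y (b # vs))"
      by (subst linear_sum[OF lin]) (simp add: linear_cmul[OF lin] inner_diff_left)
    then show ?thesis by (simp add: euclidean_representation)
  qed
  then show ?thesis
    by (simp add: seg_integral_sum seg_integral_cmult continuous_on_mult_left sm)
qed

lemma smooth_form_UNIV_cone:
  assumes "smooth_form UNIV (Suc k) U"
  shows "smooth_form UNIV k (cone_op UNIV e U)"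
proof -
  have af: "alternating_form UNIV (Suc k) (U y)" and sm: "smooth_on UNIV (\<lambda>y. U y ws)" for y ws
    using assms by (auto simp: smooth_form_UNIV)
  have ct: "continuous_on UNIV (\<lambda>y. c * U y ws)" for ws c
    using smooth_onD(3)[OF smooth_on_cmult[OF sm]] .
  have "alternating_form UNIV k (cone_op UNIV e U x)" for x
  proof (rule alternating_formI)
    show "cone_op UNIV e U x vs = 0" if "length vs \<noteq> k" for vs
      using that by (simp add: cone_op_def alternating_form_length[OF af])
    show "cone_op UNIV e U x vs = 0" if "length vs = k" "i < j" "j < k" "vs ! i = vs ! j" for vs i j
      using alternating_form_repeat[OF af, of "(x - e) # vs" "Suc i" "Suc j"] that by (simp add: cone_op_def)
    show "cone_op UNIV e U x (vs[i := a *\<^sub>R p + b *\<^sub>R q]) =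
        a * cone_op UNIV e U x (vs[i := p]) + b * cone_op UNIV e U x (vs[i := q])"
      if "length vs = k" "i < k" for vs i p q a b
      using alternating_form_update[OF af, where vs = "(x - e) # vs" and i = "Suc i" and a = a and x = p and b = b and y = q] that
      by (simp add: cone_op_def seg_integral_add ct seg_integral_cmult)
  qed
  moreover have "smooth_on UNIV (\<lambda>x. cone_op UNIV e U x vs)" for vs
    unfolding cone_op_def
    by (simp only: UNIV_I if_True cone_UNIV_expand[OF assms])
       (intro smooth_on_sum smooth_on_mult_affine bounded_linear_inner_left smooth_on_seg_integral sm)
  ultimately show ?thesis by (simp add: smooth_form_UNIV)
qed

text \<open>The product rule in the basis expansion: the first term differentiates the vector x - e,
  the second the integral, whose weight rises by one.\<close>

lemma dir_deriv_cone:
  assumes "smooth_form UNIV (Suc k) U"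
  shows "dir_deriv v (\<lambda>x. cone_op UNIV e U x ws) x
    = seg_integral e (length ws) (\<lambda>y. U y (v # ws)) x
      + seg_integral e (Suc (length ws)) (dir_deriv v (\<lambda>y. U y ((x - e) # ws))) x"
proof -
  have lin: "linear (\<lambda>v. U y (v # ws))" and sm: "smooth_on UNIV (\<lambda>y. U y ws)" for y ws
    using assms by (auto simp: smooth_form_UNIV alternating_form_Suc)
  have expand: "U y (w # ws) = (\<Sum>b\<in>Basis. (w \<bullet> b) * U y (b # ws))" for y w
  proof -
    have "U y ((\<Sum>b\<in>Basis. (w \<bullet> b) *\<^sub>R b) # ws) = (\<Sum>b\<in>Basis. (w \<bullet> b) * U y (b # ws))"
      by (subst linear_sum[OF lin]) (simp add: linear_cmul[OF lin])
    then show ?thesis by (simp add: euclidean_representation)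
  qed
  have d: "((\<lambda>x. seg_integral e j (\<lambda>y. U y (b # ws)) x) has_derivative
      (\<lambda>v. seg_integral e (Suc j) (dir_deriv v (\<lambda>y. U y (b # ws))) x)) (at x)" for j b x
    using smooth_onD(1)[OF smooth_on_seg_integral[OF sm]] dir_deriv_seg_integral[OF sm] by simp
  have "dir_deriv v (\<lambda>x. cone_op UNIV e U x ws) x =
      (\<Sum>b\<in>Basis. (v \<bullet> b) * seg_integral e (length ws) (\<lambda>y. U y (b # ws)) x
        + (- (e \<bullet> b) + x \<bullet> b) * seg_integral e (Suc (length ws)) (dir_deriv v (\<lambda>y. U y (b # ws))) x)"
  proof -
    have "(\<lambda>x. cone_op UNIV e U x ws) =
        (\<lambda>x. \<Sum>b\<in>Basis. (- (e \<bullet> b) + x \<bullet> b) * seg_integral e (length ws) (\<lambda>y. U y (b # ws)) x)"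
      by (rule ext) (simp only: cone_op_def UNIV_I if_True cone_UNIV_expand[OF assms])
    then show ?thesis
      by (simp only:) (rule dir_deriv_eqI, auto intro!: derivative_eq_intros d simp: add.commute)
  qed
  also have "\<dots> = seg_integral e (length ws) (\<lambda>y. U y (v # ws)) x
      + (\<Sum>b\<in>Basis. (- (e \<bullet> b) + x \<bullet> b) * seg_integral e (Suc (length ws)) (dir_deriv v (\<lambda>y. U y (b # ws))) x)"
    by (subst expand)
       (simp add: sum.distrib seg_integral_sum seg_integral_cmult continuous_on_mult_left smooth_onD(3)[OF sm])
  also have "(\<Sum>b\<in>Basis. (- (e \<bullet> b) + x \<bullet> b) * seg_integral e (Suc (length ws)) (dir_deriv v (\<lambda>y. U y (b # ws))) x)
      = seg_integral e (Suc (length ws)) (dir_deriv v (\<lambda>y. U y ((x - e) # ws))) x"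
  proof -
    have "dir_deriv v (\<lambda>y. U y ((x - e) # ws)) z
        = (\<Sum>b\<in>Basis. ((x - e) \<bullet> b) * dir_deriv v (\<lambda>y. U y (b # ws)) z)" for z
      by (subst expand, rule dir_deriv_eqI, auto intro!: derivative_eq_intros smooth_onD(1)[OF sm])
    then show ?thesis
      by (simp add: seg_integral_sum seg_integral_cmult continuous_on_mult_left
          smooth_onD(3)[OF smooth_onD(2)[OF sm]] inner_diff_left)
  qed
  finally show ?thesis .
qed

lemma ext_deriv_UNIV:
  "ext_deriv UNIV k U x vs =
     (if length vs = Suc k then alt_sum (\<lambda>v ws. dir_deriv v (\<lambda>y. U y ws) x) vs else 0)"
  by (simp add: ext_deriv_def alt_sum_eq_sum lessThan_Suc_atMost)

text \<open>The Poincare lemma as a homotopy formula. The terms that differentiate along the vectors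
  of the list cancel between the two summands; what remains is the integral over [0, 1] of the
  derivative in t of t^(k+1) times \<open>U\<close> along the segment.\<close>

theorem cone_homotopy:
  assumes U: "smooth_form UNIV (Suc k) U"
  shows "ext_deriv UNIV k (cone_op UNIV e U) + cone_op UNIV e (ext_deriv UNIV (Suc k) U) = U"
proof (intro ext)
  fix x vs
  have af: "alternating_form UNIV (Suc k) (U y)" and sm: "smooth_on UNIV (\<lambda>y. U y ws)" for y ws
    using U by (auto simp: smooth_form_UNIV)
  show "(ext_deriv UNIV k (cone_op UNIV e U) + cone_op UNIV e (ext_deriv UNIV (Suc k) U)) x vs = U x vs"
  proof (cases "length vs = Suc k")
    case len: True
    let ?D = "\<lambda>z. alt_sum (\<lambda>v ws. dir_deriv v (\<lambda>y. U y ((x - e) # ws)) z) vs"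
    have smD: "smooth_on UNIV ?D"
      by (rule smooth_on_alt_sum) (rule smooth_onD(2)[OF sm])
    have "ext_deriv UNIV k (cone_op UNIV e U) x vs =
        alt_sum (\<lambda>v ws. seg_integral e k (\<lambda>y. U y (v # ws)) x
          + seg_integral e (Suc k) (dir_deriv v (\<lambda>y. U y ((x - e) # ws))) x) vs"
      unfolding ext_deriv_UNIV dir_deriv_cone[OF U] if_P[OF len]
      by (rule alt_sum_cong) (use len in \<open>auto dest!: add_mset_eq_mset_length\<close>)
    also have "\<dots> = Suc k * seg_integral e k (\<lambda>y. U y vs) x + seg_integral e (Suc k) ?D x"
      unfolding alt_sum_add
      by (subst (1 2) seg_integral_alt_sum[symmetric])
         (auto simp: alt_sum_alternating_form[OF af len] seg_integral_cmult
           intro: smooth_onD sm simp del: of_nat_Suc)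
    finally have 1: "ext_deriv UNIV k (cone_op UNIV e U) x vs = \<dots>" .
    have "cone_op UNIV e (ext_deriv UNIV (Suc k) U) x vs =
        seg_integral e (Suc k) (\<lambda>z. dir_deriv (x - e) (\<lambda>y. U y vs) z - ?D z) x"
      by (simp add: cone_op_def len ext_deriv_UNIV)
    also have "\<dots> = seg_integral e (Suc k) (dir_deriv (x - e) (\<lambda>y. U y vs)) x - seg_integral e (Suc k) ?D x"
      by (rule seg_integral_diff) (auto intro: smooth_onD sm smD)
    finally show ?thesis
      using 1 seg_integral_fundamental(1)[OF smooth_onD(1)[OF sm], of vs e k x] smooth_onD(3)[OF smooth_onD(2)[OF sm]]
      by simp
  qed (simp add: ext_deriv_UNIV cone_op_def alternating_form_length[OF af])
qed

text \<open>In degree 0 the contraction ends in a constant, and the value at the cone point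
  remains.\<close>

lemma cone_homotopy_0:
  assumes "smooth_form UNIV 0 U"
  shows "cone_op UNIV e (ext_deriv UNIV 0 U) x [] = U x [] - U e []"
proof -
  have sm: "smooth_on UNIV (\<lambda>y. U y [])" using assms by (simp add: smooth_form_UNIV)
  show ?thesis
    using seg_integral_fundamental(2)[OF smooth_onD(1)[OF sm] smooth_onD(3)[OF smooth_onD(2)[OF sm]], of e x]
    by (simp add: cone_op_def ext_deriv_UNIV)
qed

lemma ext_deriv_UNIV_add:
  "smooth_form UNIV k U \<Longrightarrow> smooth_form UNIV k W \<Longrightarrow>
     ext_deriv UNIV k (U + W) = ext_deriv UNIV k U + ext_deriv UNIV k W"
  by (auto simp: fun_eq_iff ext_deriv_UNIV smooth_form_UNIV dir_deriv_add alt_sum_add)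

lemma ext_deriv_UNIV_scaleR:
  "smooth_form UNIV k U \<Longrightarrow> ext_deriv UNIV k (c *\<^sub>R U) = c *\<^sub>R ext_deriv UNIV k U"
  by (auto simp: fun_eq_iff ext_deriv_UNIV smooth_form_UNIV scaleR_fun_def dir_deriv_cmult alt_sum_mult)

lemma ext_deriv_UNIV_fun_mult:
  assumes "bounded_linear l" "smooth_form UNIV k U"
  shows "ext_deriv UNIV k (fun_mult (\<lambda>x. c + l x) U)
    = wedge1 l U + fun_mult (\<lambda>x. c + l x) (ext_deriv UNIV k U)"
proof (intro ext)
  fix x vs
  have af: "alternating_form UNIV k (U y)" and sm: "smooth_on UNIV (\<lambda>y. U y ws)" for y ws
    using assms by (auto simp: smooth_form_UNIV)
  have "wedge1 l U x vs = 0" if "length vs \<noteq> Suc k"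
    using smooth_form_UNIV_wedge1[OF bounded_linear.linear[OF assms(1)] assms(2)] that
    by (rule smooth_form_UNIV_length)
  then show "ext_deriv UNIV k (fun_mult (\<lambda>x. c + l x) U) x vs
      = (wedge1 l U + fun_mult (\<lambda>x. c + l x) (ext_deriv UNIV k U)) x vs"
    by (auto simp: fun_mult_def ext_deriv_UNIV dir_deriv_mult_affine[OF assms(1) sm] alt_sum_add
        alt_sum_mult wedge1_def)
qed

text \<open>Only \<open>U\<close> is differentiated, since \<open>\<alpha>\<close> is constant; the
  sign comes from exchanging the deletion of the derivative with that of the wedge product.\<close>

lemma ext_deriv_UNIV_wedge1:
  assumes "linear \<alpha>" "smooth_form UNIV k U"
  shows "ext_deriv UNIV (Suc k) (wedge1 \<alpha> U) = - wedge1 \<alpha> (ext_deriv UNIV k U)"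
proof (intro ext)
  fix x vs
  have sm: "smooth_on UNIV (\<lambda>y. c * U y ws)" for ws c
    using assms by (simp add: smooth_form_UNIV smooth_on_cmult)
  have sm': "smooth_on UNIV (\<lambda>y. U y ws)" for ws
    using assms by (simp add: smooth_form_UNIV)
  show "ext_deriv UNIV (Suc k) (wedge1 \<alpha> U) x vs = (- wedge1 \<alpha> (ext_deriv UNIV k U)) x vs"
  proof (cases "length vs = Suc (Suc k)")
    case True
    have "ext_deriv UNIV (Suc k) (wedge1 \<alpha> U) x vs
        = alt_sum (\<lambda>v ws. alt_sum (\<lambda>w us. \<alpha> w * dir_deriv v (\<lambda>y. U y us) x) ws) vs"
      by (simp add: ext_deriv_UNIV True wedge1_def dir_deriv_alt_sum[OF sm] dir_deriv_cmult[OF sm'])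
    also have "\<dots> = - alt_sum (\<lambda>v ws. alt_sum (\<lambda>w us. \<alpha> v * dir_deriv w (\<lambda>y. U y us) x) ws) vs"
      by (rule alt_sum_alt_sum_swap)
    also have "\<dots> = - wedge1 \<alpha> (ext_deriv UNIV k U) x vs"
      unfolding wedge1_def alt_sum_mult
      by (rule arg_cong[where f = uminus], rule alt_sum_cong)
         (use True in \<open>auto simp: ext_deriv_UNIV dest!: add_mset_eq_mset_length\<close>)
    finally show ?thesis by simp
  next
    case False
    have "wedge1 \<alpha> (ext_deriv UNIV k U) x vs = alt_sum (\<lambda>v ws. 0) vs"
      unfolding wedge1_def
      by (rule alt_sum_cong) (use False in \<open>auto simp: ext_deriv_UNIV dest!: add_mset_eq_mset_length\<close>)
    then show ?thesis using False by (simp add: ext_deriv_UNIV)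
  qed
qed


section \<open>Smooth forms on convex sets\<close>

text \<open>Identities are proved with ordinary derivatives on the whole space and carried over to
  \<open>S\<close> by this map.\<close>

definition restrict_form :: "'a::euclidean_space set \<Rightarrow> ('a \<Rightarrow> 'a list \<Rightarrow> real) \<Rightarrow> 'a \<Rightarrow> 'a list \<Rightarrow> real" where
  "restrict_form S U = (\<lambda>x vs. if x \<in> S \<and> set vs \<subseteq> tangent S then U x vs else 0)"

text \<open>Cut off outside the tangent space, in line with the convention for forms, so that it
  coincides with the differential of an affine function regarded as a 1-form on
  \<open>S\<close>.\<close>

definition covector_on :: "'a::euclidean_space set \<Rightarrow> ('a \<Rightarrow> real) \<Rightarrow> 'a \<Rightarrow> real" where
  "covector_on S \<alpha> = (\<lambda>v. if v \<in> tangent S then \<alpha> v else 0)"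

lemma restrict_form_add: "restrict_form S (U + W) = restrict_form S U + restrict_form S W"
  by (auto simp: restrict_form_def fun_eq_iff)

lemma restrict_form_diff: "restrict_form S (U - W) = restrict_form S U - restrict_form S W"
  by (auto simp: restrict_form_def fun_eq_iff)

lemma restrict_form_uminus: "restrict_form S (- U) = - restrict_form S U"
  by (auto simp: restrict_form_def fun_eq_iff)

lemma restrict_form_scaleR: "restrict_form S (c *\<^sub>R U) = c *\<^sub>R restrict_form S U"
  by (auto simp: restrict_form_def fun_eq_iff scaleR_fun_def)

lemma fun_mult_restrict_form: "fun_mult g (restrict_form S U) = restrict_form S (fun_mult g U)"
  by (auto simp: restrict_form_def fun_mult_def fun_eq_iff)

lemma add_mset_eq_mset_set: "add_mset y (mset ys) = mset xs \<Longrightarrow> set xs = insert y (set ys)"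
  by (metis set_mset_add_mset_insert set_mset_mset)

text \<open>A vector that is not tangent is either the deleted one or still in the remainder, so
  every term on the left vanishes as well.\<close>

lemma wedge1_restrict_form:
  "wedge1 (covector_on S \<alpha>) (restrict_form S U) = restrict_form S (wedge1 \<alpha> U)"
proof (intro ext)
  fix x vs
  have "alt_sum (\<lambda>v ws. covector_on S \<alpha> v * restrict_form S U x ws) vs =
      alt_sum (\<lambda>v ws. if x \<in> S \<and> set vs \<subseteq> tangent S then \<alpha> v * U x ws else 0) vs"
    by (rule alt_sum_cong) (auto simp: covector_on_def restrict_form_def dest!: add_mset_eq_mset_set)
  then show "wedge1 (covector_on S \<alpha>) (restrict_form S U) x vs = restrict_form S (wedge1 \<alpha> U) x vs"
    by (cases "x \<in> S"; cases "set vs \<subseteq> tangent S"; simp add: wedge1_def restrict_form_def)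
qed

text \<open>Convexity keeps the segment to \<open>e\<close> inside \<open>S\<close>, and the radial
  vector is tangent.\<close>

lemma cone_restrict_form:
  assumes "convex S" "e \<in> S"
  shows "cone_op S e (restrict_form S U) = restrict_form S (cone_op UNIV e U)"
proof (intro ext)
  fix x vs
  show "cone_op S e (restrict_form S U) x vs = restrict_form S (cone_op UNIV e U) x vs"
  proof (cases "x \<in> S")
    case True
    have "e + t *\<^sub>R (x - e) \<in> S" if "t \<in> {0..1}" for t
      using convexD_alt[OF assms True, of t] that by (simp add: algebra_simps)
    moreover have "x - e \<in> tangent S" using assms True by (auto intro: diff_mem_tangent hull_inc)
    ultimately show ?thesis
      using True
      by (auto simp: cone_op_def restrict_form_def seg_integral_def intro!: integral_cong)
  qed (simp add: cone_op_def restrict_form_def)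
qed

text \<open>From left to right, the given extension to the affine hull is pulled back along an
  affine retraction, which extends it to all points and to all vectors.\<close>

lemma smooth_form_iff_restrict_form:
  assumes "S \<noteq> {}"
  shows "smooth_form S k u \<longleftrightarrow> (\<exists>U. smooth_form UNIV k U \<and> u = restrict_form S U)"
proof
  assume "smooth_form S k u"
  then obtain U0 where u0: "\<And>x. x \<notin> S \<Longrightarrow> u x = 0"
    and af: "\<And>x. x \<in> affine hull S \<Longrightarrow> alternating_form S k (U0 x)"
    and sm: "\<And>vs. vs \<in> vectors S k \<Longrightarrow> smooth_on (affine hull S) (\<lambda>x. U0 x vs)"
    and uU: "\<And>x. x \<in> S \<Longrightarrow> u x = U0 x"
    unfolding smooth_form_def by blast
  obtain c l where l: "linear l" "range l \<subseteq> tangent S" "\<And>v. v \<in> tangent S \<Longrightarrow> l v = v"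
    "\<And>x. c + l x \<in> affine hull S" "\<And>x. x \<in> affine hull S \<Longrightarrow> c + l x = x"
    using affine_retraction_exists[OF assms] by metis
  define U where "U = (\<lambda>x vs. if length vs = k then U0 (c + l x) (map l vs) else 0)"
  have lv: "map l vs \<in> vectors S k" if "length vs = k" for vs
    using l(2) that by (auto simp: vectors_def)
  have "alternating_form UNIV k (U x)" for x
  proof (rule alternating_formI)
    fix vs :: "'a list" and i j assume "length vs = k" "i < j" "j < k" "vs ! i = vs ! j"
    moreover have "\<omega> ws = 0" if "alternating_form S k \<omega>" "ws \<in> vectors S k" "i < j" "j < k" "ws ! i = ws ! j"
      for \<omega> ws
      using that unfolding alternating_form_def by blast
    ultimately show "U x vs = 0"
      using af[OF l(4)[of x]] lv[of vs] by (simp add: U_def)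
  next
    fix vs :: "'a list" and i p q and a b :: real assume vs: "length vs = k" "i < k"
    have "\<omega> (ws[i := a *\<^sub>R p + b *\<^sub>R q]) = a * \<omega> (ws[i := p]) + b * \<omega> (ws[i := q])"
      if "alternating_form S k \<omega>" "ws \<in> vectors S k" "p \<in> tangent S" "q \<in> tangent S" for \<omega> ws p q
      using that vs(2) unfolding alternating_form_def by blast
    from this[OF af[OF l(4)[of x]] lv[OF vs(1)], of "l p" "l q"]
    have "U0 (c + l x) ((map l vs)[i := a *\<^sub>R l p + b *\<^sub>R l q]) =
        a * U0 (c + l x) ((map l vs)[i := l p]) + b * U0 (c + l x) ((map l vs)[i := l q])"
      using l(2) by blast
    then show "U x (vs[i := a *\<^sub>R p + b *\<^sub>R q]) = a * U x (vs[i := p]) + b * U x (vs[i := q])"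
      using vs by (simp add: U_def map_update linear_add[OF l(1)] linear_cmul[OF l(1)])
  qed (simp add: U_def)
  moreover have "smooth_on UNIV (\<lambda>x. U x vs)" for vs
  proof (cases "length vs = k")
    case True
    have "range (\<lambda>x. c + l x) \<subseteq> affine hull S" using l(4) by blast
    have "Ck_on n UNIV (\<lambda>x. U0 (c + l x) (map l vs))" for n
      by (rule Ck_on_compose_affine[where f = "\<lambda>y. U0 y (map l vs)" and A = "affine hull S"])
         (use sm[OF lv[OF True]] l \<open>range (\<lambda>x. c + l x) \<subseteq> affine hull S\<close> in
           \<open>auto simp: smooth_on_def affine_imp_convex linear_conv_bounded_linear[THEN iffD1]\<close>)
    then show ?thesis using True by (simp add: smooth_on_def U_def)
  qed (simp add: U_def smooth_on_const)
  moreover have "u = restrict_form S U"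
  proof (intro ext)
    fix x vs
    show "u x vs = restrict_form S U x vs"
    proof (cases "x \<in> S")
      case True
      then have x: "x \<in> affine hull S" by (rule hull_inc)
      have "U0 x vs = 0" if "vs \<notin> vectors S k"
        using af[OF x] that by (simp add: alternating_form_def)
      moreover have "map l vs = vs" if "vs \<in> vectors S k"
        using that l(3) by (auto simp: vectors_def intro!: map_idI)
      ultimately show ?thesis
        using True l(5)[OF x] by (auto simp: uU restrict_form_def U_def vectors_def)
    qed (simp add: u0 restrict_form_def)
  qed
  ultimately show "\<exists>U. smooth_form UNIV k U \<and> u = restrict_form S U"
    by (auto simp: smooth_form_UNIV)
next
  assume "\<exists>U. smooth_form UNIV k U \<and> u = restrict_form S U"
  then obtain U where U: "smooth_form UNIV k U" and u: "u = restrict_form S U" by blast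
  then have af: "alternating_form UNIV k (U x)" and sm: "smooth_on UNIV (\<lambda>x. U x vs)" for x vs
    by (auto simp: smooth_form_UNIV)
  let ?U = "restrict_form (affine hull S) U"
  have "alternating_form S k (?U x)" if x: "x \<in> affine hull S" for x
    unfolding alternating_form_def
  proof (intro conjI allI ballI impI)
    fix vs assume "vs \<notin> vectors S k"
    then show "?U x vs = 0"
      using alternating_form_length[OF af] by (auto simp: vectors_def restrict_form_def)
  next
    fix vs i p q and a b :: real
    assume vs: "vs \<in> vectors S k" "i < k" "p \<in> tangent S" "q \<in> tangent S"
    then have "set (vs[i := z]) \<subseteq> tangent S" if "z \<in> tangent S" for z
      using set_update_subset_insert[of vs i z] that by (auto simp: vectors_def)
    moreover have "a *\<^sub>R p + b *\<^sub>R q \<in> tangent S"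
      using vs subspace_tangent[OF assms] by (simp add: subspace_add subspace_scale)
    ultimately show "?U x (vs[i := a *\<^sub>R p + b *\<^sub>R q]) = a * ?U x (vs[i := p]) + b * ?U x (vs[i := q])"
      using vs x alternating_form_update[OF af] by (simp add: restrict_form_def vectors_def)
  next
    fix vs i j assume "vs \<in> vectors S k" "i < j \<and> j < k \<and> vs ! i = vs ! j"
    then show "?U x vs = 0"
      using alternating_form_repeat[OF af, of vs i j x] by (auto simp: vectors_def restrict_form_def)
  qed
  moreover have "smooth_on (affine hull S) (\<lambda>x. ?U x vs)" if "vs \<in> vectors S k" for vs
  proof -
    have "Ck_on n (affine hull S) (\<lambda>x. U x vs)" for n
      by (rule Ck_on_UNIV_imp) (use sm[of vs] in \<open>simp_all add: smooth_on_def affine_imp_convex\<close>)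
    moreover have "Ck_on n (affine hull S) (\<lambda>x. ?U x vs) = Ck_on n (affine hull S) (\<lambda>x. U x vs)" for n
      by (rule Ck_on_cong) (use that in \<open>simp add: restrict_form_def vectors_def\<close>)
    ultimately show ?thesis by (simp add: smooth_on_def)
  qed
  ultimately show "smooth_form S k u"
    unfolding smooth_form_def
    by (intro conjI exI[of _ ?U]) (auto simp: u restrict_form_def fun_eq_iff hull_inc)
qed

text \<open>The derivative on the whole space is also a derivative within \<open>S\<close>, and in
  tangent directions the latter is unique.\<close>

lemma ext_deriv_restrict_form:
  assumes "convex S" "smooth_form UNIV k U"
  shows "ext_deriv S k (restrict_form S U) = restrict_form S (ext_deriv UNIV k U)"
proof (intro ext)
  fix x vs
  show "ext_deriv S k (restrict_form S U) x vs = restrict_form S (ext_deriv UNIV k U) x vs"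
  proof (cases "x \<in> S \<and> vs \<in> vectors S (Suc k)")
    case True
    have "frechet_derivative (\<lambda>y. restrict_form S U y (take i vs @ drop (Suc i) vs)) (at x within S) (vs ! i)
        = dir_deriv (vs ! i) (\<lambda>y. U y (take i vs @ drop (Suc i) vs)) x" if "i \<le> k" for i
    proof (rule frechet_derivative_within_eq[OF assms(1)])
      let ?ws = "take i vs @ drop (Suc i) vs"
      have "smooth_on UNIV (\<lambda>y. U y ?ws)" using assms(2) by (simp add: smooth_form_UNIV)
      from has_derivative_at_withinI[OF smooth_onD(1)[OF this]]
      show "((\<lambda>y. U y ?ws) has_derivative (\<lambda>v. dir_deriv v (\<lambda>y. U y ?ws) x)) (at x within S)" .
      show "restrict_form S U y ?ws = U y ?ws" if "y \<in> S" for y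
        using True that by (auto simp: restrict_form_def vectors_def dest!: in_set_takeD in_set_dropD)
      show "x \<in> S" "vs ! i \<in> tangent S"
        using True \<open>i \<le> k\<close> by (auto simp: vectors_def)
    qed
    then show ?thesis using True by (simp add: ext_deriv_def restrict_form_def vectors_def)
  qed (auto simp: ext_deriv_def restrict_form_def vectors_def)
qed

section \<open>Calculus of forms on one convex set\<close>

locale convex_domain =
  fixes S :: "'a::euclidean_space set"
  assumes convex: "convex S" and nonempty: "S \<noteq> {}"
begin

lemma smooth_formE:
  assumes "smooth_form S k u"
  obtains U where "smooth_form UNIV k U" "u = restrict_form S U"
  using assms smooth_form_iff_restrict_form[OF nonempty] by blast

lemma smooth_formI: "smooth_form UNIV k U \<Longrightarrow> smooth_form S k (restrict_form S U)"
  using smooth_form_iff_restrict_form[OF nonempty] by blast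

lemma smooth_form_swap_antisymmetric: "smooth_form S k u \<Longrightarrow> swap_antisymmetric (u x)"
proof (erule smooth_formE)
  fix U assume U: "smooth_form UNIV k U" "u = restrict_form S U"
  then have swap: "swap_antisymmetric (U x)"
    using swap_antisymmetric_alternating_form smooth_form_UNIV by blast
  have "u x (xs @ a # b # ys) = - u x (xs @ b # a # ys)" for xs a b ys
    using swap_antisymmetricD[OF swap, of xs a b ys] by (auto simp: U(2) restrict_form_def)
  then show ?thesis unfolding swap_antisymmetric_def by blast
qed

lemma smooth_form_eq_0:
  "smooth_form S k u \<Longrightarrow> \<not> (x \<in> S \<and> set vs \<subseteq> tangent S \<and> length vs = k) \<Longrightarrow> u x vs = 0"
  by (erule smooth_formE) (auto simp: restrict_form_def smooth_form_UNIV_length)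

lemma smooth_form_add: "smooth_form S k u \<Longrightarrow> smooth_form S k w \<Longrightarrow> smooth_form S k (u + w)"
  by (elim smooth_formE) (simp add: restrict_form_add[symmetric] smooth_formI smooth_form_UNIV_add)

lemma smooth_form_scaleR: "smooth_form S k u \<Longrightarrow> smooth_form S k (c *\<^sub>R u)"
  by (elim smooth_formE) (simp add: restrict_form_scaleR[symmetric] smooth_formI smooth_form_UNIV_scaleR)

lemma smooth_form_const:
  "smooth_form S 0 (\<lambda>x vs. if x \<in> S \<and> vs = [] then c else 0)"
proof -
  have "smooth_form UNIV 0 (\<lambda>(x::'a) vs. if vs = [] then c else 0)"
    by (auto simp: smooth_form_UNIV smooth_on_const intro!: alternating_formI split: if_splits)
  moreover have "(\<lambda>x vs. if x \<in> S \<and> vs = [] then c else 0)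
      = restrict_form S (\<lambda>x vs. if vs = [] then c else 0)"
    by (auto simp: restrict_form_def fun_eq_iff)
  ultimately show ?thesis using smooth_formI by simp
qed

lemma smooth_form_0: "smooth_form S k 0"
proof -
  have "smooth_form UNIV k (0 :: 'a \<Rightarrow> 'a list \<Rightarrow> real)"
    by (auto simp: smooth_form_UNIV smooth_on_const intro!: alternating_formI)
  moreover have "0 = restrict_form S 0"
    by (auto simp: restrict_form_def fun_eq_iff)
  ultimately show ?thesis using smooth_formI by metis
qed

lemma smooth_form_diff: "smooth_form S k u \<Longrightarrow> smooth_form S k w \<Longrightarrow> smooth_form S k (u - w)"
  using smooth_form_add[of k u "-1 *\<^sub>R w"] smooth_form_scaleR[of k w "-1"] by simp

lemma smooth_form_sum: "(\<And>i. i \<in> I \<Longrightarrow> smooth_form S k (f i)) \<Longrightarrow> smooth_form S k (sum f I)"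
  by (induction I rule: infinite_finite_induct) (auto simp: smooth_form_add smooth_form_0)

lemma smooth_form_fun_mult:
  "linear l \<Longrightarrow> smooth_form S k u \<Longrightarrow> smooth_form S k (fun_mult (\<lambda>x. c + l x) u)"
  by (elim smooth_formE)
     (simp add: fun_mult_restrict_form smooth_formI smooth_form_UNIV_fun_mult linear_conv_bounded_linear)

lemma smooth_form_wedge1:
  "linear \<alpha> \<Longrightarrow> smooth_form S k u \<Longrightarrow> smooth_form S (Suc k) (wedge1 (covector_on S \<alpha>) u)"
  by (elim smooth_formE) (simp add: wedge1_restrict_form smooth_formI smooth_form_UNIV_wedge1)

lemma smooth_form_cone: "e \<in> S \<Longrightarrow> smooth_form S (Suc k) u \<Longrightarrow> smooth_form S k (cone_op S e u)"
  by (elim smooth_formE) (simp add: cone_restrict_form convex smooth_formI smooth_form_UNIV_cone)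

lemma ext_deriv_add:
  "smooth_form S k u \<Longrightarrow> smooth_form S k w \<Longrightarrow> ext_deriv S k (u + w) = ext_deriv S k u + ext_deriv S k w"
  by (elim smooth_formE)
     (simp add: restrict_form_add[symmetric] ext_deriv_restrict_form convex smooth_form_UNIV_add ext_deriv_UNIV_add)

lemma ext_deriv_scaleR:
  "smooth_form S k u \<Longrightarrow> ext_deriv S k (c *\<^sub>R u) = c *\<^sub>R ext_deriv S k u"
  by (elim smooth_formE)
     (simp add: restrict_form_scaleR[symmetric] ext_deriv_restrict_form convex smooth_form_UNIV_scaleR
       ext_deriv_UNIV_scaleR)

lemma ext_deriv_diff:
  "smooth_form S k u \<Longrightarrow> smooth_form S k w \<Longrightarrow> ext_deriv S k (u - w) = ext_deriv S k u - ext_deriv S k w"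
  using ext_deriv_add[of k u "-1 *\<^sub>R w"] ext_deriv_scaleR[of k w "-1"] smooth_form_scaleR[of k w "-1"] by simp

lemma ext_deriv_0: "ext_deriv S k 0 = 0"
  using ext_deriv_scaleR[OF smooth_form_0, of k 0] by simp

lemma ext_deriv_sum:
  "(\<And>i. i \<in> I \<Longrightarrow> smooth_form S k (f i)) \<Longrightarrow> ext_deriv S k (sum f I) = (\<Sum>i\<in>I. ext_deriv S k (f i))"
  by (induction I rule: infinite_finite_induct) (auto simp: ext_deriv_add ext_deriv_0 smooth_form_sum)

lemma ext_deriv_fun_mult:
  "linear l \<Longrightarrow> smooth_form S k u \<Longrightarrow>
     ext_deriv S k (fun_mult (\<lambda>x. c + l x) u)
       = wedge1 (covector_on S l) u + fun_mult (\<lambda>x. c + l x) (ext_deriv S k u)"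
  by (elim smooth_formE)
     (simp add: fun_mult_restrict_form wedge1_restrict_form restrict_form_add[symmetric] ext_deriv_restrict_form
       convex smooth_form_UNIV_fun_mult linear_conv_bounded_linear ext_deriv_UNIV_fun_mult)

lemma ext_deriv_wedge1:
  "linear \<alpha> \<Longrightarrow> smooth_form S k u \<Longrightarrow>
     ext_deriv S (Suc k) (wedge1 (covector_on S \<alpha>) u) = - wedge1 (covector_on S \<alpha>) (ext_deriv S k u)"
  by (elim smooth_formE)
     (simp add: wedge1_restrict_form restrict_form_uminus[symmetric] ext_deriv_restrict_form
       convex smooth_form_UNIV_wedge1 ext_deriv_UNIV_wedge1)

lemma cone_op_0: "cone_op S e 0 = 0"
  by (auto simp: cone_op_def fun_eq_iff)

lemma ext_deriv_cone_closed:
  assumes "e \<in> S" "smooth_form S (Suc k) u" "ext_deriv S (Suc k) u = 0"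
  shows "ext_deriv S k (cone_op S e u) = u"
proof -
  obtain U where U: "smooth_form UNIV (Suc k) U" "u = restrict_form S U"
    using assms(2) by (rule smooth_formE)
  \<comment> \<open>The extension \<open>U\<close> need not be closed. Only the restriction of its
    derivative vanishes, but on \<open>S\<close> the cone operator depends on that restriction
    alone.\<close>
  have "restrict_form S (cone_op UNIV e (ext_deriv UNIV (Suc k) U)) = 0"
    using assms(3) by (simp add: cone_restrict_form[OF convex assms(1), symmetric] U
        ext_deriv_restrict_form[OF convex U(1)] cone_op_0)
  moreover have "ext_deriv UNIV k (cone_op UNIV e U) = U - cone_op UNIV e (ext_deriv UNIV (Suc k) U)"
    using cone_homotopy[OF U(1), of e] by (simp add: algebra_simps)
  ultimately show ?thesis
    by (simp add: U cone_restrict_form[OF convex assms(1)]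
        ext_deriv_restrict_form[OF convex smooth_form_UNIV_cone[OF U(1)]] restrict_form_diff)
qed

lemma closed_0_form_constant:
  assumes "x \<in> S" "e \<in> S" "smooth_form S 0 u" "ext_deriv S 0 u = 0"
  shows "u x [] = u e []"
proof -
  obtain U where U: "smooth_form UNIV 0 U" "u = restrict_form S U"
    using assms(3) by (rule smooth_formE)
  have "restrict_form S (cone_op UNIV e (ext_deriv UNIV 0 U)) x [] = 0"
    using assms(4) by (simp add: cone_restrict_form[OF convex assms(2), symmetric] U
        ext_deriv_restrict_form[OF convex U(1)] cone_op_0)
  then show ?thesis
    using cone_homotopy_0[OF U(1), of e x] assms(1,2) by (simp add: U restrict_form_def)
qed

end


text \<open>Induction and calculational steps leave forms eta-expanded; these rules contract them.\<close>
lemma form_eta: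
  fixes u w :: "'a \<Rightarrow> 'b list \<Rightarrow> real"
  shows "(\<lambda>x vs. 0) = (0 :: 'a \<Rightarrow> 'b list \<Rightarrow> real)" "(\<lambda>x vs. u x vs + w x vs) = u + w"
    "(\<lambda>x vs. u x vs - w x vs) = u - w" "(\<lambda>x vs. - u x vs) = - u"
  by (auto simp: fun_eq_iff)

section \<open>Sums over tuples of vertices\<close>

definition tuples :: "'v set \<Rightarrow> nat \<Rightarrow> 'v list set" where
  "tuples T n = {I. set I \<subseteq> T \<and> length I = n}"

lemma tuples_0 [simp]: "tuples T 0 = {[]}"
  by (auto simp: tuples_def)

lemma finite_tuples: "finite T \<Longrightarrow> finite (tuples T n)"
  by (simp add: tuples_def finite_lists_length_eq)

lemma sum_tuples_Suc:
  assumes "finite T"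
  shows "(\<Sum>I\<in>tuples T (Suc n). f I) = (\<Sum>i\<in>T. \<Sum>J\<in>tuples T n. f (i # J))"
proof -
  have "tuples T (Suc n) = (\<lambda>(i, J). i # J) ` (T \<times> tuples T n)"
    by (auto simp: tuples_def length_Suc_conv image_iff)
  moreover have "inj_on (\<lambda>(i, J). i # J) (T \<times> tuples T n)"
    by (auto simp: inj_on_def)
  ultimately show ?thesis
    by (simp add: sum.reindex sum.cartesian_product case_prod_unfold)
qed

section \<open>The zigzag on one simplex\<close>

lemma linear_fun_mult: "linear (fun_mult g)"
  by (rule linearI) (auto simp: fun_mult_def fun_eq_iff scaleR_fun_def algebra_simps)

lemma linear_wedge1: "linear (wedge1 \<alpha>)"
proof (rule linearI)
  show "wedge1 \<alpha> (u + w) = wedge1 \<alpha> u + wedge1 \<alpha> w" for u w :: "'a \<Rightarrow> 'a list \<Rightarrow> real"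
    by (auto simp: wedge1_def fun_eq_iff algebra_simps alt_sum_add)
  show "wedge1 \<alpha> (r *\<^sub>R u) = r *\<^sub>R wedge1 \<alpha> u" for r and u :: "'a \<Rightarrow> 'a list \<Rightarrow> real"
    using alt_sum_mult[of r "\<lambda>v ws. \<alpha> v * u _ ws"]
    by (auto simp: wedge1_def fun_eq_iff scaleR_fun_def algebra_simps)
qed

lemma wedge1_wedge1: "wedge1 \<alpha> (wedge1 \<beta> u) = - wedge1 \<beta> (wedge1 \<alpha> u)"
proof (intro ext)
  fix x vs
  have "wedge1 \<alpha> (wedge1 \<beta> u) x vs = alt_sum (\<lambda>a ws. alt_sum (\<lambda>b zs. \<alpha> a * (\<beta> b * u x zs)) ws) vs"
    by (simp add: wedge1_def alt_sum_mult)
  also have "\<dots> = - alt_sum (\<lambda>a ws. alt_sum (\<lambda>b zs. \<alpha> b * (\<beta> a * u x zs)) ws) vs"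
    by (rule alt_sum_alt_sum_swap)
  also have "\<dots> = - wedge1 \<beta> (wedge1 \<alpha> u) x vs"
    by (simp add: wedge1_def alt_sum_mult[symmetric] mult.left_commute)
  finally show "wedge1 \<alpha> (wedge1 \<beta> u) x vs = (- wedge1 \<beta> (wedge1 \<alpha> u)) x vs" by simp
qed

definition pick :: "'v set \<Rightarrow> 'v" where
  "pick A = (SOME i. i \<in> A)"

lemma pick_in: "A \<noteq> {} \<Longrightarrow> pick A \<in> A"
  unfolding pick_def by (rule someI_ex) blast

text \<open>Since the cone point depends only on the set of entries of the tuple \<open>I\<close>, the forms
  \<open>zigzag S p u n I\<close> are alternating in \<open>I\<close>.\<close>

primrec zigzag :: "'a::euclidean_space set \<Rightarrow> ('v \<Rightarrow> 'a) \<Rightarrow> ('a \<Rightarrow> 'a list \<Rightarrow> real) \<Rightarrow> nat \<Rightarrow>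
    'v list \<Rightarrow> 'a \<Rightarrow> 'a list \<Rightarrow> real" where
  "zigzag S p u 0 = (\<lambda>I. if I = [] then u else 0)"
| "zigzag S p u (Suc n) = (\<lambda>I. cone_op S (p (pick (set I))) (alt_sum (\<lambda>_. zigzag S p u n) I))"

lemma cone_op_uminus: "cone_op S e (- u) = - cone_op S e u"
  using seg_integral_cmult[of e _ "-1"] by (auto simp: cone_op_def fun_eq_iff)

lemma swap_antisymmetric_zigzag: "swap_antisymmetric (zigzag S p u n)"
proof (induction n)
  case (Suc n)
  note swap = swap_antisymmetricD[OF swap_antisymmetric_alt_sum[OF Suc]]
  have "zigzag S p u (Suc n) (xs @ a # b # ys) = - zigzag S p u (Suc n) (xs @ b # a # ys)" for xs a b ys
    using swap[of xs a b ys] by (simp add: cone_op_uminus insert_commute)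
  then show ?case unfolding swap_antisymmetric_def by blast
qed (simp add: swap_antisymmetric_def)

text \<open>The barycentric coordinate of vertex \<open>i\<close> is the affine function
  \<open>c i + l i x\<close> on the ambient space, and \<open>p i\<close> is the position of the
  vertex. Of the coordinates only the two partition of unity identities are kept, the second one for
  their differentials.\<close>

locale simplex_forms = convex_domain S for S :: "'a::euclidean_space set" +
  fixes T :: "'v set" and p :: "'v \<Rightarrow> 'a" and c :: "'v \<Rightarrow> real" and l :: "'v \<Rightarrow> 'a \<Rightarrow> real"
  assumes finite_T: "finite T" and p_in: "\<And>i. i \<in> T \<Longrightarrow> p i \<in> S"
    and linear_l: "\<And>i. linear (l i)"
    and sum_bary: "\<And>x. x \<in> S \<Longrightarrow> (\<Sum>i\<in>T. c i + l i x) = 1"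
    and sum_l: "\<And>v. v \<in> tangent S \<Longrightarrow> (\<Sum>i\<in>T. l i v) = 0"
begin

text \<open>The operators \<open>m i\<close>, \<open>e i\<close> and \<open>E I\<close> multiply a
  form from the left by lambda_i, by dlambda_i and by the product of the dlambda along
  \<open>I\<close>.\<close>

definition m :: "'v \<Rightarrow> ('a \<Rightarrow> 'a list \<Rightarrow> real) \<Rightarrow> 'a \<Rightarrow> 'a list \<Rightarrow> real" where
  "m i = fun_mult (\<lambda>x. c i + l i x)"

definition e :: "'v \<Rightarrow> ('a \<Rightarrow> 'a list \<Rightarrow> real) \<Rightarrow> 'a \<Rightarrow> 'a list \<Rightarrow> real" where
  "e i = wedge1 (covector_on S (l i))"

definition E :: "'v list \<Rightarrow> ('a \<Rightarrow> 'a list \<Rightarrow> real) \<Rightarrow> 'a \<Rightarrow> 'a list \<Rightarrow> real" where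
  "E I u = foldr e I u"

lemma E_simps [simp]: "E [] u = u" "E (i # I) u = e i (E I u)"
  by (simp_all add: E_def)

lemma linear_m: "linear (m i)"
  by (simp add: m_def linear_fun_mult)

lemma linear_e: "linear (e i)"
  by (simp add: e_def linear_wedge1)

lemma linear_E: "linear (E I)"
proof (induction I)
  case Nil
  have "E [] = (\<lambda>u. u)" by (rule ext) simp
  then show ?case by (simp add: linear_ident)
next
  case (Cons i I)
  have "E (i # I) = e i \<circ> E I" by (rule ext) simp
  with linear_compose[OF Cons linear_e] show ?case by metis
qed

lemma e_anticommute: "e i (e j u) = - e j (e i u)"
  unfolding e_def by (rule wedge1_wedge1)

lemma swap_antisymmetric_E: "swap_antisymmetric (\<lambda>I. E I u)"
proof -
  have "E (xs @ a # b # ys) u + E (xs @ b # a # ys) u = 0" for xs a b ys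
  proof (induction xs)
    case Nil
    show "E ([] @ a # b # ys) u + E ([] @ b # a # ys) u = 0" using e_anticommute[of a b] by simp
  next
    case (Cons i xs)
    have "e i (E (xs @ a # b # ys) u + E (xs @ b # a # ys) u) = 0"
      unfolding Cons by (rule linear_0[OF linear_e])
    then show "E ((i # xs) @ a # b # ys) u + E ((i # xs) @ b # a # ys) u = 0"
      by (simp add: linear_add[OF linear_e])
  qed
  then show ?thesis unfolding swap_antisymmetric_def eq_neg_iff_add_eq_0 by blast
qed

lemma sum_e: "(\<Sum>i\<in>T. e i u) = 0"
proof (intro ext)
  fix x vs
  have "(\<Sum>i\<in>A. e i u) x vs = alt_sum (\<lambda>v ws. (\<Sum>i\<in>A. covector_on S (l i) v) * u x ws) vs" if "finite A" for A
    using that by induction (auto simp: e_def wedge1_def alt_sum_add algebra_simps)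
  moreover have "(\<Sum>i\<in>T. covector_on S (l i) v) = 0" for v
    by (cases "v \<in> tangent S") (simp_all add: covector_on_def sum_l)
  ultimately show "(\<Sum>i\<in>T. e i u) x vs = 0 x vs" using finite_T by simp
qed

lemma sum_m:
  assumes "\<And>x. x \<notin> S \<Longrightarrow> u x = 0"
  shows "(\<Sum>i\<in>T. m i u) = u"
proof (intro ext)
  fix x vs
  have "(\<Sum>i\<in>A. m i u) x vs = (\<Sum>i\<in>A. c i + l i x) * u x vs" if "finite A" for A
    using that by induction (auto simp: m_def fun_mult_def algebra_simps)
  from this[OF finite_T] show "(\<Sum>i\<in>T. m i u) x vs = u x vs"
    using sum_bary[of x] assms[of x] by (cases "x \<in> S") auto
qed

lemma smooth_form_support: "smooth_form S k u \<Longrightarrow> x \<notin> S \<Longrightarrow> u x = 0"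
  by (simp add: smooth_form_def)

text \<open>Each term of the inner sum omits one index \<open>i\<close> of the tuple, so that the sum over \<open>i\<close>
  only meets \<open>e i\<close>, and \<open>sum_e\<close> applies.\<close>
lemma sum_tuples_E_alt_sum: "(\<Sum>I\<in>tuples T n. E I (alt_sum (\<lambda>_. \<zeta>) I)) = 0"
proof (induction n arbitrary: \<zeta>)
  case (Suc n)
  have IH: "(\<Sum>J\<in>tuples T n. E J (alt_sum (\<lambda>_. \<xi>) J)) = 0" for \<xi> by (fact Suc)
  have "(\<Sum>I\<in>tuples T (Suc n). E I (alt_sum (\<lambda>_. \<zeta>) I)) =
      (\<Sum>i\<in>T. \<Sum>J\<in>tuples T n. e i (E J (\<zeta> J))) -
      (\<Sum>i\<in>T. e i (\<Sum>J\<in>tuples T n. E J (alt_sum (\<lambda>_ K. \<zeta> (i # K)) J)))"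
    by (simp add: sum_tuples_Suc finite_T linear_diff[OF linear_E] linear_diff[OF linear_e]
        linear_sum[OF linear_e] sum_subtractf)
  also have "(\<Sum>i\<in>T. \<Sum>J\<in>tuples T n. e i (E J (\<zeta> J))) = 0"
    by (subst sum.swap) (simp add: sum_e)
  also have "(\<Sum>i\<in>T. e i (\<Sum>J\<in>tuples T n. E J (alt_sum (\<lambda>_ K. \<zeta> (i # K)) J))) = 0"
    by (simp add: IH linear_0[OF linear_e])
  finally show "(\<Sum>I\<in>tuples T (Suc n). E I (alt_sum (\<lambda>_. \<zeta>) I)) = 0"
    by (simp only: diff_self)
qed simp

lemma smooth_form_m: "smooth_form S k u \<Longrightarrow> smooth_form S k (m i u)"
  by (simp add: m_def smooth_form_fun_mult linear_l)

lemma smooth_form_E: "smooth_form S k u \<Longrightarrow> smooth_form S (k + length I) (E I u)"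
  by (induction I) (auto simp: e_def smooth_form_wedge1 linear_l)

lemma ext_deriv_m:
  "smooth_form S k u \<Longrightarrow> ext_deriv S k (m i u) = e i u + m i (ext_deriv S k u)"
  by (simp add: m_def e_def ext_deriv_fun_mult linear_l)

lemma ext_deriv_E:
  assumes "smooth_form S k u"
  shows "ext_deriv S (k + length I) (E I u) = (-1) ^ length I *\<^sub>R E I (ext_deriv S k u)"
proof (induction I)
  case (Cons i I)
  have IH: "ext_deriv S (k + length I) (E I u) = (-1) ^ length I *\<^sub>R E I (ext_deriv S k u)" by (fact Cons)
  have "ext_deriv S (Suc (k + length I)) (e i (E I u)) = - e i (ext_deriv S (k + length I) (E I u))"
    unfolding e_def by (rule ext_deriv_wedge1[OF linear_l smooth_form_E[OF assms]])
  then show "ext_deriv S (k + length (i # I)) (E (i # I) u) =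
      (-1) ^ length (i # I) *\<^sub>R E (i # I) (ext_deriv S k u)"
    by (simp add: IH linear_cmul[OF linear_e])
qed simp

abbreviation "zz \<equiv> zigzag S p"

abbreviation "cech u n \<equiv> alt_sum (\<lambda>_. zz u n)"

definition R :: "('a \<Rightarrow> 'a list \<Rightarrow> real) \<Rightarrow> nat \<Rightarrow> 'a \<Rightarrow> 'a list \<Rightarrow> real" where
  "R u n = (\<Sum>I\<in>tuples T n. E I (zz u n I))"

definition Q :: "('a \<Rightarrow> 'a list \<Rightarrow> real) \<Rightarrow> nat \<Rightarrow> 'a \<Rightarrow> 'a list \<Rightarrow> real" where
  "Q u n = (\<Sum>j\<in>T. \<Sum>I\<in>tuples T n. m j (E I (zz u (Suc n) (j # I))))"

section \<open>The zigzag of a closed form on a simplex\<close>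

context
  fixes u k
  assumes smooth: "smooth_form S k u" and closed: "ext_deriv S k u = 0"
begin

text \<open>If the derivatives at level n form the Cech differential of some \<open>g\<close>, a
  further Cech differential annihilates them. At level 0 this is used with \<open>g\<close> = 0, as
  the given form is closed.\<close>

lemma cech_closed_aux:
  assumes "n \<le> k" "set I \<subseteq> T"
    and "\<And>J. set J \<subseteq> T \<Longrightarrow> Suc (length J) = length I \<Longrightarrow>
      smooth_form S (k - n) (zz u n J) \<and> ext_deriv S (k - n) (zz u n J) = alt_sum (\<lambda>_. g) J"
  shows "smooth_form S (k - n) (cech u n I) \<and> ext_deriv S (k - n) (cech u n I) = 0"
proof -
  have J: "set J \<subseteq> T \<and> Suc (length J) = length I" if "mset (y # J) = mset I" for y J
    using add_mset_eq_mset_set[of y J I] add_mset_eq_mset_length[of y J I] that assms(2) by auto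
  have "cech u n I \<in> Collect (smooth_form S (k - n)) \<and>
      ext_deriv S (k - n) (cech u n I) = alt_sum (\<lambda>_ J. ext_deriv S (k - n) (zz u n J)) I"
    by (rule alt_sum_additive_on[where W = "Collect (smooth_form S (k - n))" and \<phi> = "ext_deriv S (k - n)"])
       (use J assms(3) in \<open>auto simp: smooth_form_0 smooth_form_diff ext_deriv_0 ext_deriv_diff\<close>)
  also have "alt_sum (\<lambda>_ J. ext_deriv S (k - n) (zz u n J)) I = alt_sum (\<lambda>_ J. alt_sum (\<lambda>_. g) J) I"
    by (rule alt_sum_cong) (use J assms(3) in auto)
  also have "\<dots> = 0" by (rule alt_sum_alt_sum_eq_0)
  finally show ?thesis by (simp add: form_eta)
qed

text \<open>The cone operator yields a primitive only of a closed form, so the next level needs both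
  the smoothness and the derivative of the present one.\<close>

lemma zigzag_smooth_deriv:
  assumes "n \<le> k" "length I = n" "set I \<subseteq> T"
  shows "smooth_form S (k - n) (zz u n I) \<and>
    ext_deriv S (k - n) (zz u n I) = (case n of 0 \<Rightarrow> 0 | Suc j \<Rightarrow> cech u j I)"
  using assms
proof (induction n arbitrary: I)
  case 0
  then show ?case by (simp add: smooth closed)
next
  case (Suc n)
  have "smooth_form S (k - n) (cech u n I) \<and> ext_deriv S (k - n) (cech u n I) = 0"
  proof (rule cech_closed_aux[where g = "case n of 0 \<Rightarrow> (\<lambda>_. 0) | Suc j \<Rightarrow> zz u j"])
    fix J assume "set J \<subseteq> T" "Suc (length J) = length I"
    then show "smooth_form S (k - n) (zz u n J) \<and> ext_deriv S (k - n) (zz u n J) =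
        alt_sum (\<lambda>_. case n of 0 \<Rightarrow> (\<lambda>_. 0) | Suc j \<Rightarrow> zz u j) J"
      using Suc.IH[of J] Suc.prems by (cases n) (auto simp: form_eta)
  qed (use Suc.prems in auto)
  moreover have "p (pick (set I)) \<in> S"
    using pick_in[of "set I"] Suc.prems p_in by fastforce
  moreover have "k - n = Suc (k - Suc n)" using Suc.prems by simp
  ultimately show ?case by (simp add: smooth_form_cone ext_deriv_cone_closed)
qed

lemma cech_closed:
  assumes "n \<le> k" "length I = Suc n" "set I \<subseteq> T"
  shows "smooth_form S (k - n) (cech u n I)" "ext_deriv S (k - n) (cech u n I) = 0"
proof -
  have "smooth_form S (k - n) (cech u n I) \<and> ext_deriv S (k - n) (cech u n I) = 0"
  proof (rule cech_closed_aux[where g = "case n of 0 \<Rightarrow> (\<lambda>_. 0) | Suc j \<Rightarrow> zz u j"])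
    fix J assume "set J \<subseteq> T" "Suc (length J) = length I"
    then show "smooth_form S (k - n) (zz u n J) \<and> ext_deriv S (k - n) (zz u n J) =
        alt_sum (\<lambda>_. case n of 0 \<Rightarrow> (\<lambda>_. 0) | Suc j \<Rightarrow> zz u j) J"
      using zigzag_smooth_deriv[of n J] assms by (cases n) (auto simp: form_eta)
  qed (use assms in auto)
  then show "smooth_form S (k - n) (cech u n I)" "ext_deriv S (k - n) (cech u n I) = 0" by auto
qed

lemma R_0: "R u 0 = u"
  by (simp add: R_def)

lemma smooth_form_R: "n \<le> k \<Longrightarrow> smooth_form S k (R u n)"
proof -
  assume n: "n \<le> k"
  have "smooth_form S k (E I (zz u n I))" if "I \<in> tuples T n" for I
    using smooth_form_E[of "k - n" "zz u n I" I] zigzag_smooth_deriv[of n I] n that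
    by (simp add: tuples_def)
  then show ?thesis unfolding R_def by (rule smooth_form_sum)
qed

lemma smooth_form_Q_term:
  assumes "n < k" "j \<in> T" "I \<in> tuples T n"
  shows "smooth_form S (k - 1) (E I (zz u (Suc n) (j # I)))"
  using smooth_form_E[of "k - Suc n" "zz u (Suc n) (j # I)" I] zigzag_smooth_deriv[of "Suc n" "j # I"] assms
  by (simp add: tuples_def)

lemma smooth_form_Q: "n < k \<Longrightarrow> smooth_form S (k - 1) (Q u n)"
  unfolding Q_def
  by (intro smooth_form_sum smooth_form_m smooth_form_Q_term)

text \<open>The term that deletes \<open>j\<close> gives \<open>R u n\<close> because the lambda_j
  sum to 1; the terms that delete an entry of \<open>I\<close> cancel because the dlambda_i sum to
  0.\<close>

lemma sum_m_E_cech: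
  assumes "n \<le> k"
  shows "(\<Sum>j\<in>T. \<Sum>I\<in>tuples T n. m j (E I (cech u n (j # I)))) = R u n"
proof -
  have "(\<Sum>j\<in>T. \<Sum>I\<in>tuples T n. m j (E I (cech u n (j # I)))) =
      (\<Sum>j\<in>T. m j (R u n)) - (\<Sum>j\<in>T. m j (\<Sum>I\<in>tuples T n. E I (alt_sum (\<lambda>_ J. zz u n (j # J)) I)))"
    by (simp add: linear_diff[OF linear_E] R_def linear_diff[OF linear_m] linear_sum[OF linear_m] sum_subtractf)
  also have "(\<Sum>j\<in>T. m j (\<Sum>I\<in>tuples T n. E I (alt_sum (\<lambda>_ J. zz u n (j # J)) I))) = 0"
    by (simp add: sum_tuples_E_alt_sum linear_0[OF linear_m])
  also have "(\<Sum>j\<in>T. m j (R u n)) = R u n"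
    using smooth_form_support[OF smooth_form_R[OF assms]] by (rule sum_m)
  finally show ?thesis by (simp only: diff_0_right)
qed

text \<open>Differentiating lambda_j turns the pair of \<open>j\<close> and \<open>I\<close> into a
  tuple of length n + 1. Passing the n factors dlambda gives the sign, and the derivative of the
  zigzag form is a Cech differential, which \<open>sum_m_E_cech\<close> turns back into
  \<open>R u n\<close>.\<close>

theorem ext_deriv_Q:
  assumes "n < k"
  shows "ext_deriv S (k - 1) (Q u n) = R u (Suc n) + (-1) ^ n *\<^sub>R R u n"
proof -
  have deriv_term: "ext_deriv S (k - 1) (m j (E I (zz u (Suc n) (j # I)))) =
      e j (E I (zz u (Suc n) (j # I))) + (-1) ^ n *\<^sub>R m j (E I (cech u n (j # I)))"
    if "j \<in> T" "I \<in> tuples T n" for j I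
  proof -
    have zz: "smooth_form S (k - Suc n) (zz u (Suc n) (j # I))"
      "ext_deriv S (k - Suc n) (zz u (Suc n) (j # I)) = cech u n (j # I)"
      using zigzag_smooth_deriv[of "Suc n" "j # I"] assms that by (auto simp: tuples_def)
    have "ext_deriv S (k - 1) (E I (zz u (Suc n) (j # I))) = (-1) ^ n *\<^sub>R E I (cech u n (j # I))"
      using ext_deriv_E[OF zz(1), of I] zz(2) that assms by (simp add: tuples_def)
    then show ?thesis
      using ext_deriv_m[OF smooth_form_Q_term[OF assms that]]
      by (simp add: linear_cmul[OF linear_m])
  qed
  have "ext_deriv S (k - 1) (Q u n) =
      (\<Sum>j\<in>T. \<Sum>I\<in>tuples T n. e j (E I (zz u (Suc n) (j # I))) + (-1) ^ n *\<^sub>R m j (E I (cech u n (j # I))))"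
    unfolding Q_def
    by (subst ext_deriv_sum, intro smooth_form_sum smooth_form_m smooth_form_Q_term assms, assumption+)
       (intro sum.cong refl, subst ext_deriv_sum, intro smooth_form_m smooth_form_Q_term assms, assumption+,
        intro sum.cong refl deriv_term, assumption+)
  also have "\<dots> = R u (Suc n) + (-1) ^ n *\<^sub>R R u n"
    using sum_m_E_cech[of n] assms finite_T
    by (simp add: sum.distrib scaleR_sum_right[symmetric] R_def sum_tuples_Suc del: zigzag.simps)
  finally show ?thesis .
qed

text \<open>At level k the forms have degree 0, and a closed 0-form on a convex set is constant;
  \<open>q\<close> is an arbitrary point at which to read its value.\<close>

lemma cech_const:
  assumes "length I = Suc k" "set I \<subseteq> T" "q \<in> S"
  shows "cech u k I = cech u k I q [] *\<^sub>R (\<lambda>x vs. if x \<in> S \<and> vs = [] then 1 else 0)"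
proof (intro ext)
  fix x vs
  have sm: "smooth_form S 0 (cech u k I)" and cl: "ext_deriv S 0 (cech u k I) = 0"
    using cech_closed[of k I] assms by simp_all
  show "cech u k I x vs = (cech u k I q [] *\<^sub>R (\<lambda>x vs. if x \<in> S \<and> vs = [] then 1 else 0)) x vs"
  proof (cases "x \<in> S \<and> vs = []")
    case True
    then show ?thesis using closed_0_form_constant[OF _ assms(3) sm cl] by (auto simp: scaleR_fun_def)
  next
    case False
    then show ?thesis using smooth_form_eq_0[OF sm, of x vs] by (auto simp: scaleR_fun_def)
  qed
qed

end

end


section \<open>Wedge products as signed deletion sums\<close>

lemma permute_list_transpose:
  assumes "i < length xs" "j < length xs"
  shows "permute_list (Transposition.transpose i j) xs = xs[i := xs ! j, j := xs ! i]"
  using assms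
  by (intro nth_equalityI)
     (auto simp: permute_list_def Transposition.transpose_def nth_list_update simp del: upt_Suc)

text \<open>Follows by splitting the permutation into transpositions. Positions outside
  \<open>I\<close> stay fixed, which for a wedge product with a covector is the position of the
  covector.\<close>

lemma sign_permute_list:
  fixes g :: "'b list \<Rightarrow> real"
  assumes "q permutes I" "I \<subseteq> {..<n}"
    and swap: "\<And>ys i j. length ys = n \<Longrightarrow> i \<in> I \<Longrightarrow> j \<in> I \<Longrightarrow> i < j \<Longrightarrow>
      g (ys[i := ys ! j, j := ys ! i]) = - g ys"
    and "length xs = n"
  shows "g (permute_list q xs) = of_int (sign q) * g xs"
proof -
  have fin: "finite I" using assms(2) finite_subset by blast
  have swap': "g (ys[i := ys ! j, j := ys ! i]) = - g ys"
    if "length ys = n" "i \<in> I" "j \<in> I" "i \<noteq> j" for ys i j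
    using swap[of ys i j] swap[of ys j i] that by (cases i j rule: linorder_cases) (auto simp: list_update_swap)
  show ?thesis
    using assms(1) fin assms(4)
  proof (induction q arbitrary: xs rule: permutes_induct)
    case (swap a b q)
    have q: "q permutes {..<length xs}"
      using swap.hyps(4) assms(2) swap.prems by (metis permutes_subset)
    have "permute_list (Transposition.transpose a b \<circ> q) xs = permute_list q (permute_list (Transposition.transpose a b) xs)"
      by (rule permute_list_compose[OF q])
    moreover have "permute_list (Transposition.transpose a b) xs = xs[a := xs ! b, b := xs ! a]"
      using swap.hyps assms(2) swap.prems by (intro permute_list_transpose) auto
    moreover have "sign (Transposition.transpose a b \<circ> q) = - sign q"
      using swap.hyps fin by (simp add: sign_compose permutation_swap_id permutes_imp_permutation sign_swap_id)
    ultimately show "g (permute_list (Transposition.transpose a b \<circ> q) xs) =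
        of_int (sign (Transposition.transpose a b \<circ> q)) * g xs"
      using swap.IH[of "xs[a := xs ! b, b := xs ! a]"] swap'[of xs a b] swap.hyps swap.prems by simp
  qed (simp add: sign_id)
qed

text \<open>Moving both entries to the front costs the same signs in the two lists, except that they
  arrive there in opposite order.\<close>

lemma swap_antisymmetric_transpose:
  assumes "swap_antisymmetric g" "i < j" "j < length xs"
  shows "g (xs[i := xs ! j, j := xs ! i]) = - g xs"
proof -
  define us where "us = take i xs"
  define ms where "ms = take (j - Suc i) (drop (Suc i) xs)"
  define vs where "vs = drop (Suc j) xs"
  have d: "drop i xs = xs ! i # drop (Suc i) xs" "drop j xs = xs ! j # vs"
    using assms by (simp_all add: Cons_nth_drop_Suc vs_def)
  have "drop (Suc i) xs = ms @ drop j xs"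
    using append_take_drop_id[of "j - Suc i" "drop (Suc i) xs"] assms by (simp add: ms_def)
  then have xs: "xs = us @ xs ! i # ms @ xs ! j # vs"
    using append_take_drop_id[of i xs] d by (simp add: us_def)
  have len: "length us = i" "length ms = j - Suc i" using assms by (simp_all add: us_def ms_def)
  obtain a b where ab: "xs ! i = a" "xs ! j = b" by blast
  have xs': "xs = us @ a # ms @ b # vs" using xs ab by simp
  have "xs[i := xs ! j, j := xs ! i] = us @ b # ms @ a # vs"
  proof -
    have "i = length us" "j = length us + Suc (length ms)" using assms(2) len by auto
    then show ?thesis unfolding ab by (simp add: xs' list_update_append)
  qed
  moreover have "g (us @ b # ms @ a # vs) = - g (us @ a # ms @ b # vs)"
  proof -
    have A: "g (us @ b # ms @ a # vs) = (-1) ^ length us *\<^sub>R g (b # us @ ms @ a # vs)"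
      using swap_antisymmetric_move[OF assms(1), of us b "ms @ a # vs"] by simp
    have B: "g (b # us @ ms @ a # vs) = (-1) ^ (Suc (length us + length ms)) *\<^sub>R g (a # b # us @ ms @ vs)"
      using swap_antisymmetric_move[OF assms(1), of "b # us @ ms" a "vs"] by simp
    have C: "g (us @ a # ms @ b # vs) = (-1) ^ length us *\<^sub>R g (a # us @ ms @ b # vs)"
      using swap_antisymmetric_move[OF assms(1), of us a "ms @ b # vs"] by simp
    have D: "g (a # us @ ms @ b # vs) = (-1) ^ (Suc (length us + length ms)) *\<^sub>R g (b # a # us @ ms @ vs)"
      using swap_antisymmetric_move[OF assms(1), of "a # us @ ms" b "vs"] by simp
    have F: "g (a # b # us @ ms @ vs) = - g (b # a # us @ ms @ vs)"
      using swap_antisymmetricD[OF assms(1), of "[]" a b "us @ ms @ vs"] by simp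
    show ?thesis unfolding A B C D F by simp
  qed
  ultimately show ?thesis using xs' by simp
qed

text \<open>All k! permutations contribute the same term, which cancels the normalisation.\<close>

lemma wedge_0_left:
  fixes \<beta> :: "'a list \<Rightarrow> real"
  assumes "swap_antisymmetric \<beta>" "\<And>ws. length ws \<noteq> k \<Longrightarrow> \<beta> ws = 0"
  shows "wedge 0 k \<alpha> \<beta> vs = \<alpha> [] * \<beta> vs"
proof (cases "length vs = k")
  case True
  have "\<beta> (map (\<lambda>i. vs ! \<pi> i) [0..<k]) = of_int (sign \<pi>) * \<beta> vs" if "\<pi> permutes {..<k}" for \<pi>
    using sign_permute_list[OF that subset_refl swap_antisymmetric_transpose[OF assms(1)] True] True
    by (simp add: permute_list_def)
  then have "(\<Sum>\<pi> | \<pi> permutes {..<k}. of_int (sign \<pi>) * \<alpha> [] * \<beta> (map (\<lambda>i. vs ! \<pi> i) [0..<k]))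
      = (\<Sum>\<pi> | \<pi> permutes {..<k}. \<alpha> [] * \<beta> vs)"
    by (intro sum.cong refl) (simp add: sign_def)
  then show ?thesis
    using True by (simp add: wedge_def card_permutations)
qed (simp add: wedge_def assms)

text \<open>Permutations are sorted by the index \<open>b\<close> that they send to the front. The
  k! rearrangements \<open>q\<close> of the other positions contribute equal terms, since the sign
  of \<open>q\<close> enters twice.\<close>

lemma wedge_1_left:
  fixes \<beta> :: "'a list \<Rightarrow> real"
  assumes "swap_antisymmetric \<beta>" "\<And>ws. length ws \<noteq> k \<Longrightarrow> \<beta> ws = 0"
  shows "wedge 1 k \<alpha> \<beta> vs = alt_sum (\<lambda>v ws. \<alpha> [v] * \<beta> ws) vs"
proof (cases "length vs = Suc k")
  case True
  define F where "F = (\<lambda>L. \<alpha> [hd L] * \<beta> (tl L))"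
  have F: "F (L[i := L ! j, j := L ! i]) = - F L"
    if L: "length L = Suc k" and ij: "i \<in> {1..<Suc k}" "j \<in> {1..<Suc k}" "i < j" for L i j
  proof -
    obtain a K where K: "L = a # K" using L by (cases L) auto
    obtain i' j' where i': "i = Suc i'" "j = Suc j'" using ij by (cases i; cases j) auto
    then show ?thesis
      using swap_antisymmetric_transpose[OF assms(1), of i' j' K] ij L by (simp add: F_def K)
  qed
  have "(\<Sum>\<pi> | \<pi> permutes {..<Suc k}.
        of_int (sign \<pi>) * \<alpha> (map (\<lambda>i. vs ! \<pi> i) [0..<1]) * \<beta> (map (\<lambda>i. vs ! \<pi> i) [1..<Suc k]))
      = (\<Sum>\<pi> | \<pi> permutes insert 0 {1..<Suc k}. of_int (sign \<pi>) * F (permute_list \<pi> vs))"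
  proof (intro sum.cong)
    have "insert 0 {1..<Suc k} = {..<Suc k}" by auto
    then show "{\<pi>. \<pi> permutes {..<Suc k}} = {\<pi>. \<pi> permutes insert 0 {1..<Suc k}}" by simp
    show "of_int (sign \<pi>) * \<alpha> (map (\<lambda>i. vs ! \<pi> i) [0..<1]) * \<beta> (map (\<lambda>i. vs ! \<pi> i) [1..<Suc k])
        = of_int (sign \<pi>) * F (permute_list \<pi> vs)" for \<pi>
      by (simp add: F_def permute_list_def True upt_rec[of 0] del: upt_Suc)
  qed
  also have "\<dots> = (\<Sum>b\<in>insert 0 {1..<Suc k}. \<Sum>q | q permutes {1..<Suc k}.
      of_int (sign (Transposition.transpose 0 b \<circ> q)) * F (permute_list (Transposition.transpose 0 b \<circ> q) vs))"
    by (rule sum_over_permutations_insert) auto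
  also have "\<dots> = (\<Sum>b\<in>insert 0 {1..<Suc k}. \<Sum>q | q permutes {1..<Suc k}.
      (-1) ^ b * (\<alpha> [vs ! b] * \<beta> (take b vs @ drop (Suc b) vs)))"
  proof (intro sum.cong refl)
    fix b q assume b: "b \<in> insert 0 {1..<Suc k}" and q: "q \<in> {q. q permutes {1..<Suc k}}"
    have sub: "{1..<Suc k} \<subseteq> {..<Suc k}" by auto
    have q': "q permutes {..<length vs}"
      using q permutes_subset[OF _ sub] True by auto
    let ?L = "permute_list (Transposition.transpose 0 b) vs"
    have "F (permute_list (Transposition.transpose 0 b \<circ> q) vs) = F (permute_list q ?L)"
      using permute_list_compose[OF q'] by simp
    also have "\<dots> = of_int (sign q) * F ?L"
      by (rule sign_permute_list[where I = "{1..<Suc k}" and n = "Suc k"]) (use q F True in auto)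
    finally have 1: "F (permute_list (Transposition.transpose 0 b \<circ> q) vs) = of_int (sign q) * F ?L" .
    have 2: "sign (Transposition.transpose 0 b \<circ> q) = sign (Transposition.transpose 0 b) * sign q"
      using q by (intro sign_compose permutation_swap_id) (auto intro: permutes_imp_permutation[of "{1..<Suc k}"])
    have 3: "of_int (sign (Transposition.transpose 0 b)) * F ?L
        = (-1) ^ b * (\<alpha> [vs ! b] * \<beta> (take b vs @ drop (Suc b) vs))"
    proof (cases b)
      case 0
      then have "?L = vs" by simp
      then show ?thesis using 0 True by (cases vs) (auto simp: F_def sign_id)
    next
      case (Suc b')
      obtain v ws where vs: "vs = v # ws" using True by (cases vs) auto
      have b': "b' < length ws" using b Suc True vs by auto
      have "?L = vs[0 := vs ! b, b := vs ! 0]"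
        using b True by (intro permute_list_transpose) auto
      then have "?L = ws ! b' # ws[b' := v]" using Suc vs by simp
      moreover have "ws[b' := v] = take b' ws @ v # drop (Suc b') ws"
        using b' by (rule upd_conv_take_nth_drop)
      \<comment> \<open>The transposition has put the first vector \<open>v\<close> at place b' of
        the remainder. Moving it back to the front gives (-1)^b', and the sign of the transposition
        completes this to (-1)^b.\<close>
      ultimately have "F ?L = \<alpha> [ws ! b'] * ((-1) ^ b' * \<beta> (v # take b' ws @ drop (Suc b') ws))"
        using swap_antisymmetric_move[OF assms(1), of "take b' ws" v "drop (Suc b') ws"] b'
        by (simp add: F_def)
      then show ?thesis by (simp add: Suc vs sign_swap_id)
    qed
    have "sign q * sign q = 1" by simp
    then have 4: "(of_int (sign q) :: real) * of_int (sign q) = 1"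
      by (metis of_int_1 of_int_mult)
    show "of_int (sign (Transposition.transpose 0 b \<circ> q)) * F (permute_list (Transposition.transpose 0 b \<circ> q) vs)
        = (-1) ^ b * (\<alpha> [vs ! b] * \<beta> (take b vs @ drop (Suc b) vs))"
      unfolding 1 2 3[symmetric] using 4 by (simp add: algebra_simps)
  qed
  also have "\<dots> = fact k * (\<Sum>b<Suc k. (-1) ^ b * (\<alpha> [vs ! b] * \<beta> (take b vs @ drop (Suc b) vs)))"
  proof -
    have "insert 0 {1..<Suc k} = {..<Suc k}" by auto
    then show ?thesis by (simp add: card_permutations sum_distrib_left del: sum.lessThan_Suc)
  qed
  also have "(\<Sum>b<Suc k. (-1) ^ b * (\<alpha> [vs ! b] * \<beta> (take b vs @ drop (Suc b) vs)))
      = alt_sum (\<lambda>v ws. \<alpha> [v] * \<beta> ws) vs"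
    by (simp add: alt_sum_eq_sum True)
  finally show ?thesis using True by (simp add: wedge_def)
next
  case False
  have "alt_sum (\<lambda>v ws. \<alpha> [v] * \<beta> ws) vs = alt_sum (\<lambda>v ws. 0) vs"
    by (rule alt_sum_cong) (use False assms(2) in \<open>auto dest!: add_mset_eq_mset_length\<close>)
  then show ?thesis using False by (simp add: wedge_def)
qed

section \<open>Alternating cochains and Whitney forms\<close>

lemma permutations_of_set_nonempty_sum:
  assumes "finite A" "A \<noteq> {}"
  shows "(\<Sum>J\<in>permutations_of_set A. f J) = (\<Sum>x\<in>A. \<Sum>I\<in>permutations_of_set (A - {x}). f (x # I))"
proof -
  have "(\<Sum>J\<in>permutations_of_set A. f J) = (\<Sum>x\<in>A. \<Sum>J\<in>(#) x ` permutations_of_set (A - {x}). f J)"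
    unfolding permutations_of_set_nonempty[OF assms(2)]
    by (rule sum.UNION_disjoint) (use assms in auto)
  also have "\<dots> = (\<Sum>x\<in>A. \<Sum>I\<in>permutations_of_set (A - {x}). f (x # I))"
  proof -
    have "sum f ((#) x ` P) = (\<Sum>I\<in>P. f (x # I))" for x P
      by (subst sum.reindex) (auto simp: o_def inj_on_def)
    then show ?thesis by simp
  qed
  finally show ?thesis .
qed

text \<open>Tuples without repetition are grouped by their set of entries and then by their first
  entry; the k! orders of the tail give equal terms. Invariance concerns the tail only, because the
  head will carry lambda and the tail dlambda.\<close>

lemma sum_tuples_alternating:
  fixes f :: "'v list \<Rightarrow> 'c::real_vector" and s :: "'v set \<Rightarrow> 'v list"
  assumes "finite T"
    and inv: "\<And>x xs a b ys. f (x # xs @ a # b # ys) = f (x # xs @ b # a # ys)"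
    and zero: "\<And>J. \<not> distinct J \<Longrightarrow> f J = 0"
    and s: "\<And>A. A \<subseteq> T \<Longrightarrow> card A = Suc k \<Longrightarrow> distinct (s A) \<and> set (s A) = A"
  shows "(\<Sum>J\<in>tuples T (Suc k). f J) =
    (\<Sum>A | A \<subseteq> T \<and> card A = Suc k. fact k *\<^sub>R (\<Sum>l<Suc k. f (s A ! l # take l (s A) @ drop (Suc l) (s A))))"
proof -
  let ?P = "{A. A \<subseteq> T \<and> card A = Suc k}"
  have finA: "finite A" if "A \<in> ?P" for A using that assms(1) finite_subset by auto
  have finP: "finite ?P" using assms(1) by simp
  have "(\<Sum>J\<in>tuples T (Suc k). f J) = (\<Sum>J\<in>(\<Union>A\<in>?P. permutations_of_set A). f J)"
  proof (rule sum.mono_neutral_right)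
    show "finite (tuples T (Suc k))" by (rule finite_tuples[OF assms(1)])
    show "(\<Union>A\<in>?P. permutations_of_set A) \<subseteq> tuples T (Suc k)"
      by (auto simp: tuples_def permutations_of_set_def distinct_card)
    show "\<forall>J\<in>tuples T (Suc k) - (\<Union>A\<in>?P. permutations_of_set A). f J = 0"
      using zero by (auto simp: tuples_def permutations_of_set_def) (metis distinct_card)
  qed
  also have "\<dots> = (\<Sum>A\<in>?P. \<Sum>J\<in>permutations_of_set A. f J)"
    by (rule sum.UNION_disjoint[OF finP]) (simp, blast dest: permutations_of_setD)
  also have "\<dots> = (\<Sum>A\<in>?P. fact k *\<^sub>R (\<Sum>l<Suc k. f (s A ! l # take l (s A) @ drop (Suc l) (s A))))"
  proof (rule sum.cong[OF refl])
    fix A assume A: "A \<in> ?P"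
    then have sA: "distinct (s A)" "set (s A) = A" using s by auto
    then have len: "length (s A) = Suc k" using A distinct_card by force
    let ?d = "\<lambda>l. take l (s A) @ drop (Suc l) (s A)"
    have "(\<Sum>J\<in>permutations_of_set A. f J) = (\<Sum>x\<in>A. \<Sum>I\<in>permutations_of_set (A - {x}). f (x # I))"
      using A by (intro permutations_of_set_nonempty_sum finA) auto
    also have "\<dots> = (\<Sum>l<Suc k. \<Sum>I\<in>permutations_of_set (A - {s A ! l}). f (s A ! l # I))"
      using sum.reindex_bij_betw[OF bij_betw_nth[OF sA(1), of "{..<Suc k}" A],
          of "\<lambda>x. \<Sum>I\<in>permutations_of_set (A - {x}). f (x # I)"] len sA by (simp add: lessThan_atLeast0)
    also have "\<dots> = (\<Sum>l<Suc k. fact k *\<^sub>R f (s A ! l # ?d l))"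
    proof (rule sum.cong[OF refl])
      fix l assume l: "l \<in> {..<Suc k}"
      have split: "s A = take l (s A) @ s A ! l # drop (Suc l) (s A)"
        using l len by (simp add: id_take_nth_drop)
      have "distinct (take l (s A) @ s A ! l # drop (Suc l) (s A))" using sA(1) split by simp
      moreover have "A = set (take l (s A) @ s A ! l # drop (Suc l) (s A))" using sA(2) split by simp
      ultimately have dl: "distinct (?d l)" "set (?d l) = A - {s A ! l}" by auto
      have "f (s A ! l # I) = f (s A ! l # ?d l)" if "I \<in> permutations_of_set (A - {s A ! l})" for I
      proof (rule swap_invariant_eq[where g = "\<lambda>I. f (s A ! l # I)", OF inv])
        show "mset I = mset (?d l)"
          using that dl by (metis permutations_of_setD set_eq_iff_mset_eq_distinct)
      qed
      moreover have "card (permutations_of_set (A - {s A ! l})) = fact k"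
        using A l len sA finA[OF A] by (subst card_permutations_of_set) (auto simp: card_Diff_singleton_if)
      ultimately show "(\<Sum>I\<in>permutations_of_set (A - {s A ! l}). f (s A ! l # I)) = fact k *\<^sub>R f (s A ! l # ?d l)"
        by (simp add: scaleR_conv_of_real sum_constant_scaleR)
    qed
    also have "\<dots> = fact k *\<^sub>R (\<Sum>l<Suc k. f (s A ! l # ?d l))"
      by (simp only: scaleR_sum_right)
    finally show "(\<Sum>J\<in>permutations_of_set A. f J) = fact k *\<^sub>R (\<Sum>l<Suc k. f (s A ! l # ?d l))" .
  qed
  finally show ?thesis .
qed

context simplex_forms
begin

abbreviation one :: "'a \<Rightarrow> 'a list \<Rightarrow> real" where
  "one \<equiv> (\<lambda>x vs. if x \<in> S \<and> vs = [] then 1 else 0)"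

text \<open>Reordering the tail changes the sign of \<open>g\<close> and of the product of the
  dlambda alike, so the summand is invariant. The signs of the Whitney form come from
  \<open>g\<close>, when the entry in front is moved back to its place in
  \<open>s A\<close>.\<close>

lemma sum_cochain_eq_whitney:
  fixes g :: "'v list \<Rightarrow> real" and s :: "'v set \<Rightarrow> 'v list"
  assumes g: "swap_antisymmetric g"
    and s: "\<And>A. A \<subseteq> T \<Longrightarrow> card A = Suc k \<Longrightarrow> distinct (s A) \<and> set (s A) = A"
  shows "(\<Sum>j\<in>T. \<Sum>I\<in>tuples T k. g (j # I) *\<^sub>R m j (E I one)) =
    (\<Sum>A | A \<subseteq> T \<and> card A = Suc k. g (s A) *\<^sub>R fact k *\<^sub>R alt_sum (\<lambda>i J. m i (E J one)) (s A))"
proof -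
  define f where "f J = g J *\<^sub>R m (hd J) (E (tl J) one)" for J
  have "(\<Sum>j\<in>T. \<Sum>I\<in>tuples T k. g (j # I) *\<^sub>R m j (E I one)) = (\<Sum>J\<in>tuples T (Suc k). f J)"
    by (simp add: sum_tuples_Suc[OF finite_T] f_def)
  also have "\<dots> = (\<Sum>A | A \<subseteq> T \<and> card A = Suc k.
      fact k *\<^sub>R (\<Sum>l<Suc k. f (s A ! l # take l (s A) @ drop (Suc l) (s A))))"
  proof (rule sum_tuples_alternating[OF finite_T _ _ s])
    show "f (x # xs @ a # b # ys) = f (x # xs @ b # a # ys)" for x xs a b ys
      using swap_antisymmetricD[OF g, of "x # xs" a b ys] swap_antisymmetricD[OF swap_antisymmetric_E[of one], of xs a b ys]
        linear_neg[OF linear_m]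
      by (simp add: f_def)
    show "f J = 0" if "\<not> distinct J" for J
      using swap_antisymmetric_eq_0[OF g that] by (simp add: f_def)
  qed
  also have "\<dots> = (\<Sum>A | A \<subseteq> T \<and> card A = Suc k. g (s A) *\<^sub>R fact k *\<^sub>R alt_sum (\<lambda>i J. m i (E J one)) (s A))"
  proof (rule sum.cong[OF refl])
    fix A assume "A \<in> {A. A \<subseteq> T \<and> card A = Suc k}"
    then have len: "length (s A) = Suc k" using s[of A] distinct_card[of "s A"] by simp
    have "f (s A ! l # take l (s A) @ drop (Suc l) (s A)) =
        g (s A) *\<^sub>R (-1) ^ l *\<^sub>R m (s A ! l) (E (take l (s A) @ drop (Suc l) (s A)) one)" if "l < Suc k" for l
    proof -
      have "s A = take l (s A) @ s A ! l # drop (Suc l) (s A)"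
        using that len by (simp add: id_take_nth_drop)
      then have "g (s A) = (-1) ^ l * g (s A ! l # take l (s A) @ drop (Suc l) (s A))"
        using swap_antisymmetric_move[OF g, of "take l (s A)" "s A ! l" "drop (Suc l) (s A)"] that len by simp
      then show ?thesis by (simp add: f_def)
    qed
    then have "(\<Sum>l<Suc k. f (s A ! l # take l (s A) @ drop (Suc l) (s A))) =
        (\<Sum>l<Suc k. g (s A) *\<^sub>R (-1) ^ l *\<^sub>R m (s A ! l) (E (take l (s A) @ drop (Suc l) (s A)) one))"
      by (intro sum.cong refl) blast
    also have "\<dots> = g (s A) *\<^sub>R alt_sum (\<lambda>i J. m i (E J one)) (s A)"
      by (simp only: alt_sum_eq_sum len scaleR_sum_right)
    finally show "fact k *\<^sub>R (\<Sum>l<Suc k. f (s A ! l # take l (s A) @ drop (Suc l) (s A))) =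
        g (s A) *\<^sub>R fact k *\<^sub>R alt_sum (\<lambda>i J. m i (E J one)) (s A)"
      by (simp only: scaleR_left_commute)
  qed
  finally show ?thesis .
qed

end


section \<open>Affine maps on simplexes\<close>

lemma affine_independent_extend:
  fixes B :: "'a::euclidean_space set" and g :: "'a \<Rightarrow> 'b::real_vector"
  assumes "\<not> affine_dependent B"
  obtains c l where "linear l" "\<And>x. x \<in> B \<Longrightarrow> c + l x = g x"
proof (cases "B = {}")
  case True
  then show ?thesis using that[of "\<lambda>_. 0" 0] linear_zero by auto
next
  case False
  then obtain a where a: "a \<in> B" by blast
  then have "independent ((\<lambda>x. - a + x) ` (B - {a}))"
    using affine_dependent_iff_dependent2 assms by blast
  from linear_independent_extend[OF this, of "\<lambda>y. g (a + y) - g a"]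
  obtain l where l: "linear l" "\<And>x. x \<in> B - {a} \<Longrightarrow> l (- a + x) = g x - g a" by auto
  have "(g a - l a) + l x = g x" if "x \<in> B" for x
    using l(2)[of x] that
    by (cases "x = a") (auto simp: linear_add[OF l(1)] linear_neg[OF l(1)] linear_diff[OF l(1)] algebra_simps)
  with l(1) that show ?thesis by blast
qed

lemma affine_map_combine:
  assumes "linear l" "u + v = 1"
  shows "c + l (u *\<^sub>R x + v *\<^sub>R y) = u *\<^sub>R (c + l x) + v *\<^sub>R (c + l y)"
proof -
  have "c = u *\<^sub>R c + v *\<^sub>R c" using assms(2) by (metis scaleR_add_left scaleR_one)
  then show ?thesis
    by (simp add: linear_add[OF assms(1)] linear_cmul[OF assms(1)] scaleR_add_right add.assoc add.left_commute)
qed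

lemma affine_eq_on_hull:
  assumes "linear l" "linear l'" "\<And>x. x \<in> B \<Longrightarrow> c + l x = c' + l' x"
  shows "x \<in> affine hull B \<Longrightarrow> c + l x = c' + l' x"
    and "v \<in> tangent B \<Longrightarrow> l v = l' v"
proof -
  have *: "c + l x = c' + l' x" if "x \<in> affine hull B" for x
    using that
  proof (rule hull_induct)
    show "affine {x. c + l x = c' + l' x}"
      unfolding affine_def
      by (auto simp only: mem_Collect_eq affine_map_combine[OF assms(1)] affine_map_combine[OF assms(2)])
  qed (use assms(3) in auto)
  show "x \<in> affine hull B \<Longrightarrow> c + l x = c' + l' x" by (rule *)
  assume "v \<in> tangent B"
  then obtain x y where "v = x - y" "x \<in> affine hull B" "y \<in> affine hull B"
    by (auto simp: tangent_def)
  then show "l v = l' v"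
    using arg_cong2[OF *[of x] *[of y], of minus]
    by (simp add: linear_diff[OF assms(1)] linear_diff[OF assms(2)])
qed

locale realization =
  fixes \<T> :: "'v set set" and V :: "'v set \<Rightarrow> 'a::euclidean_space set" and \<rho> :: "'v set \<Rightarrow> 'v \<Rightarrow> 'a"
  assumes complex: "abstract_simplicial_complex \<T>" and realization: "affine_realization \<T> V \<rho>"
begin

lemma simplex_facts:
  assumes "T \<in> \<T>"
  shows "finite T" "T \<noteq> {}" "inj_on (\<rho> T) T" "\<not> affine_dependent (\<rho> T ` T)"
proof -
  show fin: "finite T" and ne: "T \<noteq> {}"
    using complex assms by (auto simp: abstract_simplicial_complex_def)
  then have card: "card T = (card T - 1) + 1" by (simp add: card_gt_0_iff)
  then have "T \<in> simplexes \<T> (card T - 1)" using assms unfolding simplexes_def by blast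
  then have *: "inj_on (\<rho> T) T \<and> aff_dim (affine hull (\<rho> T ` T)) = int (card T - 1)"
    using realization unfolding affine_realization_def by blast
  then show inj: "inj_on (\<rho> T) T" by simp
  have "card (\<rho> T ` T) = card T" using inj by (rule card_image)
  \<comment> \<open>A set of k + 1 points whose affine span has dimension k is affinely
    independent.\<close>
  then show "\<not> affine_dependent (\<rho> T ` T)"
    using * fin card by (simp add: affine_independent_iff_card)
qed

lemma face_in: "T \<in> \<T> \<Longrightarrow> A \<subseteq> T \<Longrightarrow> A \<noteq> {} \<Longrightarrow> A \<in> \<T>"
  using complex unfolding abstract_simplicial_complex_def by blast

lemma vertex_extend:
  assumes "T \<in> \<T>"
  obtains c l where "linear l" "\<And>i. i \<in> T \<Longrightarrow> c + l (\<rho> T i) = g i"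
proof -
  obtain c l where "linear l" "\<And>x. x \<in> \<rho> T ` T \<Longrightarrow> c + l x = g (inv_into T (\<rho> T) x)"
    by (rule affine_independent_extend[OF simplex_facts(4)[OF assms], of "g \<circ> inv_into T (\<rho> T)"]) auto
  then show thesis using simplex_facts(3)[OF assms] by (intro that[of l c]) auto
qed

text \<open>Constant and linear part of an affine function on the whole ambient space; the
  conditions at the vertices determine it only on the affine span of the simplex.\<close>

definition bary :: "'v set \<Rightarrow> 'v \<Rightarrow> real \<times> ('a \<Rightarrow> real)" where
  "bary T i = (SOME (c, l). linear l \<and> (\<forall>j\<in>T. c + l (\<rho> T j) = (if i = j then 1 else 0)))"

text \<open>The value zero for vertices outside \<open>T\<close> is what makes terms with such a
  vertex drop out on faces.\<close>

definition bc :: "'v set \<Rightarrow> 'v \<Rightarrow> real" where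
  "bc T i = (if i \<in> T then fst (bary T i) else 0)"

definition bl :: "'v set \<Rightarrow> 'v \<Rightarrow> 'a \<Rightarrow> real" where
  "bl T i = (if i \<in> T then snd (bary T i) else (\<lambda>_. 0))"

lemma bary_spec:
  assumes "T \<in> \<T>"
  shows "linear (bl T i)" "j \<in> T \<Longrightarrow> bc T i + bl T i (\<rho> T j) = (if i = j then 1 else 0)"
proof -
  have "case bary T i of (c, l) \<Rightarrow> linear l \<and> (\<forall>j\<in>T. c + l (\<rho> T j) = (if i = j then 1 else 0))"
    unfolding bary_def
  proof (rule someI_ex)
    obtain c l where "linear l" "\<And>j. j \<in> T \<Longrightarrow> c + l (\<rho> T j) = (if i = j then 1 else (0::real))"
      by (rule vertex_extend[OF assms, of "\<lambda>j. if i = j then 1 else 0"]) blast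
    then show "\<exists>p. case p of (c, l) \<Rightarrow> linear l \<and> (\<forall>j\<in>T. c + l (\<rho> T j) = (if i = j then 1 else (0::real)))"
      by - (rule exI[of _ "(c, l)"], simp)
  qed
  then show "linear (bl T i)" "j \<in> T \<Longrightarrow> bc T i + bl T i (\<rho> T j) = (if i = j then 1 else 0)"
    by (auto simp: bc_def bl_def linear_zero split: prod.splits)
qed

lemma vertex_in: "i \<in> T \<Longrightarrow> \<rho> T i \<in> carrier_of \<rho> T"
  by (simp add: carrier_of_def hull_inc)

lemma affine_hull_carrier: "affine hull (carrier_of \<rho> T) = affine hull (\<rho> T ` T)"
  by (simp add: carrier_of_def)

lemma tangent_carrier: "tangent (carrier_of \<rho> T) = tangent (\<rho> T ` T)"
  by (simp add: tangent_def affine_hull_carrier)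

lemma carrier_affine_eq:
  assumes "linear l" "linear l'" "\<And>i. i \<in> T \<Longrightarrow> c + l (\<rho> T i) = c' + l' (\<rho> T i)"
  shows "x \<in> carrier_of \<rho> T \<Longrightarrow> c + l x = c' + l' x"
    and "v \<in> tangent (carrier_of \<rho> T) \<Longrightarrow> l v = l' v"
proof -
  show "c + l x = c' + l' x" if "x \<in> carrier_of \<rho> T"
    by (rule affine_eq_on_hull(1)[OF assms(1,2), of "\<rho> T ` T"])
       (use assms(3) hull_inc[OF that, of affine] affine_hull_carrier in auto)
  show "l v = l' v" if "v \<in> tangent (carrier_of \<rho> T)"
    by (rule affine_eq_on_hull(2)[OF assms(1,2), of "\<rho> T ` T" c c'])
       (use assms(3) that tangent_carrier in auto)
qed

text \<open>The partition of unity identity is checked at the vertices; being affine it extends to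
  the carrier, and its linear part to the tangent space.\<close>

lemma simplex_forms:
  assumes T: "T \<in> \<T>"
  shows "simplex_forms (carrier_of \<rho> T) T (\<rho> T) (bc T) (bl T)"
proof (intro simplex_forms.intro convex_domain.intro simplex_forms_axioms.intro)
  have lin: "linear (\<lambda>x. \<Sum>i\<in>T. bl T i x)"
    using bary_spec(1)[OF T] by (intro linear_compose_sum) auto
  have vert: "(\<Sum>i\<in>T. bc T i) + (\<Sum>i\<in>T. bl T i (\<rho> T j)) = 1 + 0" if "j \<in> T" for j
  proof -
    have "(\<Sum>i\<in>T. bc T i + bl T i (\<rho> T j)) = 1"
      using that simplex_facts(1)[OF T] by (simp add: bary_spec(2)[OF T])
    then show ?thesis by (simp add: sum.distrib)
  qed
  show "(\<Sum>i\<in>T. bc T i + bl T i x) = 1" if "x \<in> carrier_of \<rho> T" for x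
    using carrier_affine_eq(1)[OF lin linear_zero, of T "\<Sum>i\<in>T. bc T i" 1 x] vert that
    by (simp add: sum.distrib)
  show "(\<Sum>i\<in>T. bl T i v) = 0" if "v \<in> tangent (carrier_of \<rho> T)" for v
    using carrier_affine_eq(2)[OF lin linear_zero, of T "\<Sum>i\<in>T. bc T i" 1 v] vert that
    by simp
  show "convex (carrier_of \<rho> T)" "carrier_of \<rho> T \<noteq> {}"
    using simplex_facts(2)[OF T] by (auto simp: carrier_of_def)
  show "linear (bl T i)" for i by (rule bary_spec(1)[OF T])
qed (use simplex_facts(1)[OF T] vertex_in in auto)

text \<open>The affine coordinate function takes an affine combination of the vertices to the same
  combination of its values there, which are 0 except for 1 at \<open>i\<close>. This identifies
  whichever coefficients \<open>bary_coords\<close> has chosen.\<close>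

lemma bary_coords_eq:
  assumes T: "T \<in> \<T>" and x: "x \<in> carrier_of \<rho> T" and i: "i \<in> T"
  shows "bary_coords \<rho> T x i = bc T i + bl T i x"
proof -
  have inj: "inj_on (\<rho> T) T" and fin: "finite T" using simplex_facts[OF T] by auto
  have "\<exists>c. sum c T = 1 \<and> (\<Sum>i\<in>T. c i *\<^sub>R \<rho> T i) = x"
  proof -
    obtain w where w: "sum w (\<rho> T ` T) = 1" "(\<Sum>y\<in>\<rho> T ` T. w y *\<^sub>R y) = x"
      using x fin unfolding carrier_of_def by (auto simp: convex_hull_finite)
    then show ?thesis
      by (intro exI[of _ "w \<circ> \<rho> T"]) (simp add: sum.reindex[OF inj])
  qed
  then have "sum (bary_coords \<rho> T x) T = 1 \<and> (\<Sum>i\<in>T. bary_coords \<rho> T x i *\<^sub>R \<rho> T i) = x"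
    unfolding bary_coords_def by (rule someI_ex)
  then have b: "sum (bary_coords \<rho> T x) T = 1" "x = (\<Sum>j\<in>T. bary_coords \<rho> T x j *\<^sub>R \<rho> T j)" by auto
  have "bc T i + bl T i x = (\<Sum>j\<in>T. bary_coords \<rho> T x j * bc T i) + (\<Sum>j\<in>T. bary_coords \<rho> T x j * bl T i (\<rho> T j))"
    by (subst b(2)) (simp add: linear_sum[OF bary_spec(1)[OF T]] linear_cmul[OF bary_spec(1)[OF T]]
        sum_distrib_right[symmetric] b(1))
  also have "\<dots> = (\<Sum>j\<in>T. bary_coords \<rho> T x j * (bc T i + bl T i (\<rho> T j)))"
    by (simp add: sum.distrib distrib_left)
  also have "\<dots> = bary_coords \<rho> T x i"
    using fin i by (simp add: bary_spec(2)[OF T] if_distrib[where f = "\<lambda>a. _ * a"] cong: if_cong)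
  finally show ?thesis by simp
qed

end

section \<open>Pullback to a face\<close>

text \<open>Gives names to the parts of the affine map chosen by \<open>face_map\<close>. The
  interpretations \<open>A\<close> and \<open>B\<close> are the calculus on the simplex and on its
  face.\<close>

locale face = realization \<T> V \<rho>
  for \<T> :: "'v set set" and V :: "'v set \<Rightarrow> 'a::euclidean_space set" and \<rho> +
  fixes T T' :: "'v set" and c :: 'a and l :: "'a \<Rightarrow> 'a"
  assumes T: "T \<in> \<T>" and T': "T' \<in> \<T>" and sub: "T' \<subseteq> T"
    and lin: "linear l" and vert: "\<And>i. i \<in> T' \<Longrightarrow> c + l (\<rho> T' i) = \<rho> T i"
    and face_map_eq: "face_map \<rho> T T' = (\<lambda>x. c + l x)"
begin

abbreviation "S \<equiv> carrier_of \<rho> T"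
abbreviation "S' \<equiv> carrier_of \<rho> T'"

sublocale A: simplex_forms S T "\<rho> T" "bc T" "bl T"
  by (rule simplex_forms[OF T])

sublocale B: simplex_forms S' T' "\<rho> T'" "bc T'" "bl T'"
  by (rule simplex_forms[OF T'])

lemma face_affine_hull: "x \<in> affine hull S' \<Longrightarrow> c + l x \<in> affine hull S"
  unfolding affine_hull_carrier
proof (erule hull_induct)
  show "affine {x. c + l x \<in> affine hull (\<rho> T ` T)}"
    using mem_affine[OF affine_affine_hull[of "\<rho> T ` T"]]
    by (auto simp: affine_def[of "Collect _"] affine_map_combine[OF lin])
qed (use vert sub in \<open>auto intro: hull_inc\<close>)

lemma face_carrier: "x \<in> S' \<Longrightarrow> c + l x \<in> S"
  unfolding carrier_of_def
proof (erule hull_induct)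
  show "convex {x. c + l x \<in> convex hull (\<rho> T ` T)}"
    using convexD[OF convex_convex_hull[of "\<rho> T ` T"]]
    by (auto simp: convex_def[of "Collect _"] affine_map_combine[OF lin])
qed (use vert sub in \<open>auto intro: hull_inc\<close>)

lemma face_tangent:
  assumes "v \<in> tangent S'"
  shows "l v \<in> tangent S"
proof -
  obtain x y where "v = x - y" "x \<in> affine hull S'" "y \<in> affine hull S'"
    using assms by (auto simp: tangent_def)
  then show ?thesis
    using diff_mem_tangent[OF face_affine_hull face_affine_hull, of x y] by (simp add: linear_diff[OF lin])
qed

text \<open>The pullback with the linear part of the face map in place of its derivative. It does
  not mention the degree and is linear on arbitrary functions.\<close>

definition pb :: "('a \<Rightarrow> 'a list \<Rightarrow> real) \<Rightarrow> 'a \<Rightarrow> 'a list \<Rightarrow> real" where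
  "pb u = restrict_form S' (\<lambda>x vs. u (c + l x) (map l vs))"

lemma linear_pb: "linear pb"
  by (rule linearI) (auto simp: pb_def restrict_form_def fun_eq_iff scaleR_fun_def)

lemma pullback_eq_pb:
  assumes "smooth_form S k u"
  shows "pullback (face_map \<rho> T T') S' k u = pb u"
proof (intro ext)
  fix x vs
  show "pullback (face_map \<rho> T T') S' k u x vs = pb u x vs"
  proof (cases "x \<in> S' \<and> vs \<in> vectors S' k")
    case True
    have "((\<lambda>x. c + l x) has_derivative l) (at x within S')"
      using bounded_linear.has_derivative[OF linear_conv_bounded_linear[THEN iffD1, OF lin] has_derivative_ident]
      by (auto intro!: derivative_eq_intros)
    then have "frechet_derivative (face_map \<rho> T T') (at x within S') v = l v" if "v \<in> tangent S'" for v
      by - (rule frechet_derivative_within_eq[OF B.convex], use True that face_map_eq in auto)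
    then have "map (frechet_derivative (face_map \<rho> T T') (at x within S')) vs = map l vs"
      using True by (auto simp: vectors_def)
    then show ?thesis
      using True by (simp add: pullback_def pb_def restrict_form_def vectors_def face_map_eq del: map_eq_conv)
  next
    case False
    then show ?thesis
      using A.smooth_form_eq_0[OF assms, of "c + l x" "map l vs"]
      by (auto simp: pullback_def pb_def restrict_form_def vectors_def)
  qed
qed

text \<open>Affine functions that agree at the vertices of \<open>T'\<close>; if \<open>i\<close> is
  not in \<open>T'\<close>, both are 0 at all of these.\<close>

lemma bary_face:
  shows "x \<in> S' \<Longrightarrow> bc T i + bl T i (c + l x) = bc T' i + bl T' i x"
    and "v \<in> tangent S' \<Longrightarrow> bl T i (l v) = bl T' i v"
proof -
  note bl = bary_spec(1)[OF T, of i]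
  have lin': "linear (\<lambda>x. bl T i (l x))"
    using linear_compose[OF lin bl] by (simp add: o_def)
  have vert': "(bc T i + bl T i c) + bl T i (l (\<rho> T' j)) = bc T' i + bl T' i (\<rho> T' j)" if "j \<in> T'" for j
    using vert[OF that] bary_spec(2)[OF T, of j i] bary_spec(2)[OF T' that, of i] that sub
    by (auto simp: linear_add[OF bl, symmetric] add.assoc)
  show "x \<in> S' \<Longrightarrow> bc T i + bl T i (c + l x) = bc T' i + bl T' i x"
    using carrier_affine_eq(1)[OF lin' bary_spec(1)[OF T', of i], of T' "bc T i + bl T i c" "bc T' i" x] vert'
    by (simp add: linear_add[OF bl] add.assoc)
  show "v \<in> tangent S' \<Longrightarrow> bl T i (l v) = bl T' i v"
    using carrier_affine_eq(2)[OF lin' bary_spec(1)[OF T', of i], of T' "bc T i + bl T i c" "bc T' i" v] vert'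
    by simp
qed

lemma pb_m: "pb (A.m i u) = B.m i (pb u)"
  by (auto simp: fun_eq_iff pb_def restrict_form_def A.m_def B.m_def fun_mult_def bary_face)

lemma pb_e: "pb (A.e i u) = B.e i (pb u)"
proof -
  have "pb (A.e i u) = restrict_form S' (wedge1 (\<lambda>v. covector_on S (bl T i) (l v)) (\<lambda>x vs. u (c + l x) (map l vs)))"
    by (simp add: pb_def A.e_def wedge1_def alt_sum_map)
  also have "\<dots> = wedge1 (covector_on S' (\<lambda>v. covector_on S (bl T i) (l v))) (pb u)"
    by (simp add: pb_def wedge1_restrict_form)
  also have "covector_on S' (\<lambda>v. covector_on S (bl T i) (l v)) = covector_on S' (bl T' i)"
    by (auto simp: fun_eq_iff covector_on_def face_tangent bary_face)
  finally show ?thesis by (simp add: B.e_def)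
qed

lemma pb_E: "pb (A.E I u) = B.E I (pb u)"
proof (induction I)
  case (Cons i I)
  have IH: "pb (A.E I u) = B.E I (pb u)" by (fact Cons)
  show "pb (A.E (i # I) u) = B.E (i # I) (pb u)" by (simp add: pb_e IH)
qed simp

text \<open>The face map is affine and preserves the vertex \<open>i\<close>, so it takes each
  segment to the cone point of the face onto a segment to the cone point of the simplex.\<close>

lemma pb_cone:
  assumes "i \<in> T'"
  shows "pb (cone_op S (\<rho> T i) u) = cone_op S' (\<rho> T' i) (pb u)"
proof -
  have "pb (cone_op S (\<rho> T i) u) = restrict_form S' (cone_op UNIV (\<rho> T' i) (\<lambda>x vs. u (c + l x) (map l vs)))"
  proof -
    have seg: "c + l (\<rho> T' i + t *\<^sub>R (x - \<rho> T' i)) = \<rho> T i + t *\<^sub>R (c + l x - \<rho> T i)" for x t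
      using vert[OF assms, symmetric] by (simp add: linear_add[OF lin] linear_cmul[OF lin] linear_diff[OF lin] add.assoc)
    have "l (x - \<rho> T' i) = c + l x - \<rho> T i" for x
      using vert[OF assms, symmetric] by (simp add: linear_diff[OF lin])
    then show ?thesis
      by (auto simp: fun_eq_iff pb_def restrict_form_def cone_op_def face_carrier seg_integral_def seg)
  qed
  then show ?thesis
    by (simp add: pb_def cone_restrict_form[OF B.convex vertex_in[OF assms]])
qed

lemma pb_zigzag:
  assumes "set I \<subseteq> T'"
  shows "pb (A.zz u n I) = B.zz (pb u) n I"
  using assms
proof (induction n arbitrary: I)
  case 0
  show "pb (A.zz u 0 I) = B.zz (pb u) 0 I" by (simp add: linear_0[OF linear_pb])
next
  case (Suc n)
  have cech: "pb (A.cech u n I) = B.cech (pb u) n I"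
  proof -
    have "pb (A.cech u n I) = alt_sum (\<lambda>_ J. pb (A.zz u n J)) I"
      by (rule alt_sum_additive[where \<phi> = pb]) (rule linear_diff[OF linear_pb])
    also have "\<dots> = B.cech (pb u) n I"
      by (rule alt_sum_cong, rule Suc.IH) (use Suc.prems in \<open>auto dest!: add_mset_eq_mset_set\<close>)
    finally show ?thesis .
  qed
  show "pb (A.zz u (Suc n) I) = B.zz (pb u) (Suc n) I"
  proof (cases "I = []")
    \<comment> \<open>Here \<open>pick\<close> has no vertex to choose, but the alternating sum over
      the empty tuple is 0 anyway.\<close>
    case True
    then show ?thesis by (simp add: A.cone_op_0 B.cone_op_0 linear_0[OF linear_pb])
  next
    case False
    then have "pick (set I) \<in> T'" using pick_in[of "set I"] Suc.prems by auto
    from pb_cone[OF this] show ?thesis by (simp add: cech)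
  qed
qed

lemma pb_cech:
  assumes "set I \<subseteq> T'"
  shows "pb (A.cech u n I) = B.cech (pb u) n I"
proof -
  have "pb (A.cech u n I) = alt_sum (\<lambda>_ J. pb (A.zz u n J)) I"
    by (rule alt_sum_additive[where \<phi> = pb]) (rule linear_diff[OF linear_pb])
  also have "\<dots> = B.cech (pb u) n I"
    by (rule alt_sum_cong, rule pb_zigzag) (use assms in \<open>auto dest!: add_mset_eq_mset_set\<close>)
  finally show ?thesis .
qed

lemma B_m_eq_0: "i \<notin> T' \<Longrightarrow> B.m i u = 0"
  by (auto simp: B.m_def bc_def bl_def fun_mult_def fun_eq_iff)

lemma B_e_eq_0: "i \<notin> T' \<Longrightarrow> B.e i u = 0"
  by (auto simp: B.e_def bl_def covector_on_def wedge1_def fun_eq_iff)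

lemma B_E_eq_0: "\<not> set I \<subseteq> T' \<Longrightarrow> B.E I u = 0"
proof (induction I)
  case (Cons i I)
  then have "i \<in> T' \<Longrightarrow> B.E I u = 0" by (auto simp: form_eta)
  then show "B.E (i # I) u = 0"
    by (cases "i \<in> T'") (simp_all add: B_e_eq_0 linear_0[OF B.linear_e])
qed simp

text \<open>A term with a vertex outside \<open>T'\<close> vanishes on the face through its factor
  lambda or dlambda. For the other terms the tuple lies in \<open>T'\<close>, where the zigzag
  commutes with pullback.\<close>

lemma pb_Q: "pb (A.Q u n) = B.Q (pb u) n"
proof -
  let ?t = "\<lambda>j I. B.m j (B.E I (pb (A.zz u (Suc n) (j # I))))"
  have "pb (A.Q u n) = (\<Sum>j\<in>T. \<Sum>I\<in>tuples T n. ?t j I)"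
    by (simp add: A.Q_def linear_sum[OF linear_pb] pb_m pb_E del: zigzag.simps)
  also have "\<dots> = (\<Sum>j\<in>T'. \<Sum>I\<in>tuples T n. ?t j I)"
    by (rule sum.mono_neutral_right) (use A.finite_T sub in \<open>auto simp: B_m_eq_0 simp del: zigzag.simps\<close>)
  also have "\<dots> = (\<Sum>j\<in>T'. \<Sum>I\<in>tuples T' n. ?t j I)"
  proof (rule sum.cong[OF refl], rule sum.mono_neutral_right)
    fix j
    show "finite (tuples T n)" "tuples T' n \<subseteq> tuples T n"
      using A.finite_T sub by (auto simp: finite_tuples) (auto simp: tuples_def)
    show "\<forall>I\<in>tuples T n - tuples T' n. ?t j I = 0"
    proof
      fix I assume "I \<in> tuples T n - tuples T' n"
      then have I: "\<not> set I \<subseteq> T'" by (auto simp: tuples_def)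
      show "?t j I = 0" unfolding B_E_eq_0[OF I] by (rule linear_0[OF B.linear_m])
    qed
  qed
  also have "\<dots> = B.Q (pb u) n"
    unfolding B.Q_def
    by (intro sum.cong refl arg_cong[where f = "B.m _"] arg_cong[where f = "B.E _"] pb_zigzag)
       (auto simp: tuples_def)
  finally show ?thesis .
qed

end


section \<open>The simplicial de Rham theorem\<close>

lemma sum_scaleR_fun_apply:
  "(\<Sum>a\<in>A. c a *\<^sub>R f a) x = (\<Sum>a\<in>A. c a *\<^sub>R f a x)" for f :: "'i \<Rightarrow> 'b \<Rightarrow> 'c::real_vector"
  by (induction A rule: infinite_finite_induct) (auto simp: scaleR_fun_def)

lemma filter_upt_neq:
  "i < n \<Longrightarrow> [j \<leftarrow> [0..<n]. j \<noteq> i] = take i [0..<n] @ drop (Suc i) [0..<n]"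
proof -
  assume i: "i < n"
  have "[0..<n] = [0..<i] @ i # [Suc i..<n]"
    using i by (metis le_add_same_cancel1 less_imp_le_nat upt_add_eq_append upt_conv_Cons zero_le le_add_diff_inverse)
  moreover have "filter (\<lambda>j. j \<noteq> i) [0..<i] = [0..<i]" "filter (\<lambda>j. j \<noteq> i) [Suc i..<n] = [Suc i..<n]"
    by (auto intro!: filter_True)
  ultimately show ?thesis using i by (simp add: take_upt drop_upt)
qed

lemma (in convex_domain) ext_deriv_const:
  "ext_deriv S 0 (\<lambda>x vs. if x \<in> S \<and> vs = [] then c else 0) = 0"
proof (intro ext)
  fix x vs
  have "frechet_derivative (\<lambda>y. if y \<in> S then c else 0) (at x within S) v = 0" if "x \<in> S" "v \<in> tangent S" for v
    by (rule frechet_derivative_within_eq[OF convex that(1) has_derivative_const _ that(2)]) simp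
  then show "ext_deriv S 0 (\<lambda>x vs. if x \<in> S \<and> vs = [] then c else 0) x vs = 0 x vs"
    by (auto simp: ext_deriv_def vectors_def length_Suc_conv)
qed

section \<open>Compatible families of forms\<close>

context realization
begin

lemma convex_domain: "T \<in> \<T> \<Longrightarrow> convex_domain (carrier_of \<rho> T)"
  using simplex_forms simplex_forms.axioms(1) by blast

lemma face_exists:
  assumes T: "T \<in> \<T>" and T': "T' \<in> \<T>" and sub: "T' \<subseteq> T"
  obtains c l where "face \<T> V \<rho> T T' c l"
proof -
  have ex: "\<exists>f. (\<exists>c l. linear l \<and> f = (\<lambda>x. c + l x)) \<and> (\<forall>i\<in>T'. f (\<rho> T' i) = \<rho> T i)"
  proof -
    obtain c l where "linear l" "\<And>i. i \<in> T' \<Longrightarrow> c + l (\<rho> T' i) = \<rho> T i"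
      by (rule vertex_extend[OF T', of "\<rho> T"]) blast
    then show ?thesis by - (rule exI[of _ "\<lambda>x. c + l x"], auto)
  qed
  note f = someI_ex[OF ex, folded face_map_def]
  obtain c l where cl: "linear l" "face_map \<rho> T T' = (\<lambda>x. c + l x)"
    using conjunct1[OF f] by blast
  have "c + l (\<rho> T' i) = \<rho> T i" if "i \<in> T'" for i
    using bspec[OF conjunct2[OF f] that] by (simp only: cl(2))
  then have "face \<T> V \<rho> T T' c l"
    by (intro face.intro face_axioms.intro realization_axioms T T' sub cl)
  then show thesis by (rule that)
qed

lemma OmegaI:
  assumes "\<And>T. T \<in> \<T> \<Longrightarrow> smooth_form (carrier_of \<rho> T) k (u T)"
    and "\<And>T. T \<notin> \<T> \<Longrightarrow> u T = 0"
    and "\<And>T T' c l. face \<T> V \<rho> T T' c l \<Longrightarrow> face.pb \<rho> T' c l (u T) = u T'"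
  shows "u \<in> Omega \<T> \<rho> k"
  unfolding Omega_def
proof (intro CollectI conjI ballI allI impI)
  fix T T' assume "T \<in> \<T>" "T' \<in> \<T>" "T' \<subseteq> T"
  then obtain c l where F: "face \<T> V \<rho> T T' c l" by (rule face_exists)
  then interpret F: face \<T> V \<rho> T T' c l .
  show "pullback (face_map \<rho> T T') (carrier_of \<rho> T') k (u T) = u T'"
    using F.pullback_eq_pb[OF assms(1)[OF F.T]] assms(3)[OF F] by simp
qed (use assms in auto)

lemma OmegaD:
  assumes "u \<in> Omega \<T> \<rho> k"
  shows "T \<in> \<T> \<Longrightarrow> smooth_form (carrier_of \<rho> T) k (u T)"
    and "T \<notin> \<T> \<Longrightarrow> u T = 0"
    and "face \<T> V \<rho> T T' c l \<Longrightarrow> face.pb \<rho> T' c l (u T) = u T'"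
proof -
  show "face.pb \<rho> T' c l (u T) = u T'" if F: "face \<T> V \<rho> T T' c l"
  proof -
    interpret F: face \<T> V \<rho> T T' c l by (rule F)
    have "smooth_form (carrier_of \<rho> T) k (u T)"
      "pullback (face_map \<rho> T T') (carrier_of \<rho> T') k (u T) = u T'"
      using assms F.T F.T' F.sub by (auto simp: Omega_def)
    then show ?thesis using F.pullback_eq_pb by simp
  qed
qed (use assms in \<open>auto simp: Omega_def\<close>)

lemma subspace_Omega: "subspace (Omega \<T> \<rho> k)"
proof (rule subspaceI)
  show "0 \<in> Omega \<T> \<rho> k"
    by (rule OmegaI)
       (auto simp: convex_domain.smooth_form_0[OF convex_domain] linear_0[OF face.linear_pb])
  show "u + w \<in> Omega \<T> \<rho> k" if "u \<in> Omega \<T> \<rho> k" "w \<in> Omega \<T> \<rho> k" for u w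
    by (rule OmegaI)
       (use OmegaD[OF that(1)] OmegaD[OF that(2)] in \<open>auto simp: convex_domain.smooth_form_add[OF convex_domain]
         linear_add[OF face.linear_pb]\<close>)
  show "r *\<^sub>R u \<in> Omega \<T> \<rho> k" if "u \<in> Omega \<T> \<rho> k" for r u
    by (rule OmegaI)
       (use OmegaD[OF that] in \<open>auto simp: scaleR_fun_def[of r u] convex_domain.smooth_form_scaleR[OF convex_domain]
         linear_cmul[OF face.linear_pb]\<close>)
qed

lemma dd_add:
  "u \<in> Omega \<T> \<rho> k \<Longrightarrow> w \<in> Omega \<T> \<rho> k \<Longrightarrow> dd \<T> \<rho> k (u + w) = dd \<T> \<rho> k u + dd \<T> \<rho> k w"
  by (rule ext) (simp add: dd_def OmegaD(1) convex_domain.ext_deriv_add[OF convex_domain])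

lemma dd_scaleR: "u \<in> Omega \<T> \<rho> k \<Longrightarrow> dd \<T> \<rho> k (r *\<^sub>R u) = r *\<^sub>R dd \<T> \<rho> k u"
  by (rule ext) (simp add: dd_def OmegaD(1) scaleR_fun_def[of r u] scaleR_fun_def[of r "\<lambda>T. if T \<in> _ then _ T else _"]
      convex_domain.ext_deriv_scaleR[OF convex_domain])

section \<open>Whitney forms expressed by the operators on a simplex\<close>

lemma lam_eq:
  assumes T: "T \<in> \<T>"
  shows "lam \<T> \<rho> i T = simplex_forms.m (bc T) (bl T) i (simplex_forms.one (carrier_of \<rho> T))"
proof -
  interpret A: simplex_forms "carrier_of \<rho> T" T "\<rho> T" "bc T" "bl T" by (rule simplex_forms[OF T])
  show ?thesis
  proof (intro ext)
    fix x vs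
    show "lam \<T> \<rho> i T x vs = A.m i A.one x vs"
      by (cases "i \<in> T") (auto simp: lam_def A.m_def fun_mult_def T bary_coords_eq bc_def bl_def)
  qed
qed

lemma dd_lam_eq:
  assumes T: "T \<in> \<T>"
  shows "dd \<T> \<rho> 0 (lam \<T> \<rho> i) T = simplex_forms.e (carrier_of \<rho> T) (bl T) i (simplex_forms.one (carrier_of \<rho> T))"
proof -
  interpret A: simplex_forms "carrier_of \<rho> T" T "\<rho> T" "bc T" "bl T" by (rule simplex_forms[OF T])
  have "dd \<T> \<rho> 0 (lam \<T> \<rho> i) T = ext_deriv (carrier_of \<rho> T) 0 (A.m i A.one)"
    by (simp add: dd_def T lam_eq)
  also have "\<dots> = A.e i A.one + A.m i (ext_deriv (carrier_of \<rho> T) 0 A.one)"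
    by (rule A.ext_deriv_m[OF A.smooth_form_const])
  also have "A.m i (ext_deriv (carrier_of \<rho> T) 0 A.one) = 0"
    unfolding A.ext_deriv_const by (rule linear_0[OF A.linear_m])
  finally show ?thesis by (simp only: add_0_right)
qed

lemma wedge_list_eq:
  assumes T: "T \<in> \<T>"
  shows "wedge_list \<T> \<rho> (map (\<lambda>i. dd \<T> \<rho> 0 (lam \<T> \<rho> i)) I) T
    = simplex_forms.E (carrier_of \<rho> T) (bl T) I (simplex_forms.one (carrier_of \<rho> T))"
proof -
  interpret A: simplex_forms "carrier_of \<rho> T" T "\<rho> T" "bc T" "bl T" by (rule simplex_forms[OF T])
  have "wedge_list \<T> \<rho> (map (\<lambda>i. dd \<T> \<rho> 0 (lam \<T> \<rho> i)) I) T x vs = A.E I A.one x vs" for x vs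
  proof (induction I arbitrary: vs)
    case Nil
    then show ?case by (simp add: one_form0_def T)
  next
    case (Cons i I)
    have IH: "wedge_list \<T> \<rho> (map (\<lambda>i. dd \<T> \<rho> 0 (lam \<T> \<rho> i)) I) T x = A.E I A.one x"
      by (rule ext) (rule Cons)
    have sm: "smooth_form (carrier_of \<rho> T) (length I) (A.E I A.one)"
      using A.smooth_form_E[OF A.smooth_form_const, of I] by simp
    have "wedge_list \<T> \<rho> (map (\<lambda>i. dd \<T> \<rho> 0 (lam \<T> \<rho> i)) (i # I)) T x vs
        = wedge 1 (length I) (A.e i A.one x) (A.E I A.one x) vs"
      by (simp add: wedge_forms_def IH dd_lam_eq[OF T])
    also have "\<dots> = alt_sum (\<lambda>v ws. A.e i A.one x [v] * A.E I A.one x ws) vs"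
      by (rule wedge_1_left) (use A.smooth_form_swap_antisymmetric[OF sm] A.smooth_form_eq_0[OF sm] in auto)
    also have "\<dots> = alt_sum (\<lambda>v ws. covector_on (carrier_of \<rho> T) (bl T i) v * A.E I A.one x ws) vs"
      using A.smooth_form_eq_0[OF sm, of x]
      by (intro alt_sum_cong) (auto simp: A.e_def wedge1_def)
    finally show ?case by (simp add: A.e_def wedge1_def)
  qed
  then show ?thesis by (intro ext)
qed

lemma whitney_form_eq:
  assumes T: "T \<in> \<T>"
  shows "whitney_form \<T> \<rho> \<sigma> k A T = fact k *\<^sub>R
    alt_sum (\<lambda>i J. simplex_forms.m (bc T) (bl T) i
      (simplex_forms.E (carrier_of \<rho> T) (bl T) J (simplex_forms.one (carrier_of \<rho> T)))) (map (\<sigma> A) [0..<Suc k])"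
proof -
  interpret A: simplex_forms "carrier_of \<rho> T" T "\<rho> T" "bc T" "bl T" by (rule simplex_forms[OF T])
  let ?s = "map (\<sigma> A) [0..<Suc k]"
  let ?f = "\<lambda>i. wedge_forms 0 k (lam \<T> \<rho> (\<sigma> A i))
         (wedge_list \<T> \<rho> (map (\<lambda>j. dd \<T> \<rho> 0 (lam \<T> \<rho> (\<sigma> A j))) [j \<leftarrow> [0..<Suc k]. j \<noteq> i]))"
  have "?f i T = A.m (?s ! i) (A.E (take i ?s @ drop (Suc i) ?s) A.one)" if "i \<le> k" for i
  proof -
    let ?I = "take i ?s @ drop (Suc i) ?s"
    have I: "map (\<lambda>j. dd \<T> \<rho> 0 (lam \<T> \<rho> (\<sigma> A j))) [j \<leftarrow> [0..<Suc k]. j \<noteq> i]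
        = map (\<lambda>i. dd \<T> \<rho> 0 (lam \<T> \<rho> i)) ?I"
      using that by (simp add: filter_upt_neq take_map drop_map del: upt_Suc)
    have len: "length ?I = k" using that by simp
    have sm: "smooth_form (carrier_of \<rho> T) k (A.E ?I A.one)"
      using A.smooth_form_E[OF A.smooth_form_const, of ?I] unfolding len add_0 .
    show ?thesis
    proof (intro ext)
      fix x vs
      have "?f i T x vs = wedge 0 k (lam \<T> \<rho> (\<sigma> A i) T x) (A.E ?I A.one x) vs"
        unfolding wedge_forms_def I wedge_list_eq[OF T] ..
      also have "\<dots> = lam \<T> \<rho> (\<sigma> A i) T x [] * A.E ?I A.one x vs"
        by (rule wedge_0_left) (use A.smooth_form_swap_antisymmetric[OF sm] A.smooth_form_eq_0[OF sm] in auto)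
      also have "\<dots> = A.m (?s ! i) (A.E ?I A.one) x vs"
      proof (cases "x \<in> carrier_of \<rho> T")
        case True
        have "?s ! i = \<sigma> A i" using that by (simp del: upt_Suc)
        then show ?thesis using True by (simp add: lam_eq[OF T] A.m_def fun_mult_def del: upt_Suc)
      next
        case False
        then have z: "A.E ?I A.one x vs = 0" by (intro A.smooth_form_eq_0[OF sm]) simp
        show ?thesis by (simp only: A.m_def fun_mult_def z mult_zero_right)
      qed
      finally show "?f i T x vs = A.m (?s ! i) (A.E ?I A.one) x vs" .
    qed
  qed
  then have "(\<Sum>i\<le>k. (-1) ^ i *\<^sub>R ?f i T) = (\<Sum>i\<le>k. (-1) ^ i *\<^sub>R A.m (?s ! i) (A.E (take i ?s @ drop (Suc i) ?s) A.one))"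
    by (intro sum.cong refl arg_cong[where f = "scaleR _"]) (simp only: atMost_iff)
  then show ?thesis
    unfolding whitney_form_def alt_sum_eq_sum length_map length_upt diff_zero lessThan_Suc_atMost
      scaleR_fun_def[of "fact k" "sum _ _"] sum_scaleR_fun_apply by (rule arg_cong)
qed

lemma whitney_form_outside:
  assumes "T \<notin> \<T>"
  shows "whitney_form \<T> \<rho> \<sigma> k A T = 0"
proof -
  have "wedge_forms 0 k (lam \<T> \<rho> i) w T = 0" for i w
    using assms by (auto simp: fun_eq_iff wedge_forms_def wedge_def lam_def if_distrib cong: if_cong)
  then show ?thesis
    unfolding whitney_form_def scaleR_fun_def[of "fact k" "sum _ _"] sum_scaleR_fun_apply
    by (simp add: form_eta)
qed

lemma whitney_form_not_subset:
  assumes T: "T \<in> \<T>" and "\<not> set (map (\<sigma> A) [0..<Suc k]) \<subseteq> T"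
  shows "whitney_form \<T> \<rho> \<sigma> k A T = 0"
proof -
  \<comment> \<open>Regarding \<open>T\<close> as a face of itself makes the vanishing lemmas for
    vertices outside a face available.\<close>
  obtain c l where "face \<T> V \<rho> T T c l" using face_exists[OF T T subset_refl] .
  then interpret F: face \<T> V \<rho> T T c l .
  let ?s = "map (\<sigma> A) [0..<Suc k]"
  have "alt_sum (\<lambda>i J. F.A.m i (F.A.E J F.A.one)) ?s = alt_sum (\<lambda>i J. 0) ?s"
  proof (rule alt_sum_cong)
    fix y ys assume "mset (y # ys) = mset ?s"
    then have "insert y (set ys) = set ?s" by (metis list.set(2) set_mset_mset)
    then have "y \<notin> T \<or> \<not> set ys \<subseteq> T" using assms(2) by auto
    then show "F.A.m y (F.A.E ys F.A.one) = 0"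
    proof
      assume "\<not> set ys \<subseteq> T"
      show ?thesis unfolding F.B_E_eq_0[OF \<open>\<not> set ys \<subseteq> T\<close>] by (rule linear_0[OF F.A.linear_m])
    qed (rule F.B_m_eq_0)
  qed
  then show ?thesis by (simp only: whitney_form_eq[OF T] alt_sum_zero scaleR_zero_right)
qed

section \<open>The zigzag on the whole complex\<close>

definition global_Q :: "('v, 'a) forms \<Rightarrow> nat \<Rightarrow> ('v, 'a) forms" where
  "global_Q u n = (\<lambda>T. if T \<in> \<T>
     then simplex_forms.Q (carrier_of \<rho> T) T (\<rho> T) (bc T) (bl T) (u T) n else 0)"

definition global_R :: "('v, 'a) forms \<Rightarrow> nat \<Rightarrow> ('v, 'a) forms" where
  "global_R u n = (\<lambda>T. if T \<in> \<T>
     then simplex_forms.R (carrier_of \<rho> T) T (\<rho> T) (bl T) (u T) n else 0)"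

text \<open>The Cech cocycle of constants at the end of the zigzag, evaluated at a vertex of the
  simplex spanned by the tuple.\<close>
definition cochain :: "('v, 'a) forms \<Rightarrow> nat \<Rightarrow> 'v list \<Rightarrow> real" where
  "cochain u k I = alt_sum (\<lambda>_. zigzag (carrier_of \<rho> (set I)) (\<rho> (set I)) (u (set I)) k) I
     (\<rho> (set I) (pick (set I))) []"

lemma swap_antisymmetric_cochain: "swap_antisymmetric (cochain u k)"
proof -
  have "cochain u k (xs @ a # b # ys) = - cochain u k (xs @ b # a # ys)" for xs a b ys
  proof -
    have eq: "set (xs @ a # b # ys) = set (xs @ b # a # ys)" by auto
    show ?thesis
      unfolding cochain_def eq
      by (subst swap_antisymmetricD[OF swap_antisymmetric_alt_sum[OF swap_antisymmetric_zigzag]]) simp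
  qed
  then show ?thesis unfolding swap_antisymmetric_def by blast
qed

context
  fixes u k
  assumes u: "u \<in> Omega \<T> \<rho> k" and closed: "dd \<T> \<rho> k u = 0"
begin

lemma closed_on:
  assumes "T \<in> \<T>"
  shows "smooth_form (carrier_of \<rho> T) k (u T)" "ext_deriv (carrier_of \<rho> T) k (u T) = 0"
  using OmegaD(1)[OF u assms] fun_cong[OF closed, of T] assms by (auto simp: dd_def)

lemma global_Q_Omega: "n < k \<Longrightarrow> global_Q u n \<in> Omega \<T> \<rho> (k - 1)"
proof (rule OmegaI)
  fix T assume n: "n < k" and T: "T \<in> \<T>"
  interpret A: simplex_forms "carrier_of \<rho> T" T "\<rho> T" "bc T" "bl T" by (rule simplex_forms[OF T])
  show "smooth_form (carrier_of \<rho> T) (k - 1) (global_Q u n T)"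
    using A.smooth_form_Q[OF closed_on[OF T] n] T by (simp add: global_Q_def)
next
  fix T T' c l assume F: "face \<T> V \<rho> T T' c l"
  interpret F: face \<T> V \<rho> T T' c l by (rule F)
  show "F.pb (global_Q u n T) = global_Q u n T'"
    using F.pb_Q[of "u T" n] OmegaD(3)[OF u F] F.T F.T' by (simp add: global_Q_def)
qed (simp add: global_Q_def)

lemma dd_global_Q:
  assumes "n < k"
  shows "dd \<T> \<rho> (k - 1) (global_Q u n) = global_R u (Suc n) + (-1) ^ n *\<^sub>R global_R u n"
proof
  fix T
  show "dd \<T> \<rho> (k - 1) (global_Q u n) T = (global_R u (Suc n) + (-1) ^ n *\<^sub>R global_R u n) T"
  proof (cases "T \<in> \<T>")
    case True
    interpret A: simplex_forms "carrier_of \<rho> T" T "\<rho> T" "bc T" "bl T" by (rule simplex_forms[OF True])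
    show ?thesis
      using A.ext_deriv_Q[OF closed_on[OF True] assms] True
      by (simp add: dd_def global_Q_def global_R_def scaleR_fun_def[of _ "\<lambda>T. if T \<in> _ then _ T else _"])
  qed (simp add: dd_def global_R_def scaleR_fun_def form_eta)
qed

lemma global_R_0: "global_R u 0 = u"
proof
  fix T
  show "global_R u 0 T = u T"
  proof (cases "T \<in> \<T>")
    case True
    interpret A: simplex_forms "carrier_of \<rho> T" T "\<rho> T" "bc T" "bl T" by (rule simplex_forms[OF True])
    show ?thesis using True A.R_0[OF closed_on[OF True]] by (simp add: global_R_def)
  qed (use OmegaD(2)[OF u] in \<open>simp add: global_R_def\<close>)
qed

text \<open>Pulling the constant back to the face spanned by \<open>I\<close> does not change its
  value, and on that face it depends on \<open>I\<close> alone. Hence the coefficient is the same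
  for all \<open>T\<close> that contain \<open>I\<close>.\<close>

lemma cech_eq_cochain:
  assumes T: "T \<in> \<T>" and I: "I \<in> tuples T (Suc k)"
  shows "alt_sum (\<lambda>_. zigzag (carrier_of \<rho> T) (\<rho> T) (u T) k) I
    = cochain u k I *\<^sub>R simplex_forms.one (carrier_of \<rho> T)"
proof -
  have sub: "set I \<subseteq> T" "length I = Suc k" "set I \<noteq> {}" using I by (auto simp: tuples_def)
  have T': "set I \<in> \<T>" using face_in[OF T sub(1,3)] .
  obtain c l where F: "face \<T> V \<rho> T (set I) c l" using face_exists[OF T T' sub(1)] .
  interpret F: face \<T> V \<rho> T "set I" c l by (rule F)
  let ?i = "pick (set I)"
  have i: "?i \<in> set I" using pick_in[OF sub(3)] .
  have q: "\<rho> T ?i \<in> carrier_of \<rho> T" using vertex_in i sub(1) by blast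
  have "F.pb (F.A.cech (u T) k I) = F.B.cech (u (set I)) k I"
    using F.pb_cech[OF subset_refl] OmegaD(3)[OF u F] by simp
  then have "cochain u k I = F.pb (F.A.cech (u T) k I) (\<rho> (set I) ?i) []"
    by (simp add: cochain_def)
  also have "\<dots> = F.A.cech (u T) k I (\<rho> T ?i) []"
    using vertex_in[OF i] F.vert[OF i] by (simp add: F.pb_def restrict_form_def)
  finally show ?thesis
    using F.A.cech_const[OF closed_on[OF T] sub(2,1) q] by simp
qed

text \<open>The coefficients do not depend on \<open>T\<close>, and a Whitney form vanishes on
  simplexes that do not contain its own; so the expansions on the single simplexes fit together to
  one global sum.\<close>

lemma global_R_eq_whitney:
  assumes \<sigma>: "vertex_numbering \<T> \<sigma>"
  shows "global_R u k =
    (\<Sum>A\<in>simplexes \<T> k. cochain u k (map (\<sigma> A) [0..<Suc k]) *\<^sub>R whitney_form \<T> \<rho> \<sigma> k A)"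
    (is "_ = ?w")
proof
  fix T
  let ?s = "\<lambda>A. map (\<sigma> A) [0..<Suc k]"
  have w: "?w T = (\<Sum>A\<in>simplexes \<T> k. cochain u k (?s A) *\<^sub>R whitney_form \<T> \<rho> \<sigma> k A T)"
    by (rule sum_scaleR_fun_apply)
  have s: "distinct (?s A) \<and> set (?s A) = A" if "A \<in> simplexes \<T> k" for A
  proof -
    have "bij_betw (\<sigma> A) {0..k} A" using \<sigma> that by (auto simp: vertex_numbering_def)
    then have "inj_on (\<sigma> A) {0..<Suc k}" "\<sigma> A ` {0..<Suc k} = A"
      by (auto simp: bij_betw_def atLeastLessThanSuc_atLeastAtMost)
    then show ?thesis by (simp add: distinct_map del: upt_Suc)
  qed
  show "global_R u k T = ?w T"
  proof (cases "T \<in> \<T>")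
    case T: True
    interpret A: simplex_forms "carrier_of \<rho> T" T "\<rho> T" "bc T" "bl T" by (rule simplex_forms[OF T])
    have sub: "A \<in> simplexes \<T> k" if "A \<subseteq> T" "card A = Suc k" for A
    proof -
      have "A \<noteq> {}" using that(2) by auto
      then show ?thesis using face_in[OF T that(1)] that(2) by (simp add: simplexes_def)
    qed
    have fin: "finite (simplexes \<T> k)"
      using complex by (simp add: simplexes_def abstract_simplicial_complex_def)
    have "global_R u k T = A.R (u T) k" by (simp add: global_R_def T)
    also have "\<dots> = (\<Sum>j\<in>T. \<Sum>I\<in>tuples T k. A.m j (A.E I (A.cech (u T) k (j # I))))"
      using A.sum_m_E_cech[OF closed_on[OF T] order_refl] by (simp only:)
    also have "\<dots> = (\<Sum>j\<in>T. \<Sum>I\<in>tuples T k. cochain u k (j # I) *\<^sub>R A.m j (A.E I A.one))"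
    proof (intro sum.cong refl)
      fix j I assume "j \<in> T" "I \<in> tuples T k"
      then have "j # I \<in> tuples T (Suc k)" by (simp add: tuples_def)
      from cech_eq_cochain[OF T this]
      show "A.m j (A.E I (A.cech (u T) k (j # I))) = cochain u k (j # I) *\<^sub>R A.m j (A.E I A.one)"
        by (simp only: linear_cmul[OF A.linear_E] linear_cmul[OF A.linear_m])
    qed
    also have "\<dots> = (\<Sum>A | A \<subseteq> T \<and> card A = Suc k.
        cochain u k (?s A) *\<^sub>R fact k *\<^sub>R alt_sum (\<lambda>i J. A.m i (A.E J A.one)) (?s A))"
      by (rule A.sum_cochain_eq_whitney[OF swap_antisymmetric_cochain]) (use s sub in blast)
    also have "\<dots> = (\<Sum>A | A \<subseteq> T \<and> card A = Suc k. cochain u k (?s A) *\<^sub>R whitney_form \<T> \<rho> \<sigma> k A T)"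
      by (simp only: whitney_form_eq[OF T])
    also have "\<dots> = (\<Sum>A\<in>simplexes \<T> k. cochain u k (?s A) *\<^sub>R whitney_form \<T> \<rho> \<sigma> k A T)"
    proof (rule sum.mono_neutral_left[OF fin])
      show "{A. A \<subseteq> T \<and> card A = Suc k} \<subseteq> simplexes \<T> k" using sub by blast
      show "\<forall>A\<in>simplexes \<T> k - {A. A \<subseteq> T \<and> card A = Suc k}. cochain u k (?s A) *\<^sub>R whitney_form \<T> \<rho> \<sigma> k A T = 0"
      proof
        fix A assume A: "A \<in> simplexes \<T> k - {A. A \<subseteq> T \<and> card A = Suc k}"
        then have "\<not> A \<subseteq> T" by (auto simp: simplexes_def)
        then have "\<not> set (?s A) \<subseteq> T" using s[of A] A by blast
        then have "whitney_form \<T> \<rho> \<sigma> k A T = 0" by (rule whitney_form_not_subset[OF T])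
        then show "cochain u k (?s A) *\<^sub>R whitney_form \<T> \<rho> \<sigma> k A T = 0"
          by (simp only: scaleR_zero_right)
      qed
    qed
    finally show ?thesis unfolding w .
  next
    case False
    then show ?thesis unfolding w by (simp add: global_R_def whitney_form_outside)
  qed
qed

theorem simplicial_de_rham:
  assumes \<sigma>: "vertex_numbering \<T> \<sigma>"
  obtains w v where "w \<in> Lambda \<T> \<rho> \<sigma> k" "v \<in> Omega \<T> \<rho> (k - 1)"
    "u = w + dd \<T> \<rho> (k - 1) v" "k = 0 \<longrightarrow> v = 0"
proof -
  \<comment> \<open>For k = 0 the truncated \<open>k - 1\<close> is 0 rather than -1; that there is
    no primitive is expressed by v = 0. At the end n = k, so it is enough to record this for n =
    0.\<close>
  have "\<exists>t v. v \<in> Omega \<T> \<rho> (k - 1) \<and> u = t *\<^sub>R global_R u n + dd \<T> \<rho> (k - 1) v \<and> (n = 0 \<longrightarrow> v = 0)"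
    if "n \<le> k" for n
    using that
  proof (induction n)
    case 0
    have "dd \<T> \<rho> (k - 1) 0 = 0"
      using dd_scaleR[OF subspace_0[OF subspace_Omega], of "k - 1" 0] by (simp only: scaleR_zero_left)
    then have "u = 1 *\<^sub>R global_R u 0 + dd \<T> \<rho> (k - 1) 0"
      by (simp only: global_R_0 scaleR_one add_0_right)
    then show ?case using subspace_0[OF subspace_Omega] by blast
  next
    case (Suc n)
    obtain t v where v: "v \<in> Omega \<T> \<rho> (k - 1)" and eq: "u = t *\<^sub>R global_R u n + dd \<T> \<rho> (k - 1) v"
      using Suc.IH[OF Suc_leD[OF Suc.prems]] by blast
    \<comment> \<open>Chosen so that d applied to \<open>?r\<close> times
      \<open>global_Q u n\<close> contains exactly t times \<open>global_R u n\<close>, as (-1)^n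
      squares to 1; the coefficient at the next level is then \<open>- ?r\<close>.\<close>
    let ?r = "t * (-1) ^ n"
    have n: "n < k" using Suc.prems by simp
    note Q = global_Q_Omega[OF n]
    have "?r *\<^sub>R (-1) ^ n *\<^sub>R global_R u n = t *\<^sub>R global_R u n"
      by (simp add: power_mult_distrib[symmetric])
    then have "dd \<T> \<rho> (k - 1) (?r *\<^sub>R global_Q u n) = ?r *\<^sub>R global_R u (Suc n) + t *\<^sub>R global_R u n"
      by (simp only: dd_scaleR[OF Q] dd_global_Q[OF n] scaleR_add_right)
    then have "u = (- ?r) *\<^sub>R global_R u (Suc n) + dd \<T> \<rho> (k - 1) (?r *\<^sub>R global_Q u n + v)"
      using eq dd_add[OF subspace_scale[OF subspace_Omega Q] v] by (simp only: scaleR_minus_left add.assoc) simp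
    moreover have "?r *\<^sub>R global_Q u n + v \<in> Omega \<T> \<rho> (k - 1)"
      by (intro subspace_add[OF subspace_Omega] subspace_scale[OF subspace_Omega] Q v)
    ultimately show ?case by blast
  qed
  from this[OF order_refl] obtain t v where v: "v \<in> Omega \<T> \<rho> (k - 1)"
    "u = t *\<^sub>R global_R u k + dd \<T> \<rho> (k - 1) v" "k = 0 \<longrightarrow> v = 0" by blast
  have "t *\<^sub>R global_R u k \<in> Lambda \<T> \<rho> \<sigma> k"
    unfolding global_R_eq_whitney[OF \<sigma>] Lambda_def
    by (intro span_scale span_sum span_base imageI)
  with v show thesis using that by blast
qed

end

end

section \<open>Cohomology of a subcomplex\<close>

lemma coh_class_eq_iff:
  assumes "subspace (coboundaries d A k)"
  shows "coh_class d A k u = coh_class d A k v \<longleftrightarrow> u - v \<in> coboundaries d A k"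
proof
  assume "coh_class d A k u = coh_class d A k v"
  moreover have "u \<in> coh_class d A k u"
    using subspace_0[OF assms] by (force simp: coh_class_def)
  ultimately have "u \<in> coh_class d A k v" by (simp only:)
  then show "u - v \<in> coboundaries d A k" by (auto simp: coh_class_def)
next
  assume uv: "u - v \<in> coboundaries d A k"
  have "x \<in> coh_class d A k u \<longleftrightarrow> x \<in> coh_class d A k v" for x
  proof -
    have "x - v = (x - u) + (u - v)" by simp
    then have "x - u \<in> coboundaries d A k \<longleftrightarrow> x - v \<in> coboundaries d A k"
      using uv subspace_add[OF assms, of "x - u" "u - v"] subspace_diff[OF assms, of "x - v" "u - v"]
      by (metis add_diff_cancel_right')
    moreover have "x \<in> coh_class d A k w \<longleftrightarrow> x - w \<in> coboundaries d A k" for w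
      unfolding coh_class_def by (auto, metis add.commute diff_add_cancel)
    ultimately show ?thesis by blast
  qed
  then show "coh_class d A k u = coh_class d A k v" by blast
qed

lemma coh_class_memD: "x \<in> coh_class d A k u \<Longrightarrow> x - u \<in> coboundaries d A k"
  by (auto simp: coh_class_def)

lemma coh_class_self: "subspace (coboundaries d A k) \<Longrightarrow> u \<in> coh_class d A k u"
  using subspace_0 by (force simp: coh_class_def)

lemma coh_add_class:
  assumes "subspace (coboundaries d A k)"
  shows "coh_add d A k (coh_class d A k u) (coh_class d A k v) = coh_class d A k (u + v)"
proof -
  have "coh_class d A k (x + y) = coh_class d A k (u + v)"
    if "x \<in> coh_class d A k u" "y \<in> coh_class d A k v" for x y
  proof -
    have "x + y - (u + v) = (x - u) + (y - v)" by simp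
    then show ?thesis
      unfolding coh_class_eq_iff[OF assms]
      using subspace_add[OF assms coh_class_memD coh_class_memD, OF that] by (simp only:)
  qed
  then show ?thesis
    using coh_class_self[OF assms] unfolding coh_add_def by blast
qed

lemma coh_scale_class:
  assumes "subspace (coboundaries d A k)"
  shows "coh_scale d A k a (coh_class d A k u) = coh_class d A k (a *\<^sub>R u)"
proof -
  have "coh_class d A k (a *\<^sub>R x) = coh_class d A k (a *\<^sub>R u)" if "x \<in> coh_class d A k u" for x
    unfolding coh_class_eq_iff[OF assms] scaleR_diff_right[symmetric]
    by (rule subspace_scale[OF assms coh_class_memD[OF that]])
  then show ?thesis
    using coh_class_self[OF assms] unfolding coh_scale_def by blast
qed

text \<open>Reduces statements about cosets to representatives: the kernel condition
  \<open>inj\<close> is applied to differences of cocycles, and \<open>surj\<close> asks for a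
  cocycle of the subcomplex in each class.\<close>

lemma inclusion_induces_isoI:
  assumes A: "subspace (cocycles d A k)" "subspace (coboundaries d A k)"
    and B: "subspace (coboundaries d B k)"
    and cocycles: "cocycles d A k \<subseteq> cocycles d B k"
    and coboundaries: "coboundaries d A k \<subseteq> coboundaries d B k"
    and inj: "\<And>u. u \<in> cocycles d A k \<Longrightarrow> u \<in> coboundaries d B k \<Longrightarrow> u \<in> coboundaries d A k"
    and surj: "\<And>u. u \<in> cocycles d B k \<Longrightarrow> \<exists>w\<in>cocycles d A k. u - w \<in> coboundaries d B k"
  shows "inclusion_induces_iso d A B k"
proof -
  \<comment> \<open>A definition without chosen representatives: for a class of \<open>A\<close> the
    union is over equal classes of \<open>B\<close>, because coboundaries of \<open>A\<close> are
    coboundaries of \<open>B\<close>.\<close>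
  define \<phi> where "\<phi> X = (\<Union>x\<in>X. coh_class d B k x)" for X
  have \<phi>: "\<phi> (coh_class d A k u) = coh_class d B k u" for u
  proof -
    have "coh_class d B k x = coh_class d B k u" if "x \<in> coh_class d A k u" for x
      unfolding coh_class_eq_iff[OF B] using coh_class_memD[OF that] coboundaries by blast
    then show ?thesis using coh_class_self[OF A(2)] unfolding \<phi>_def by blast
  qed
  have "inj_on \<phi> (cohomology d A k)"
  proof (rule inj_onI)
    fix X Y assume XY: "X \<in> cohomology d A k" "Y \<in> cohomology d A k" "\<phi> X = \<phi> Y"
    then obtain x y where xy: "X = coh_class d A k x" "x \<in> cocycles d A k" "Y = coh_class d A k y" "y \<in> cocycles d A k"
      unfolding cohomology_def by blast
    then have "x - y \<in> coboundaries d B k"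
      using XY(3) unfolding xy \<phi> coh_class_eq_iff[OF B] by blast
    then have "x - y \<in> coboundaries d A k"
      by (rule inj[OF subspace_diff[OF A(1) xy(2,4)]])
    then show "X = Y" unfolding xy coh_class_eq_iff[OF A(2)] .
  qed
  moreover have "\<phi> ` cohomology d A k = cohomology d B k"
  proof
    show "\<phi> ` cohomology d A k \<subseteq> cohomology d B k"
      using cocycles by (auto simp: cohomology_def \<phi>)
    show "cohomology d B k \<subseteq> \<phi> ` cohomology d A k"
    proof
      fix X assume "X \<in> cohomology d B k"
      then obtain u where u: "X = coh_class d B k u" "u \<in> cocycles d B k" unfolding cohomology_def by blast
      obtain w where w: "w \<in> cocycles d A k" "u - w \<in> coboundaries d B k" using surj[OF u(2)] by blast
      then have "X = \<phi> (coh_class d A k w)" unfolding u(1) \<phi> coh_class_eq_iff[OF B] by blast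
      then show "X \<in> \<phi> ` cohomology d A k" using w(1) unfolding cohomology_def by blast
    qed
  qed
  ultimately have "bij_betw \<phi> (cohomology d A k) (cohomology d B k)" by (simp add: bij_betw_def)
  moreover have "\<phi> (coh_add d A k X Y) = coh_add d B k (\<phi> X) (\<phi> Y)"
    if "X \<in> cohomology d A k" "Y \<in> cohomology d A k" for X Y
    using that by (auto simp: cohomology_def coh_add_class[OF A(2)] coh_add_class[OF B] \<phi>)
  moreover have "\<phi> (coh_scale d A k a X) = coh_scale d B k a (\<phi> X)" if "X \<in> cohomology d A k" for a X
    using that by (auto simp: cohomology_def coh_scale_class[OF A(2)] coh_scale_class[OF B] \<phi>)
  ultimately show ?thesis
    unfolding inclusion_induces_iso_def by (intro exI[of _ \<phi>] conjI ballI allI \<phi>)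
qed

lemma subspace_cocycles:
  assumes "subspace (A k)"
    and "\<And>u v. u \<in> A k \<Longrightarrow> v \<in> A k \<Longrightarrow> d k (u + v) = d k u + d k v"
    and "\<And>a u. u \<in> A k \<Longrightarrow> d k (a *\<^sub>R u) = a *\<^sub>R d k u"
  shows "subspace (cocycles d A k)"
proof (rule subspaceI)
  show "0 \<in> cocycles d A k"
    using assms(3)[OF subspace_0[OF assms(1)], of 0] subspace_0[OF assms(1)] by (simp add: cocycles_def)
qed (use assms(2,3) subspace_add[OF assms(1)] subspace_scale[OF assms(1)] in \<open>auto simp: cocycles_def\<close>)

lemma subspace_coboundaries:
  assumes "\<And>j. subspace (A j)"
    and "\<And>j u v. u \<in> A j \<Longrightarrow> v \<in> A j \<Longrightarrow> d j (u + v) = d j u + d j v"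
    and "\<And>j a u. u \<in> A j \<Longrightarrow> d j (a *\<^sub>R u) = a *\<^sub>R d j u"
  shows "subspace (coboundaries d A k)"
proof (cases k)
  case (Suc j)
  have "subspace (d j ` A j)"
  proof (rule subspaceI)
    show "0 \<in> d j ` A j"
      using assms(3)[OF subspace_0[OF assms(1)], of j 0] subspace_0[OF assms(1)] by (metis image_eqI scaleR_zero_left)
    show "x + y \<in> d j ` A j" if "x \<in> d j ` A j" "y \<in> d j ` A j" for x y
      using that assms(2)[symmetric] subspace_add[OF assms(1)] by (auto intro!: imageI)
    show "c *\<^sub>R x \<in> d j ` A j" if "x \<in> d j ` A j" for c x
      using that assms(3)[symmetric] subspace_scale[OF assms(1)] by (auto intro!: imageI)
  qed
  then show ?thesis by (simp add: coboundaries_def Suc)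
qed (simp add: coboundaries_def subspace_single_0)

lemma linear_projectorD:
  assumes "linear_projector W R P" "subspace W"
  shows "u \<in> W \<Longrightarrow> P u \<in> R" and "u \<in> R \<Longrightarrow> P u = u" and "P 0 = 0"
    and "u \<in> W \<Longrightarrow> v \<in> W \<Longrightarrow> P (u - v) = P u - P v"
proof -
  have add: "P (u + v) = P u + P v" if "u \<in> W" "v \<in> W" for u v
    using assms(1) that by (auto simp: linear_projector_def linear_map_on_def)
  have scale: "P (a *\<^sub>R u) = a *\<^sub>R P u" if "u \<in> W" for a u
    using assms(1) that by (auto simp: linear_projector_def linear_map_on_def)
  show "u \<in> W \<Longrightarrow> P u \<in> R" and "u \<in> R \<Longrightarrow> P u = u"
    using assms(1) by (auto simp: linear_projector_def)
  show "P 0 = 0" using scale[OF subspace_0[OF assms(2)], of 0] by (simp only: scaleR_zero_left)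
  show "P (u - v) = P u - P v" if "u \<in> W" "v \<in> W"
    using add[OF that(1) subspace_neg[OF assms(2) that(2)]] scale[OF that(2), of "-1"] by simp
qed

theorem proposition3p8:
  fixes \<T> :: "'v set set"
    and V :: "'v set \<Rightarrow> 'a::euclidean_space set"
    and \<rho> :: "'v set \<Rightarrow> 'v \<Rightarrow> 'a"
    and \<sigma> :: "'v set \<Rightarrow> nat \<Rightarrow> 'v"
    and \<Gamma> :: "nat \<Rightarrow> ('v, 'a) forms set"
    and \<Pi>\<^sub>\<Gamma> \<Pi>\<^sub>\<Lambda> :: "nat \<Rightarrow> ('v, 'a) forms \<Rightarrow> ('v, 'a) forms"
  assumes "abstract_simplicial_complex \<T>"
    and "vertex_numbering \<T> \<sigma>"
    and "affine_realization \<T> V \<rho>"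
    and "\<And>k. subspace (\<Gamma> k)"
    and "\<And>k. Lambda \<T> \<rho> \<sigma> k \<subseteq> \<Gamma> k"
    and "\<And>k. \<Gamma> k \<subseteq> Omega \<T> \<rho> k"
    and "\<And>k. dd \<T> \<rho> k ` \<Gamma> k \<subseteq> \<Gamma> (Suc k)"
    and "\<And>k. linear_projector (Omega \<T> \<rho> k) (\<Gamma> k) (\<Pi>\<^sub>\<Gamma> k)"
    and "\<And>k. linear_projector (Omega \<T> \<rho> k) (Lambda \<T> \<rho> \<sigma> k) (\<Pi>\<^sub>\<Lambda> k)"
    and "\<And>k u. u \<in> Omega \<T> \<rho> k \<Longrightarrow>
           \<Pi>\<^sub>\<Gamma> (Suc k) (dd \<T> \<rho> k u) = dd \<T> \<rho> k (\<Pi>\<^sub>\<Gamma> k u)"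
    and "\<And>k u. u \<in> Omega \<T> \<rho> k \<Longrightarrow>
           \<Pi>\<^sub>\<Lambda> (Suc k) (dd \<T> \<rho> k u) = dd \<T> \<rho> k (\<Pi>\<^sub>\<Lambda> k u)"
    and "\<And>k u. u \<in> Omega \<T> \<rho> k \<Longrightarrow> \<Pi>\<^sub>\<Lambda> k (\<Pi>\<^sub>\<Gamma> k u) = \<Pi>\<^sub>\<Lambda> k u"
  shows "\<forall>k. inclusion_induces_iso (dd \<T> \<rho>) (Lambda \<T> \<rho> \<sigma>) \<Gamma> k"
proof
  fix k
  let ?d = "dd \<T> \<rho>" and ?\<Lambda> = "Lambda \<T> \<rho> \<sigma>" and ?\<Omega> = "Omega \<T> \<rho>"
  interpret realization \<T> V \<rho> by (rule realization.intro[OF assms(1,3)])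
  note \<Gamma>\<Omega> = assms(6)[THEN subsetD] and \<Lambda>\<Gamma> = assms(5)[THEN subsetD]
  note \<Lambda>\<Omega> = \<Gamma>\<Omega>[OF \<Lambda>\<Gamma>]
  note P\<Gamma> = linear_projectorD[OF assms(8) subspace_Omega]
  note P\<Lambda> = linear_projectorD[OF assms(9) subspace_Omega]
  have sub\<Lambda>: "subspace (?\<Lambda> k)" for k by (simp add: Lambda_def)
  show "inclusion_induces_iso ?d ?\<Lambda> \<Gamma> k"
  proof (rule inclusion_induces_isoI)
    show "subspace (cocycles ?d ?\<Lambda> k)"
      by (intro subspace_cocycles sub\<Lambda> dd_add dd_scaleR \<Lambda>\<Omega>)
    show "subspace (coboundaries ?d ?\<Lambda> k)"
      by (intro subspace_coboundaries sub\<Lambda> dd_add dd_scaleR \<Lambda>\<Omega>)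
    show "subspace (coboundaries ?d \<Gamma> k)"
      by (intro subspace_coboundaries assms(4) dd_add dd_scaleR \<Gamma>\<Omega>)
    show "cocycles ?d ?\<Lambda> k \<subseteq> cocycles ?d \<Gamma> k"
      using \<Lambda>\<Gamma> by (auto simp: cocycles_def)
    show "coboundaries ?d ?\<Lambda> k \<subseteq> coboundaries ?d \<Gamma> k"
      using \<Lambda>\<Gamma> by (auto simp: coboundaries_def split: nat.splits)
  next
    fix u assume u: "u \<in> cocycles ?d ?\<Lambda> k" "u \<in> coboundaries ?d \<Gamma> k"
    show "u \<in> coboundaries ?d ?\<Lambda> k"
    proof (cases k)
      case (Suc j)
      then obtain z where z: "z \<in> \<Gamma> j" "u = ?d j z" using u(2) by (auto simp: coboundaries_def)
      have "u = \<Pi>\<^sub>\<Lambda> k u" using P\<Lambda>(2) u(1) by (simp add: cocycles_def)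
      also have "\<dots> = ?d j (\<Pi>\<^sub>\<Lambda> j z)" unfolding z(2) Suc by (rule assms(11)[OF \<Gamma>\<Omega>[OF z(1)]])
      finally show ?thesis using P\<Lambda>(1)[OF \<Gamma>\<Omega>[OF z(1)]] by (auto simp: coboundaries_def Suc)
    qed (use u(2) in \<open>simp add: coboundaries_def\<close>)
  next
    fix u assume "u \<in> cocycles ?d \<Gamma> k"
    then have u: "u \<in> \<Gamma> k" "?d k u = 0" by (auto simp: cocycles_def)
    obtain w v where wv: "w \<in> ?\<Lambda> k" "v \<in> ?\<Omega> (k - 1)" "u = w + ?d (k - 1) v" "k = 0 \<longrightarrow> v = 0"
      using simplicial_de_rham[OF \<Gamma>\<Omega>[OF u(1)] u(2) assms(2)] .
    \<comment> \<open>The projection of \<open>u\<close>, rather than \<open>w\<close>, is taken as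
      representative: its closedness follows from that of \<open>u\<close> by commutation with
      d.\<close>
    have "?d k (\<Pi>\<^sub>\<Lambda> k u) = 0"
      using assms(11)[OF \<Gamma>\<Omega>[OF u(1)]] P\<Lambda>(3) u(2) by simp
    then have "\<Pi>\<^sub>\<Lambda> k u \<in> cocycles ?d ?\<Lambda> k"
      using P\<Lambda>(1)[OF \<Gamma>\<Omega>[OF u(1)]] by (simp add: cocycles_def)
    moreover have "u - \<Pi>\<^sub>\<Lambda> k u \<in> coboundaries ?d \<Gamma> k"
    proof (cases k)
      case 0
      \<comment> \<open>In degree 0 the only coboundary is 0, so \<open>u\<close> has to equal its
        projection; it does, as \<open>v\<close> = 0 puts \<open>u\<close> into Lambda.\<close>
      have "?d 0 0 = 0"
        using dd_scaleR[OF subspace_0[OF subspace_Omega], of 0 0] by (simp only: scaleR_zero_left)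
      then have "u = w" using wv(3,4) 0 by simp
      then show ?thesis using P\<Lambda>(2)[OF wv(1)] 0 by (simp add: coboundaries_def)
    next
      case (Suc j)
      have v: "v \<in> ?\<Omega> j" and uw: "u - w = ?d j v" using wv(2,3) Suc by simp_all
      \<comment> \<open>The primitive \<open>v\<close> is only known to lie in Omega. As
        \<open>u\<close> and \<open>w\<close> lie in Gamma, the projector fixes their difference,
        and commutation with d moves the primitive into Gamma.\<close>
      have "u - w = \<Pi>\<^sub>\<Gamma> k (u - w)"
        using P\<Gamma>(2) subspace_diff[OF assms(4) u(1) \<Lambda>\<Gamma>[OF wv(1)]] by simp
      also have "\<dots> = ?d j (\<Pi>\<^sub>\<Gamma> j v)" unfolding uw Suc by (rule assms(10)[OF v])
      finally have 1: "u - w = ?d j (\<Pi>\<^sub>\<Gamma> j v)" .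
      have "\<Pi>\<^sub>\<Lambda> k u - w = \<Pi>\<^sub>\<Lambda> k (u - w)"
        using P\<Lambda>(4)[OF \<Gamma>\<Omega>[OF u(1)] \<Lambda>\<Omega>[OF wv(1)]] P\<Lambda>(2)[OF wv(1)] by simp
      also have "\<dots> = ?d j (\<Pi>\<^sub>\<Lambda> j v)" unfolding uw Suc by (rule assms(11)[OF v])
      finally have 2: "\<Pi>\<^sub>\<Lambda> k u - w = ?d j (\<Pi>\<^sub>\<Lambda> j v)" .
      have \<Gamma>v: "\<Pi>\<^sub>\<Gamma> j v \<in> \<Gamma> j" "\<Pi>\<^sub>\<Lambda> j v \<in> \<Gamma> j" using P\<Gamma>(1)[OF v] \<Lambda>\<Gamma>[OF P\<Lambda>(1)[OF v]] .
      have "u - \<Pi>\<^sub>\<Lambda> k u = (u - w) - (\<Pi>\<^sub>\<Lambda> k u - w)" by simp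
      also have "\<dots> \<in> coboundaries ?d \<Gamma> k"
      proof (rule subspace_diff)
        show "subspace (coboundaries ?d \<Gamma> k)"
          by (intro subspace_coboundaries assms(4) dd_add dd_scaleR \<Gamma>\<Omega>)
        show "u - w \<in> coboundaries ?d \<Gamma> k" unfolding 1 using \<Gamma>v by (simp add: coboundaries_def Suc)
        show "\<Pi>\<^sub>\<Lambda> k u - w \<in> coboundaries ?d \<Gamma> k" unfolding 2 using \<Gamma>v by (simp add: coboundaries_def Suc)
      qed
      finally show ?thesis .
    qed
    ultimately show "\<exists>w\<in>cocycles ?d ?\<Lambda> k. u - w \<in> coboundaries ?d \<Gamma> k" by blast
  qed
qed

end
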